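(* Fix $\eta\in(0,1)$, $\sigma_{\sf w}>0$ and a fixed sub-Gaussian constant $K\ge 1$. There exist positive constants $d_0,d_1,d_2$ for which the LASSO guarantee stated in the context holds, and a constant $L\ge 1$ which is only a function of $\eta$ and $\sigma_{\sf w}^2$, such that the following holds. Let $x_{-p+1},\dots,x_n$, $n<p$, be samples of an AR($p$) process with $s$-sparse parameter vector satisfying $\|\boldsymbol{\theta}\|_1\le 1-\eta$, where $s\ge 1$ and $$s\le\min\left\{\frac{1-\eta}{\sqrt{8\pi}\,\eta}\sqrt{\frac{n}{\log p}},\ \frac{n}{d_1(p\log p)^{1/2}},\ \frac{n}{d_0(\log p)^2}\right\}.$$ Let $\widehat{\boldsymbol{\theta}}_{\ell_1}$ be the $\ell_1$-regularized least squares estimator with $\gamma_n=d_2\sqrt{\log p/n}$. Then $$\mathcal{R}_{\sf est}(\widehat{\boldsymbol{\theta}}_{\ell_1})\le L\,\mathcal{R}_{\sf est}(\widehat{\boldsymbol{\theta}}_{\sf minimax}).$$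
   Context: The AR($p$) process with parameter $\boldsymbol{\theta}=(\theta_1,\dots,\theta_p)$ is the stationary process $\{x_k\}_{k\in\mathbb{Z}}$ satisfying $x_k=\sum_{\ell=1}^p\theta_\ell x_{k-\ell}+w_k$, where $\{w_k\}_{k\in\mathbb{Z}}$ are i.i.d., zero mean, variance $\sigma_{\sf w}^2$, sub-Gaussian with constant $K$: $\mathbb{E}[e^{\lambda w_k}]\le e^{K^2\sigma_{\sf w}^2\lambda^2/2}$ for all $\lambda\in\mathbb{R}$, with $K\ge1$ a fixed absolute constant (so Gaussian innovations are included). Let $\mathcal{H}$ be the class of all such processes with $s$-sparse $\boldsymbol{\theta}$ (at most $s$ nonzero entries) and $\|\boldsymbol{\theta}\|_1\le1-\eta$. An estimator $\widehat{\boldsymbol{\theta}}$ is a measurable function of the observations $x_{-p+1},\dots,x_n$, and its maximal estimation risk is $$\mathcal{R}_{\sf est}(\widehat{\boldsymbol{\theta}})=\sup_{\mathcal{H}}\left(\mathbb{E}\left[\|\widehat{\boldsymbol{\theta}}-\boldsymbol{\theta}\|_2^2\right]\right)^{1/2}.$$ The minimax estimator $\widehat{\boldsymbol{\theta}}_{\sf minimax}$ is the one minimizing $\mathcal{R}_{\sf est}$ over all estimators; $\mathcal{R}_{\sf est}(\widehat{\boldsymbol{\theta}}_{\sf minimax})$ is the infimum of $\mathcal{R}_{\sf est}$. The $\ell_1$-regularized least squares estimator $\widehat{\boldsymbol{\theta}}_{\ell_1}$ is a minimizer of $\mathfrak{L}(\boldsymbol{\vartheta})+\gamma_n\|\boldsymbol{\vartheta}\|_1$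 over $\boldsymbol{\vartheta}\in\boldsymbol{\Theta}=\{\boldsymbol{\vartheta}\in\mathbb{R}^p:\|\boldsymbol{\vartheta}\|_1<1-\eta\}$, where $\mathfrak{L}(\boldsymbol{\vartheta})=\frac1n\sum_{k=1}^n\big(x_k-\sum_{\ell=1}^p\vartheta_\ell x_{k-\ell}\big)^2$. LASSO guarantee (defining the role of $d_0,d_1,d_2$): there are positive constants $d_3,d_4$ such that, with $\boldsymbol{\theta}_s$ the best $s$-term approximation of $\boldsymbol{\theta}$ and $\sigma_s(\boldsymbol{\theta})=\|\boldsymbol{\theta}-\boldsymbol{\theta}_s\|_1=\mathcal{O}(\sqrt s)$, whenever $n<p$, $n>s\max\{d_0(\log p)^2,d_1(p\log p)^{1/2}\}$ and $\gamma_n=d_2\sqrt{\log p/n}$, every such minimizer satisfies $\|\widehat{\boldsymbol{\theta}}_{\ell_1}-\boldsymbol{\theta}\|_2\le d_3\sqrt{s\log p/n}+\sqrt{d_3\sigma_s(\boldsymbol{\theta})}\sqrt[4]{\log p/n}$ with probability greater than $1-\mathcal{O}(n^{-d_4})$; all constants are independent of $n,p,s$. Logarithms are natural.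
   Formalization: Since Θ is the open ℓ1 ball, a minimizer over Θ fails to exist for some data (with positive probability for Gaussian innovations); for such data the estimator is taken to be a minimizer over the closed ball ‖ϑ‖₁ ≤ 1−η, both in the guarantee and in the risk bound. *)

theory Defs
  imports "HOL-Probability.Probability"
begin

text \<open>
  Vectors of \<open>\<real>\<^sup>p\<close> are functions in \<open>{1..p} \<rightarrow>\<^sub>E UNIV\<close>, since \<open>p\<close>
  varies inside the statements below; their Euclidean norm is \<^const>\<open>L2_set\<close> over \<open>{1..p}\<close>.
\<close>

definition l1_norm :: "nat \<Rightarrow> (nat \<Rightarrow> real) \<Rightarrow> real" where
  "l1_norm p v = (\<Sum>l = 1..p. \<bar>v l\<bar>)"

definition sparse :: "nat \<Rightarrow> nat \<Rightarrow> (nat \<Rightarrow> real) \<Rightarrow> bool" where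
  "sparse p s v \<longleftrightarrow> card {l \<in> {1..p}. v l \<noteq> 0} \<le> s"

definition best_term_approx :: "nat \<Rightarrow> nat \<Rightarrow> (nat \<Rightarrow> real) \<Rightarrow> (nat \<Rightarrow> real) \<Rightarrow> bool" where
  "best_term_approx p s \<theta> u \<longleftrightarrow>
     is_arg_min (\<lambda>v. l1_norm p (\<lambda>l. \<theta> l - v l)) (\<lambda>v. v \<in> {1..p} \<rightarrow>\<^sub>E UNIV \<and> sparse p s v) u"


text \<open>
  \<open>AR_process M p \<theta> \<sigma> K x w\<close>: the process \<open>x\<close> is strictly stationary and solves the AR(p) equation
  almost surely for the innovations \<open>w\<close>. The integrability of \<open>exp (t w\<^sub>k)\<close> is explicit because the
  Bochner integral of a non-integrable function is 0.
\<close>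

definition AR_process ::
  "'a measure \<Rightarrow> nat \<Rightarrow> (nat \<Rightarrow> real) \<Rightarrow> real \<Rightarrow> real \<Rightarrow> (int \<Rightarrow> 'a \<Rightarrow> real) \<Rightarrow> (int \<Rightarrow> 'a \<Rightarrow> real) \<Rightarrow> bool"
where
  "AR_process M p \<theta> \<sigma> K x w \<longleftrightarrow>
     prob_space M \<and>
     (\<forall>k. x k \<in> borel_measurable M) \<and>
     (\<forall>h. distr M (PiM UNIV (\<lambda>_. borel)) (\<lambda>\<omega> k. x (k + h) \<omega>) =
          distr M (PiM UNIV (\<lambda>_. borel)) (\<lambda>\<omega> k. x k \<omega>)) \<and>
     (\<forall>k. AE \<omega> in M. x k \<omega> = (\<Sum>l = 1..p. \<theta> l * x (k - int l) \<omega>) + w k \<omega>) \<and>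
     prob_space.indep_vars M (\<lambda>_. borel) w UNIV \<and>
     (\<forall>k. distr M borel (w k) = distr M borel (w 0)) \<and>
     (\<forall>k. integrable M (w k) \<and> prob_space.expectation M (w k) = 0) \<and>
     (\<forall>k. integrable M (\<lambda>\<omega>. (w k \<omega>)\<^sup>2) \<and> prob_space.variance M (w k) = \<sigma>\<^sup>2) \<and>
     (\<forall>k t. integrable M (\<lambda>\<omega>. exp (t * w k \<omega>)) \<and>
            prob_space.expectation M (\<lambda>\<omega>. exp (t * w k \<omega>)) \<le> exp (K\<^sup>2 * \<sigma>\<^sup>2 * t\<^sup>2 / 2))"

text \<open>
  A process is represented by its parameter and its law \<open>P\<close> on the space of two-sided real sequences,
  on which \<open>x\<^sub>k\<close> is the \<open>k\<close>-th coordinate; estimation risks depend on the process only through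
  its law. The innovations are determined by the AR equation up to null sets, so the existential
  quantifier leaves no freedom.
\<close>

definition AR_laws :: "real \<Rightarrow> real \<Rightarrow> real \<Rightarrow> nat \<Rightarrow> ((nat \<Rightarrow> real) \<times> (int \<Rightarrow> real) measure) set" where
  "AR_laws \<eta> \<sigma> K p =
     {(\<theta>, P). \<theta> \<in> {1..p} \<rightarrow>\<^sub>E UNIV \<and> l1_norm p \<theta> \<le> 1 - \<eta> \<and>
             sets P = sets (PiM UNIV (\<lambda>_. borel)) \<and>
             (\<exists>w. AR_process P p \<theta> \<sigma> K (\<lambda>k \<omega>. \<omega> k) w)}"

definition sparse_AR_laws ::
  "real \<Rightarrow> real \<Rightarrow> real \<Rightarrow> nat \<Rightarrow> nat \<Rightarrow> ((nat \<Rightarrow> real) \<times> (int \<Rightarrow> real) measure) set" where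
  "sparse_AR_laws \<eta> \<sigma> K p s = {(\<theta>, P) \<in> AR_laws \<eta> \<sigma> K p. sparse p s \<theta>}"


definition obs_times :: "nat \<Rightarrow> nat \<Rightarrow> int set" where
  "obs_times n p = {- int p + 1..int n}"

definition estimators :: "nat \<Rightarrow> nat \<Rightarrow> ((int \<Rightarrow> real) \<Rightarrow> (nat \<Rightarrow> real)) set" where
  "estimators n p = PiM (obs_times n p) (\<lambda>_. borel) \<rightarrow>\<^sub>M PiM {1..p} (\<lambda>_. borel)"

definition esqrt :: "ennreal \<Rightarrow> ennreal" where
  "esqrt a = (if a = top then top else ennreal (sqrt (enn2real a)))"

definition est_risk ::
  "real \<Rightarrow> real \<Rightarrow> real \<Rightarrow> nat \<Rightarrow> nat \<Rightarrow> nat \<Rightarrow> ((int \<Rightarrow> real) \<Rightarrow> (nat \<Rightarrow> real)) \<Rightarrow> ennreal" where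
  "est_risk \<eta> \<sigma> K n p s T =
     (SUP (\<theta>, P) \<in> sparse_AR_laws \<eta> \<sigma> K p s.
        esqrt (\<integral>\<^sup>+ x. ennreal ((L2_set (\<lambda>l. T (restrict x (obs_times n p)) l - \<theta> l) {1..p})\<^sup>2) \<partial>P))"

definition minimax_risk :: "real \<Rightarrow> real \<Rightarrow> real \<Rightarrow> nat \<Rightarrow> nat \<Rightarrow> nat \<Rightarrow> ennreal" where
  "minimax_risk \<eta> \<sigma> K n p s = (INF T \<in> estimators n p. est_risk \<eta> \<sigma> K n p s T)"


definition sq_loss :: "nat \<Rightarrow> nat \<Rightarrow> (int \<Rightarrow> real) \<Rightarrow> (nat \<Rightarrow> real) \<Rightarrow> real" where
  "sq_loss n p x v =
     (1 / real n) * (\<Sum>k = 1..n. (x (int k) - (\<Sum>l = 1..p. v l * x (int k - int l)))\<^sup>2)"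

definition lasso_objective :: "nat \<Rightarrow> nat \<Rightarrow> real \<Rightarrow> (int \<Rightarrow> real) \<Rightarrow> (nat \<Rightarrow> real) \<Rightarrow> real" where
  "lasso_objective n p \<gamma> x v = sq_loss n p x v + \<gamma> * l1_norm p v"

definition lasso_params :: "real \<Rightarrow> nat \<Rightarrow> (nat \<Rightarrow> real) set" where
  "lasso_params \<eta> p = {v \<in> {1..p} \<rightarrow>\<^sub>E UNIV. l1_norm p v < 1 - \<eta>}"

definition lasso_params_closed :: "real \<Rightarrow> nat \<Rightarrow> (nat \<Rightarrow> real) set" where
  "lasso_params_closed \<eta> p = {v \<in> {1..p} \<rightarrow>\<^sub>E UNIV. l1_norm p v \<le> 1 - \<eta>}"

text \<open>
  The feasible set \<^const>\<open>lasso_params\<close> is open, so for some data (of positive probability in the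
  Gaussian case) the objective has no minimizer on it, and no estimator minimizes for all data. A
  solution is a minimizer on the open set whenever one exists; for the remaining data it is a
  minimizer on the closure, that is, a limit of a minimizing sequence.
\<close>

definition lasso_solution ::
  "real \<Rightarrow> real \<Rightarrow> nat \<Rightarrow> nat \<Rightarrow> (int \<Rightarrow> real) \<Rightarrow> (nat \<Rightarrow> real) \<Rightarrow> bool" where
  "lasso_solution \<eta> \<gamma> n p x v \<longleftrightarrow>
     (if \<exists>u. is_arg_min (lasso_objective n p \<gamma> x) (\<lambda>u. u \<in> lasso_params \<eta> p) u
      then is_arg_min (lasso_objective n p \<gamma> x) (\<lambda>u. u \<in> lasso_params \<eta> p) v
      else is_arg_min (lasso_objective n p \<gamma> x) (\<lambda>u. u \<in> lasso_params_closed \<eta> p) v)"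

definition lasso_estimators ::
  "real \<Rightarrow> real \<Rightarrow> nat \<Rightarrow> nat \<Rightarrow> ((int \<Rightarrow> real) \<Rightarrow> (nat \<Rightarrow> real)) set" where
  "lasso_estimators \<eta> \<gamma> n p =
     {T \<in> estimators n p.
        \<forall>x \<in> space (PiM (obs_times n p) (\<lambda>_. borel)). lasso_solution \<eta> \<gamma> n p x (T x)}"

definition reg_param :: "real \<Rightarrow> nat \<Rightarrow> nat \<Rightarrow> real" where
  "reg_param d2 n p = d2 * sqrt (ln (real p) / real n)"

text \<open>
  In the guarantee, \<open>A\<close> is the constant in \<open>\<sigma>\<^sub>s(\<theta>) = O(\<surd>s)\<close> and \<open>C\<close> the one in
  \<open>O(n\<^sup>-\<^sup>d\<^sup>4)\<close>. The bound holds on one measurable event \<open>E\<close> for all solutions at once.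
\<close>

definition lasso_guarantee :: "real \<Rightarrow> real \<Rightarrow> real \<Rightarrow> real \<Rightarrow> real \<Rightarrow> real \<Rightarrow> bool" where
  "lasso_guarantee \<eta> \<sigma> K d0 d1 d2 \<longleftrightarrow>
     (\<exists>d3 > 0. \<exists>d4 > 0. \<forall>A > 0. \<exists>C > 0. \<forall>n p s \<theta> P \<theta>s.
        n < p \<longrightarrow> 1 \<le> s \<longrightarrow>
        real n > real s * max (d0 * (ln (real p))\<^sup>2) (d1 * sqrt (real p * ln (real p))) \<longrightarrow>
        (\<theta>, P) \<in> AR_laws \<eta> \<sigma> K p \<longrightarrow>
        best_term_approx p s \<theta> \<theta>s \<longrightarrow>
        l1_norm p (\<lambda>l. \<theta> l - \<theta>s l) \<le> A * sqrt (real s) \<longrightarrow>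
        (\<exists>E \<in> sets P. measure P E > 1 - C * real n powr (- d4) \<and>
           (\<forall>x \<in> E. \<forall>v. lasso_solution \<eta> (reg_param d2 n p) n p x v \<longrightarrow>
              L2_set (\<lambda>l. v l - \<theta> l) {1..p}
                \<le> d3 * sqrt (real s * ln (real p) / real n)
                  + sqrt (d3 * l1_norm p (\<lambda>l. \<theta> l - \<theta>s l)) * root 4 (ln (real p) / real n))))"

end

theory Submission imports Defs begin

text \<open>A process in the class is the moving average \<open>x\<^sub>k = \<Sum>\<^sub>j \<psi>\<^sub>j w\<^bsub>k - j\<^esub>\<close> of its innovations, where
  \<open>\<Sum>\<^sub>j \<bar>\<psi>\<^sub>j\<bar> \<le> 1 / \<eta>\<close>. By convexity of the exponential, Bernstein bounds for the sums
  \<open>\<Sum>\<^sub>k w\<^bsub>k - i\<^esub> w\<^bsub>k - j\<^esub>\<close> therefore carry over to the correlation of the regressors with the noise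
  and to the Gram matrix. The standard analysis of the lasso then gives a risk of order
  \<open>\<sqrt>(s ln p / n)\<close>. When \<open>ln p / n\<close> is small enough, depending on \<open>K\<close>, only the variance term of the
  Bernstein bounds matters, so the factor in front depends on \<open>\<eta>\<close> alone.

  For the lower bound, take Gaussian innovations and \<open>s\<close> coefficients equal to
  \<open>\<sqrt>(ln p / n) / 64\<close>, at lags in \<open>(p - n, p]\<close>, one in each of \<open>s\<close> blocks of length \<open>B = n div s\<close>. The early observations regress only on the
  unobserved past, and the second moment of their likelihood relative to white noise is
  controlled by the interaction of two independent pasts. At most \<open>2 n\<close> later observations remain,
  whose regressions have a total energy of order \<open>s ln p\<close>. Hence the probability that an estimator
  hits a small ball around the parameter is at most a constant less than \<open>1\<close> plus \<open>B\<close> to the power \<open>2 s / 3\<close>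
  times the probability of the same event under white noise. The latter probabilities, summed over
  the \<open>B\<^sup>s\<close> parameters, are of order at most \<open>B\<close> to the power \<open>0.3 s\<close>, because only few
  parameters are close to any given point.\<close>

text \<open>The order of the quantifiers is an obstacle: \<open>L\<close> is fixed before
  \<open>K\<close>, while \<open>d0\<close>, \<open>d1\<close>, \<open>d2\<close> may depend on
  \<open>K\<close>. The leading constant of the upper bound is free of \<open>K\<close> because the
  noise only meets earlier values, and products of innovations at distinct times have variance
  exactly \<open>\<sigma> ^ 4\<close>. The Gram error does involve \<open>K\<close>, but it is only
  compared with the smallest eigenvalue of the covariance, so a large \<open>d1\<close> absorbs it.
  The lower bound uses Gaussian laws, which lie in the class for every \<open>K \<ge> 1\<close>.

  The estimator also sees the \<open>p\<close> values before time 1. With coefficients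
  \<open>a\<close> of order \<open>sqrt (ln p / n)\<close>, their regressions have energy of order
  \<open>p * s * a^2\<close>, which exceeds \<open>s * ln p\<close> by a factor of order
  \<open>p / n\<close>. Averaging over the unobserved past removes the first-order effect: the
  second moment of the averaged likelihood has an exponent of order
  \<open>(s * a)^2 * p * s * a^2\<close>. This is of order at most \<open>s * ln p\<close> once
  \<open>s * sqrt (p * ln p)\<close> is of order at most \<open>n\<close>, which is the sparsity
  condition with \<open>d1\<close>.\<close>

section \<open>The impulse response of the autoregression\<close>

text \<open>These are the Taylor coefficients of the inverse of the polynomial with constant term 1
  and further coefficients \<open>- \<theta> l\<close>.\<close>

fun impulse :: "nat \<Rightarrow> (nat \<Rightarrow> real) \<Rightarrow> nat \<Rightarrow> real" where
  "impulse p \<theta> j = (if j = 0 then 1 else (\<Sum>l = 1..min j p. \<theta> l * impulse p \<theta> (j - l)))"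

declare impulse.simps [simp del]

lemma impulse_0 [simp]: "impulse p \<theta> 0 = 1"
  by (simp add: impulse.simps)

text \<open>With all \<open>p\<close> lags and zero terms for \<open>l > j\<close>, the index set
  does not depend on \<open>j\<close>, so that sums over \<open>j\<close> and over lags can be
  exchanged.\<close>

lemma impulse_rec:
  assumes "0 < j"
  shows "impulse p \<theta> j = (\<Sum>l = 1..p. \<theta> l * (if l \<le> j then impulse p \<theta> (j - l) else 0))"
proof -
  have "impulse p \<theta> j = (\<Sum>l = 1..min j p. \<theta> l * impulse p \<theta> (j - l))"
    using assms by (subst impulse.simps) simp
  also have "\<dots> = (\<Sum>l = 1..p. \<theta> l * (if l \<le> j then impulse p \<theta> (j - l) else 0))"
    by (rule sum.mono_neutral_cong_left) auto
  finally show ?thesis .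
qed

text \<open>The recursion bounds each partial sum by \<open>1 + (1 - \<eta>)\<close> times the
  previous one, and \<open>1 / \<eta>\<close> is the fixed point of that map.\<close>

lemma impulse_abs_sum_le:
  assumes "l1_norm p \<theta> \<le> 1 - \<eta>" "0 < \<eta>"
  shows "(\<Sum>j<m. \<bar>impulse p \<theta> j\<bar>) \<le> 1 / \<eta>"
proof (induction m)
  case 0
  then show ?case using assms by simp
next
  case (Suc m)
  let ?S = "\<Sum>j<m. \<bar>impulse p \<theta> j\<bar>"
  have shift: "(\<Sum>j = 1..m. \<bar>if l \<le> j then impulse p \<theta> (j - l) else 0\<bar>) \<le> ?S" if "1 \<le> l" for l
  proof -
    have "(\<Sum>j = 1..m. \<bar>if l \<le> j then impulse p \<theta> (j - l) else 0\<bar>) = (\<Sum>j\<in>{l..m}. \<bar>impulse p \<theta> (j - l)\<bar>)"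
      using that by (intro sum.mono_neutral_cong_right) auto
    also have "\<dots> = (\<Sum>i\<in>(\<lambda>j. j - l) ` {l..m}. \<bar>impulse p \<theta> i\<bar>)"
      by (subst sum.reindex) (auto simp: inj_on_def)
    also have "\<dots> \<le> ?S"
      using that by (intro sum_mono2) auto
    finally show ?thesis .
  qed
  have "(\<Sum>j<Suc m. \<bar>impulse p \<theta> j\<bar>) = 1 + (\<Sum>j = 1..m. \<bar>impulse p \<theta> j\<bar>)"
    by (subst sum.lessThan_Suc_shift) (simp add: sum.atLeast1_atMost_eq)
  also have "(\<Sum>j = 1..m. \<bar>impulse p \<theta> j\<bar>)
      \<le> (\<Sum>j = 1..m. \<Sum>l = 1..p. \<bar>\<theta> l\<bar> * \<bar>if l \<le> j then impulse p \<theta> (j - l) else 0\<bar>)"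
    by (intro sum_mono, subst impulse_rec) (auto simp: abs_mult[symmetric] intro!: order_trans[OF sum_abs])
  also have "\<dots> = (\<Sum>l = 1..p. \<bar>\<theta> l\<bar> * (\<Sum>j = 1..m. \<bar>if l \<le> j then impulse p \<theta> (j - l) else 0\<bar>))"
    by (subst sum.swap) (simp add: sum_distrib_left)
  also have "\<dots> \<le> (\<Sum>l = 1..p. \<bar>\<theta> l\<bar> * ?S)"
    by (intro sum_mono mult_left_mono shift) auto
  also have "\<dots> = l1_norm p \<theta> * ?S"
    by (simp add: l1_norm_def sum_distrib_right)
  also have "\<dots> \<le> (1 - \<eta>) * (1 / \<eta>)"
    using Suc assms order_trans[OF _ assms(1), of 0]
    by (intro mult_mono) (auto simp: l1_norm_def sum_nonneg)
  also have "1 + (1 - \<eta>) * (1 / \<eta>) = 1 / \<eta>"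
    using assms by (simp add: field_simps)
  finally show ?case by simp
qed

lemma summable_abs_impulse:
  assumes "l1_norm p \<theta> \<le> 1 - \<eta>" "0 < \<eta>"
  shows "summable (\<lambda>j. \<bar>impulse p \<theta> j\<bar>)"
  by (rule bounded_imp_summable[where B = "1 / \<eta>"])
    (use impulse_abs_sum_le[OF assms, of "Suc _"] in \<open>auto simp: lessThan_Suc_atMost\<close>)

lemma sum_lag_reindex:
  fixes a :: "nat \<Rightarrow> real" and x :: "int \<Rightarrow> real"
  assumes "l \<le> p"
  shows "(\<Sum>j<m. a j * x (k - int j - int l))
       = (\<Sum>i<m+p. (if l \<le> i \<and> i - l < m then a (i - l) else 0) * x (k - int i))"
proof -
  have "(\<Sum>j<m. a j * x (k - int j - int l)) = (\<Sum>j<m. a (j + l - l) * x (k - int (j + l)))"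
    by (simp add: algebra_simps)
  also have "\<dots> = (\<Sum>i\<in>(\<lambda>j. j + l) ` {..<m}. a (i - l) * x (k - int i))"
    by (subst sum.reindex) (auto simp: inj_on_def)
  also have "(\<lambda>j. j + l) ` {..<m} = {i \<in> {..<m+p}. l \<le> i \<and> i - l < m}"
    using assms by (auto simp: image_iff) (metis le_add_diff_inverse2 lessThan_iff)
  also have "(\<Sum>i\<in>{i \<in> {..<m+p}. l \<le> i \<and> i - l < m}. a (i - l) * x (k - int i))
      = (\<Sum>i<m+p. (if l \<le> i \<and> i - l < m then a (i - l) else 0) * x (k - int i))"
    by (rule sum.mono_neutral_cong_left) auto
  finally show ?thesis .
qed

text \<open>Truncating the moving average after \<open>m\<close> terms leaves a remainder that involves only \<open>p\<close>
  values of the process; a remainder with a growing number of terms could not be controlled, because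
  the process is not assumed to have moments.\<close>

lemma impulse_truncation:
  fixes x :: "int \<Rightarrow> real"
  assumes "0 < m"
  shows "(\<Sum>j<m. impulse p \<theta> j * (x (k - int j) - (\<Sum>l = 1..p. \<theta> l * x (k - int j - int l))))
       = x k - (\<Sum>i = m..<m+p. (\<Sum>l = 1..p. \<theta> l * (if l \<le> i \<and> i - l < m then impulse p \<theta> (i - l) else 0)) * x (k - int i))"
proof -
  define c where "c i = (\<Sum>l = 1..p. \<theta> l * (if l \<le> i \<and> i - l < m then impulse p \<theta> (i - l) else 0))" for i
  have "(\<Sum>j<m. impulse p \<theta> j * (\<Sum>l = 1..p. \<theta> l * x (k - int j - int l)))
      = (\<Sum>l = 1..p. \<theta> l * (\<Sum>j<m. impulse p \<theta> j * x (k - int j - int l)))"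
    by (simp add: sum_distrib_left mult_ac) (rule sum.swap)
  also have "\<dots> = (\<Sum>l = 1..p. \<theta> l * (\<Sum>i<m+p. (if l \<le> i \<and> i - l < m then impulse p \<theta> (i - l) else 0) * x (k - int i)))"
    by (intro sum.cong refl arg_cong2[where f = "(*)"] sum_lag_reindex) auto
  also have "\<dots> = (\<Sum>i<m+p. c i * x (k - int i))"
    unfolding c_def sum_distrib_left sum_distrib_right by (subst sum.swap) (simp add: mult_ac)
  also have "\<dots> = (\<Sum>i<m. c i * x (k - int i)) + (\<Sum>i = m..<m+p. c i * x (k - int i))"
    by (simp add: lessThan_atLeast0 sum.atLeastLessThan_concat)
  \<comment> \<open>Below \<open>m\<close> the restriction \<open>i - l < m\<close> is vacuous, so
    \<open>c i\<close> is the impulse response by its recursion, except at \<open>i = 0\<close>,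
    where \<open>c i\<close> is 0. That missing term is the \<open>x k\<close> that survives the
    cancellation.\<close>
  also have "(\<Sum>i<m. c i * x (k - int i)) = (\<Sum>i<m. (if i = 0 then 0 else impulse p \<theta> i) * x (k - int i))"
  proof (intro sum.cong refl arg_cong2[where f = "(*)"])
    fix i assume i: "i \<in> {..<m}"
    show "c i = (if i = 0 then 0 else impulse p \<theta> i)"
    proof (cases "i = 0")
      case True then show ?thesis by (simp add: c_def)
    next
      case False
      then show ?thesis using i unfolding c_def
        by (subst impulse_rec) (auto intro!: sum.cong)
    qed
  qed
  finally have *: "(\<Sum>j<m. impulse p \<theta> j * (\<Sum>l = 1..p. \<theta> l * x (k - int j - int l)))
     = (\<Sum>i<m. (if i = 0 then 0 else impulse p \<theta> i) * x (k - int i)) + (\<Sum>i = m..<m+p. c i * x (k - int i))" .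
  have "(\<Sum>i<m. impulse p \<theta> i * x (k - int i)) - (\<Sum>i<m. (if i = 0 then 0 else impulse p \<theta> i) * x (k - int i))
     = (\<Sum>i<m. if i = 0 then x k else 0)"
    unfolding sum_subtractf[symmetric] by (intro sum.cong) auto
  also have "\<dots> = x k" using assms by simp
  finally show ?thesis
    unfolding right_diff_distrib sum_subtractf * c_def[symmetric] by simp
qed

subsection \<open>The moving average representation\<close>

text \<open>By Tonelli the expected sum is the sum of the \<open>\<bar>a j\<bar>\<close> times the
  common first absolute moment \<open>C\<close>. The general form also serves for the coordinates of
  a Gaussian product space, when the laws of the lower bound are built.\<close>

lemma AE_summable_ma:
  fixes a :: "nat \<Rightarrow> real" and w :: "int \<Rightarrow> 'a \<Rightarrow> real"
  assumes [measurable]: "\<And>k. w k \<in> borel_measurable M"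
    and C: "\<And>k. (\<integral>\<^sup>+\<omega>. ennreal \<bar>w k \<omega>\<bar> \<partial>M) = C" "C < \<infinity>" and a: "summable (\<lambda>j. \<bar>a j\<bar>)"
  shows "AE \<omega> in M. \<forall>k. summable (\<lambda>j. \<bar>a j * w (k - int j) \<omega>\<bar>)"
  unfolding AE_all_countable
proof
  fix k
  have "(\<integral>\<^sup>+\<omega>. (\<Sum>j. ennreal \<bar>a j * w (k - int j) \<omega>\<bar>) \<partial>M) = (\<Sum>j. \<integral>\<^sup>+\<omega>. ennreal \<bar>a j * w (k - int j) \<omega>\<bar> \<partial>M)"
    by (rule nn_integral_suminf) measurable
  also have "\<dots> = (\<Sum>j. ennreal \<bar>a j\<bar> * C)"
    by (intro suminf_cong) (simp add: abs_mult ennreal_mult nn_integral_cmult C(1))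
  also have "\<dots> = (\<Sum>j. ennreal \<bar>a j\<bar>) * C"
    by (rule ennreal_suminf_multc)
  also have "\<dots> = ennreal (\<Sum>j. \<bar>a j\<bar>) * C"
    using a by (simp add: suminf_ennreal2)
  also have "\<dots> < \<infinity>" using C(2) by (simp add: ennreal_mult_less_top)
  finally have "AE \<omega> in M. (\<Sum>j. ennreal \<bar>a j * w (k - int j) \<omega>\<bar>) \<noteq> \<infinity>"
    by (intro nn_integral_PInf_AE) auto
  then show "AE \<omega> in M. summable (\<lambda>j. \<bar>a j * w (k - int j) \<omega>\<bar>)"
    by eventually_elim (auto intro: summable_suminf_not_top)
qed

locale ar_proc =
  fixes M :: "'a measure" and p :: nat and \<theta> :: "nat \<Rightarrow> real" and \<sigma> K \<eta> :: real
    and x w :: "int \<Rightarrow> 'a \<Rightarrow> real"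
  assumes ar: "AR_process M p \<theta> \<sigma> K x w"
    and l1: "l1_norm p \<theta> \<le> 1 - \<eta>" and eta: "0 < \<eta>" and sigma: "0 < \<sigma>"
begin

sublocale prob_space M
  using ar by (simp add: AR_process_def)

abbreviation psi where "psi \<equiv> impulse p \<theta>"

lemma x_meas [measurable]: "x k \<in> borel_measurable M"
  using ar by (simp add: AR_process_def)

lemma w_indep: "indep_vars (\<lambda>_. borel) w UNIV"
  using ar by (simp add: AR_process_def)

lemma w_meas [measurable]: "w k \<in> borel_measurable M"
  using w_indep by (simp add: indep_vars_def)

lemma ar_eq: "AE \<omega> in M. \<forall>k. x k \<omega> = (\<Sum>l = 1..p. \<theta> l * x (k - int l) \<omega>) + w k \<omega>"
  using ar by (simp add: AR_process_def AE_all_countable)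

lemma nn_integral_shift:
  assumes [measurable]: "f \<in> borel_measurable (PiM UNIV (\<lambda>_::int. borel))"
  shows "(\<integral>\<^sup>+\<omega>. f (\<lambda>k. x (k + h) \<omega>) \<partial>M) = (\<integral>\<^sup>+\<omega>. f (\<lambda>k. x k \<omega>) \<partial>M)"
proof -
  have m: "(\<lambda>\<omega> k. x (k + h) \<omega>) \<in> M \<rightarrow>\<^sub>M PiM UNIV (\<lambda>_. borel)" for h
    by (rule measurable_PiM_single') auto
  have "distr M (PiM UNIV (\<lambda>_. borel)) (\<lambda>\<omega> k. x (k + h) \<omega>) = distr M (PiM UNIV (\<lambda>_. borel)) (\<lambda>\<omega> k. x k \<omega>)"
    using ar by (simp add: AR_process_def)
  then have "integral\<^sup>N (distr M (PiM UNIV (\<lambda>_. borel)) (\<lambda>\<omega> k. x (k + h) \<omega>)) f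
     = integral\<^sup>N (distr M (PiM UNIV (\<lambda>_. borel)) (\<lambda>\<omega> k. x k \<omega>)) f" by simp
  then show ?thesis
    using m[of h] m[of 0] by (simp add: nn_integral_distr)
qed

lemma nn_integral_x:
  assumes [measurable]: "f \<in> borel_measurable borel"
  shows "(\<integral>\<^sup>+\<omega>. f (x k \<omega>) \<partial>M) = (\<integral>\<^sup>+\<omega>. f (x 0 \<omega>) \<partial>M)"
  using nn_integral_shift[of "\<lambda>y. f (y 0)" k] by simp

lemma nn_integral_w:
  assumes [measurable]: "f \<in> borel_measurable borel"
  shows "(\<integral>\<^sup>+\<omega>. f (w k \<omega>) \<partial>M) = (\<integral>\<^sup>+\<omega>. f (w 0 \<omega>) \<partial>M)"
proof -
  have "distr M borel (w k) = distr M borel (w 0)"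
    using ar by (simp add: AR_process_def)
  then have "integral\<^sup>N (distr M borel (w k)) f = integral\<^sup>N (distr M borel (w 0)) f" by simp
  then show ?thesis by (simp add: nn_integral_distr)
qed

lemma psi_sum: "(\<Sum>j<m. \<bar>psi j\<bar>) \<le> 1 / \<eta>"
  using impulse_abs_sum_le[OF l1 eta] .

lemma psi_summable: "summable (\<lambda>j. \<bar>psi j\<bar>)"
  using summable_abs_impulse[OF l1 eta] .

lemma w_int: "integrable M (w k)" and w_mean: "expectation (w k) = 0"
  and w_sq_int: "integrable M (\<lambda>\<omega>. (w k \<omega>)\<^sup>2)" and w_var: "expectation (\<lambda>\<omega>. (w k \<omega>)\<^sup>2) = \<sigma>\<^sup>2"
  using ar by (auto simp: AR_process_def)

lemma psi_w_summable: "AE \<omega> in M. \<forall>k. summable (\<lambda>j. \<bar>psi j * w (k - int j) \<omega>\<bar>)"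
proof (rule AE_summable_ma)
  show "(\<integral>\<^sup>+\<omega>. ennreal \<bar>w k \<omega>\<bar> \<partial>M) = (\<integral>\<^sup>+\<omega>. ennreal \<bar>w 0 \<omega>\<bar> \<partial>M)" for k
    by (rule nn_integral_w[of "\<lambda>t. ennreal \<bar>t\<bar>"]) measurable
  show "(\<integral>\<^sup>+\<omega>. ennreal \<bar>w 0 \<omega>\<bar> \<partial>M) < \<infinity>"
    using w_int[of 0] by (simp add: integrable_iff_bounded)
qed (auto intro: psi_summable)

text \<open>After \<open>m\<close> terms the remainder consists of \<open>p\<close> values of the
  process with coefficients at most \<open>e\<close> in absolute value, once \<open>m\<close> is
  large. By stationarity the size of these values, measured through \<open>phi\<close>, does not
  depend on their times, and it tends to 0 with \<open>e\<close>. By Fatou the limit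
  \<open>D\<close> of the remainders vanishes almost surely.\<close>

lemma ma_sums: "AE \<omega> in M. \<forall>k. (\<lambda>j. psi j * w (k - int j) \<omega>) sums x k \<omega>"
  unfolding AE_all_countable
proof
  fix k
  define y where "y \<omega> = (\<Sum>j. psi j * w (k - int j) \<omega>)" for \<omega>
  have [measurable]: "y \<in> borel_measurable M" unfolding y_def by measurable
  define D where "D \<omega> = x k \<omega> - y \<omega>" for \<omega>
  have [measurable]: "D \<in> borel_measurable M" unfolding D_def by measurable
  define r where "r m \<omega> = x k \<omega> - (\<Sum>j<m. psi j * w (k - int j) \<omega>)" for m \<omega>
  have [measurable]: "r m \<in> borel_measurable M" for m unfolding r_def by measurable
  \<comment> \<open>Bounded and subadditive: \<open>p\<close> summands can be estimated one by one
    although no moment of \<open>x\<close> is known yet.\<close>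
  define phi where "phi t = ennreal (min 1 \<bar>t\<bar>)" for t :: real
  have phim [measurable]: "phi \<in> borel_measurable borel" unfolding phi_def by measurable
  have lim: "AE \<omega> in M. (\<lambda>m. r m \<omega>) \<longlonglongrightarrow> D \<omega>"
    using psi_w_summable
  proof eventually_elim
    case (elim \<omega>)
    then have "summable (\<lambda>j. \<bar>psi j * w (k - int j) \<omega>\<bar>)" by (rule spec)
    then have "summable (\<lambda>j. psi j * w (k - int j) \<omega>)"
      by (rule summable_rabs_cancel)
    then have "(\<lambda>m. \<Sum>j<m. psi j * w (k - int j) \<omega>) \<longlonglongrightarrow> y \<omega>"
      unfolding y_def by (rule summable_LIMSEQ)
    then show ?case unfolding r_def D_def by (intro tendsto_intros)
  qed
  have phi_sum: "phi (sum f I) \<le> (\<Sum>i\<in>I. phi (f i))" if "finite I" for f :: "nat \<Rightarrow> real" and I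
    using that
  proof (induction I)
    case (insert i I)
    have "phi (a + b) \<le> phi a + phi b" for a b
    proof -
      have "min 1 \<bar>a + b\<bar> \<le> min 1 \<bar>a\<bar> + min 1 \<bar>b\<bar>" by linarith
      then show ?thesis
        unfolding phi_def by (simp add: ennreal_plus[symmetric] ennreal_leI del: ennreal_plus)
    qed
    then have "phi (f i + sum f I) \<le> phi (f i) + phi (sum f I)" .
    also have "\<dots> \<le> phi (f i) + (\<Sum>i\<in>I. phi (f i))" by (intro add_left_mono insert.IH)
    finally show ?case using insert.hyps by simp
  qed (simp add: phi_def)
  have bound: "(\<integral>\<^sup>+\<omega>. phi (D \<omega>) \<partial>M) \<le> of_nat p * (\<integral>\<^sup>+\<omega>. phi (e * x 0 \<omega>) \<partial>M)" if "0 < e" for e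
  proof -
    from psi_summable have "(\<lambda>j. \<bar>psi j\<bar>) \<longlonglongrightarrow> 0" by (rule summable_LIMSEQ_zero)
    then have "eventually (\<lambda>j. \<bar>psi j\<bar> < e) sequentially"
      using that by (auto dest: order_tendstoD)
    then obtain N where N: "\<And>j. j \<ge> N \<Longrightarrow> \<bar>psi j\<bar> \<le> e"
      by (auto simp: eventually_sequentially intro: less_imp_le)
    \<comment> \<open>The margin \<open>p + 1\<close> keeps \<open>i - l\<close> beyond
      \<open>N\<close> for every \<open>i \<ge> m\<close> and every lag
      \<open>l \<le> p\<close>.\<close>
    have le: "(\<integral>\<^sup>+\<omega>. phi (r m \<omega>) \<partial>M) \<le> of_nat p * (\<integral>\<^sup>+\<omega>. phi (e * x 0 \<omega>) \<partial>M)" if m: "m \<ge> N + p + 1" for m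
    proof -
      define c where "c i = (\<Sum>l = 1..p. \<theta> l * (if l \<le> i \<and> i - l < m then psi (i - l) else 0))" for i
      have c: "\<bar>c i\<bar> \<le> e" if "i \<ge> m" for i
      proof -
        have "\<bar>c i\<bar> \<le> (\<Sum>l = 1..p. \<bar>\<theta> l\<bar> * e)"
          unfolding c_def using N[of "i - _"] m \<open>0 < e\<close> \<open>i \<ge> m\<close>
          by (intro order_trans[OF sum_abs] sum_mono) (auto simp: abs_mult intro!: mult_left_mono)
        also have "\<dots> = l1_norm p \<theta> * e" by (simp add: l1_norm_def sum_distrib_right)
        also have "\<dots> \<le> 1 * e" using l1 eta \<open>0 < e\<close> by (intro mult_right_mono) auto
        finally show ?thesis by simp
      qed
      have "AE \<omega> in M. r m \<omega> = (\<Sum>i = m..<m+p. c i * x (k - int i) \<omega>)"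
        using ar_eq
      proof eventually_elim
        case (elim \<omega>)
        have *: "w (k - int j) \<omega> = x (k - int j) \<omega> - (\<Sum>l = 1..p. \<theta> l * x (k - int j - int l) \<omega>)" for j
          using spec[OF elim, of "k - int j"] by linarith
        show ?case
          using impulse_truncation[of m p \<theta> "\<lambda>k. x k \<omega>" k] m unfolding r_def c_def * by simp
      qed
      then have "(\<integral>\<^sup>+\<omega>. phi (r m \<omega>) \<partial>M) = (\<integral>\<^sup>+\<omega>. phi (\<Sum>i = m..<m+p. c i * x (k - int i) \<omega>) \<partial>M)"
        by (intro nn_integral_cong_AE) auto
      also have "\<dots> \<le> (\<integral>\<^sup>+\<omega>. (\<Sum>i = m..<m+p. phi (e * x (k - int i) \<omega>)) \<partial>M)"
      proof (intro nn_integral_mono order_trans[OF phi_sum] sum_mono)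
        fix \<omega> i assume "i \<in> {m..<m+p}"
        then have "\<bar>c i * x (k - int i) \<omega>\<bar> \<le> \<bar>e * x (k - int i) \<omega>\<bar>"
          unfolding abs_mult using c[of i] \<open>0 < e\<close> by (intro mult_right_mono) auto
        then show "phi (c i * x (k - int i) \<omega>) \<le> phi (e * x (k - int i) \<omega>)"
          unfolding phi_def by (intro ennreal_leI) auto
      qed auto
      also have "\<dots> = (\<Sum>i = m..<m+p. (\<integral>\<^sup>+\<omega>. phi (e * x (k - int i) \<omega>) \<partial>M))"
        by (rule nn_integral_sum) measurable
      also have "\<dots> = (\<Sum>i = m..<m+p. (\<integral>\<^sup>+\<omega>. phi (e * x 0 \<omega>) \<partial>M))"
        by (intro sum.cong refl) (rule nn_integral_x, measurable)
      also have "\<dots> = of_nat p * (\<integral>\<^sup>+\<omega>. phi (e * x 0 \<omega>) \<partial>M)" by simp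
      finally show ?thesis .
    qed
    have "(\<integral>\<^sup>+\<omega>. phi (D \<omega>) \<partial>M) = (\<integral>\<^sup>+\<omega>. liminf (\<lambda>m. phi (r m \<omega>)) \<partial>M)"
    proof (intro nn_integral_cong_AE)
      show "AE \<omega> in M. phi (D \<omega>) = liminf (\<lambda>m. phi (r m \<omega>))"
        using lim
      proof eventually_elim
        case (elim \<omega>)
        then have "(\<lambda>m. phi (r m \<omega>)) \<longlonglongrightarrow> phi (D \<omega>)"
          unfolding phi_def by (intro tendsto_ennrealI tendsto_intros)
        then show ?case by (simp add: lim_imp_Liminf)
      qed
    qed
    also have "\<dots> \<le> liminf (\<lambda>m. \<integral>\<^sup>+\<omega>. phi (r m \<omega>) \<partial>M)"
      by (rule nn_integral_liminf) measurable
    also have "\<dots> \<le> of_nat p * (\<integral>\<^sup>+\<omega>. phi (e * x 0 \<omega>) \<partial>M)"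
    proof (rule order_trans[OF Liminf_le_Limsup], simp, rule Limsup_bounded)
      show "\<forall>\<^sub>F m in sequentially. (\<integral>\<^sup>+\<omega>. phi (r m \<omega>) \<partial>M) \<le> of_nat p * (\<integral>\<^sup>+\<omega>. phi (e * x 0 \<omega>) \<partial>M)"
        using le by (auto simp: eventually_sequentially)
    qed
    finally show ?thesis .
  qed
  have "(\<lambda>n. \<integral>\<^sup>+\<omega>. phi (1 / real (Suc n) * x 0 \<omega>) \<partial>M) \<longlonglongrightarrow> (\<integral>\<^sup>+\<omega>. 0 \<partial>M)"
  proof (rule nn_integral_dominated_convergence[where w = "\<lambda>_. 1"])
    show "AE \<omega> in M. (\<lambda>n. phi (1 / real (Suc n) * x 0 \<omega>)) \<longlonglongrightarrow> 0"
    proof (intro AE_I2)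
      fix \<omega>
      have "(\<lambda>n. phi (1 / real (Suc n) * x 0 \<omega>)) \<longlonglongrightarrow> phi (0 * x 0 \<omega>)"
        unfolding phi_def by (intro tendsto_ennrealI tendsto_intros LIMSEQ_Suc[OF lim_1_over_n])
      then show "(\<lambda>n. phi (1 / real (Suc n) * x 0 \<omega>)) \<longlonglongrightarrow> 0" by (simp add: phi_def)
    qed
    show "AE \<omega> in M. phi (1 / real (Suc j) * x 0 \<omega>) \<le> 1" for j
      by (auto simp: phi_def)
  qed (auto simp: emeasure_space_1)
  then have "(\<lambda>n. of_nat p * (\<integral>\<^sup>+\<omega>. phi (1 / real (Suc n) * x 0 \<omega>) \<partial>M)) \<longlonglongrightarrow> of_nat p * 0"
    by (intro ennreal_tendsto_cmult) (auto simp: ennreal_of_nat_eq_real_of_nat)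
  then have "(\<integral>\<^sup>+\<omega>. phi (D \<omega>) \<partial>M) \<le> of_nat p * 0"
    by (rule LIMSEQ_le_const) (intro exI[of _ 0] allI impI bound, simp)
  then have "AE \<omega> in M. phi (D \<omega>) = 0"
    by (simp add: nn_integral_0_iff_AE)
  then show "AE \<omega> in M. (\<lambda>j. psi j * w (k - int j) \<omega>) sums x k \<omega>"
    using psi_w_summable
  proof eventually_elim
    case (elim \<omega>)
    then have "D \<omega> = 0" by (auto simp: phi_def min_def ennreal_eq_0_iff split: if_splits)
    moreover have "summable (\<lambda>j. psi j * w (k - int j) \<omega>)"
      by (rule summable_rabs_cancel) (rule spec[OF elim(2)])
    ultimately show ?case
      by (simp add: D_def y_def summable_sums)
  qed
qed

end

subsection \<open>Exponential moments\<close>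

text \<open>Jensen's inequality with weights \<open>\<bar>c i\<bar> / \<Psi>\<close> at the points
  \<open>y i\<close> and the remaining mass at 0. The proof averages the tangent of the exponential
  at the barycentre \<open>z\<close>.\<close>

lemma exp_sum_le_convex:
  fixes c V :: "'i \<Rightarrow> real"
  assumes "(\<Sum>i\<in>I. \<bar>c i\<bar>) \<le> \<Psi>" "0 < \<Psi>"
  shows "exp (\<kappa> * (\<Sum>i\<in>I. c i * V i))
     \<le> (\<Sum>i\<in>I. \<bar>c i\<bar> / \<Psi> * exp (sgn (c i) * \<kappa> * \<Psi> * V i)) + (1 - (\<Sum>i\<in>I. \<bar>c i\<bar>) / \<Psi>)"
proof -
  define z where "z = \<kappa> * (\<Sum>i\<in>I. c i * V i)"
  define y where "y i = sgn (c i) * \<kappa> * \<Psi> * V i" for i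
  have tangent: "exp z * (1 + t - z) \<le> exp t" for t
    using exp_ge_add_one_self[of "t - z"] by (simp add: exp_diff field_simps)
  have "\<bar>c i\<bar> / \<Psi> * y i = \<kappa> * (c i * V i)" for i
    using assms(2) by (simp add: y_def abs_mult_sgn mult_ac)
  then have "(\<Sum>i\<in>I. \<bar>c i\<bar> / \<Psi> * y i) = z"
    by (simp add: z_def sum_distrib_left)
  moreover have "(\<Sum>i\<in>I. \<bar>c i\<bar> / \<Psi> * (exp z * (1 + y i - z)))
     = (\<Sum>i\<in>I. exp z * (1 - z) * (\<bar>c i\<bar> / \<Psi>) + exp z * (\<bar>c i\<bar> / \<Psi> * y i))"
    by (intro sum.cong refl) (simp add: algebra_simps)
  moreover have "\<dots> = exp z * (1 - z) * ((\<Sum>i\<in>I. \<bar>c i\<bar>) / \<Psi>) + exp z * (\<Sum>i\<in>I. \<bar>c i\<bar> / \<Psi> * y i)"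
    unfolding sum.distrib sum_distrib_left[symmetric] sum_divide_distrib[symmetric] by simp
  ultimately have "exp z = (\<Sum>i\<in>I. \<bar>c i\<bar> / \<Psi> * (exp z * (1 + y i - z))) + (1 - (\<Sum>i\<in>I. \<bar>c i\<bar>) / \<Psi>) * (exp z * (1 + 0 - z))"
    by (simp add: algebra_simps)
  also have "\<dots> \<le> (\<Sum>i\<in>I. \<bar>c i\<bar> / \<Psi> * exp (y i)) + (1 - (\<Sum>i\<in>I. \<bar>c i\<bar>) / \<Psi>) * exp 0"
    using assms by (intro add_mono sum_mono mult_left_mono tangent) auto
  finally show ?thesis by (simp add: z_def y_def)
qed

text \<open>Cauchy-Schwarz after splitting \<open>\<bar>c i\<bar>\<close> into two square roots; the
  quadratic counterpart of the preceding bound.\<close>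

lemma square_sum_le_convex:
  fixes c V :: "'i \<Rightarrow> real"
  assumes "(\<Sum>i\<in>I. \<bar>c i\<bar>) \<le> \<Psi>"
  shows "(\<Sum>i\<in>I. c i * V i)\<^sup>2 \<le> (\<Sum>i\<in>I. \<bar>c i\<bar> * \<Psi> * (V i)\<^sup>2)"
proof -
  have "(\<Sum>i\<in>I. c i * V i) = (\<Sum>i\<in>I. (sgn (c i) * sqrt \<bar>c i\<bar>) * (sqrt \<bar>c i\<bar> * V i))"
    by (intro sum.cong refl) (simp add: sgn_if)
  also have "\<dots>\<^sup>2 \<le> (\<Sum>i\<in>I. (sgn (c i) * sqrt \<bar>c i\<bar>)\<^sup>2) * (\<Sum>i\<in>I. (sqrt \<bar>c i\<bar> * V i)\<^sup>2)"
    by (rule Cauchy_Schwarz_ineq_sum)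
  also have "(\<Sum>i\<in>I. (sgn (c i) * sqrt \<bar>c i\<bar>)\<^sup>2) = (\<Sum>i\<in>I. \<bar>c i\<bar>)"
    by (intro sum.cong refl) (auto simp: power_mult_distrib sgn_if)
  also have "(\<Sum>i\<in>I. \<bar>c i\<bar>) * (\<Sum>i\<in>I. (sqrt \<bar>c i\<bar> * V i)\<^sup>2) \<le> \<Psi> * (\<Sum>i\<in>I. (sqrt \<bar>c i\<bar> * V i)\<^sup>2)"
    using assms by (intro mult_right_mono sum_nonneg) auto
  also have "\<dots> = (\<Sum>i\<in>I. \<bar>c i\<bar> * \<Psi> * (V i)\<^sup>2)"
    by (simp add: sum_distrib_left power_mult_distrib mult_ac)
  finally show ?thesis .
qed

text \<open>Fatou's lemma, in the form that carries moment bounds for truncated moving averages over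
  to the process.\<close>

lemma nn_integral_lim_le:
  fixes X :: "nat \<Rightarrow> 'a \<Rightarrow> real" and f :: "real \<Rightarrow> real"
  assumes [measurable]: "\<And>m. X m \<in> borel_measurable M"
    and lim: "AE \<omega> in M. (\<lambda>m. X m \<omega>) \<longlonglongrightarrow> Y \<omega>"
    and f: "continuous_on UNIV f"
    and bound: "\<And>m. (\<integral>\<^sup>+\<omega>. ennreal (f (X m \<omega>)) \<partial>M) \<le> R"
  shows "(\<integral>\<^sup>+\<omega>. ennreal (f (Y \<omega>)) \<partial>M) \<le> R"
proof -
  have [measurable]: "f \<in> borel_measurable borel" using f by (rule borel_measurable_continuous_onI)
  have "(\<integral>\<^sup>+\<omega>. ennreal (f (Y \<omega>)) \<partial>M) = (\<integral>\<^sup>+\<omega>. liminf (\<lambda>m. ennreal (f (X m \<omega>))) \<partial>M)"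
  proof (intro nn_integral_cong_AE)
    show "AE \<omega> in M. ennreal (f (Y \<omega>)) = liminf (\<lambda>m. ennreal (f (X m \<omega>)))"
      using lim
    proof eventually_elim
      case (elim \<omega>)
      then have "(\<lambda>m. ennreal (f (X m \<omega>))) \<longlonglongrightarrow> ennreal (f (Y \<omega>))"
        by (intro tendsto_ennrealI continuous_on_tendsto_compose[OF f]) auto
      then show ?case by (simp add: lim_imp_Liminf)
    qed
  qed
  also have "\<dots> \<le> liminf (\<lambda>m. \<integral>\<^sup>+\<omega>. ennreal (f (X m \<omega>)) \<partial>M)"
    by (rule nn_integral_liminf) measurable
  also have "\<dots> \<le> R"
    by (rule order_trans[OF Liminf_le_Limsup]) (auto intro!: Limsup_bounded always_eventually bound)
  finally show ?thesis .
qed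

lemma power_div_fact_le_exp:
  fixes x :: real assumes "0 \<le> x" shows "x ^ n / fact n \<le> exp x"
proof -
  obtain t where "exp x = (\<Sum>m<Suc n. (x ^ m) / fact m) + (exp t / fact (Suc n)) * x ^ Suc n"
    using Maclaurin_exp_le[of x "Suc n"] by blast
  moreover have "0 \<le> (exp t / fact (Suc n)) * x ^ Suc n" using assms by simp
  moreover have "x ^ n / fact n \<le> (\<Sum>m<Suc n. (x ^ m) / fact m)"
    using assms by (simp add: sum_nonneg)
  ultimately show ?thesis by linarith
qed

context prob_space begin

text \<open>The \<open>V i\<close> may depend on each other arbitrarily: convexity transfers a bound
  valid for each of them at \<open>\<kappa> * \<Psi>\<close>, for both signs, to their combination.
  \<open>1 \<le> R\<close> pays for the mass placed at 0 and for indices with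
  \<open>c i = 0\<close>.\<close>

lemma nn_integral_exp_sum_le:
  fixes V :: "'i \<Rightarrow> 'a \<Rightarrow> real"
  assumes c: "(\<Sum>i\<in>I. \<bar>c i\<bar>) \<le> \<Psi>" "0 < \<Psi>" and "1 \<le> R"
    and [measurable]: "\<And>i. i \<in> I \<Longrightarrow> V i \<in> borel_measurable M"
    and V: "\<And>i. i \<in> I \<Longrightarrow> (\<integral>\<^sup>+\<omega>. ennreal (exp (\<kappa> * \<Psi> * V i \<omega>)) \<partial>M) \<le> ennreal R"
      "\<And>i. i \<in> I \<Longrightarrow> (\<integral>\<^sup>+\<omega>. ennreal (exp (- \<kappa> * \<Psi> * V i \<omega>)) \<partial>M) \<le> ennreal R"
  shows "(\<integral>\<^sup>+\<omega>. ennreal (exp (\<kappa> * (\<Sum>i\<in>I. c i * V i \<omega>))) \<partial>M) \<le> ennreal R"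
proof -
  have sg: "(\<integral>\<^sup>+\<omega>. ennreal (exp (sgn (c i) * \<kappa> * \<Psi> * V i \<omega>)) \<partial>M) \<le> ennreal R" if "i \<in> I" for i
    using V[OF that] \<open>1 \<le> R\<close> by (cases "c i" "0 :: real" rule: linorder_cases) (auto simp: emeasure_space_1)
  have nn: "0 \<le> 1 - (\<Sum>i\<in>I. \<bar>c i\<bar>) / \<Psi>" using c by simp
  have "(\<integral>\<^sup>+\<omega>. ennreal (exp (\<kappa> * (\<Sum>i\<in>I. c i * V i \<omega>))) \<partial>M)
     \<le> (\<integral>\<^sup>+\<omega>. (\<Sum>i\<in>I. ennreal (\<bar>c i\<bar> / \<Psi>) * ennreal (exp (sgn (c i) * \<kappa> * \<Psi> * V i \<omega>)))
           + ennreal (1 - (\<Sum>i\<in>I. \<bar>c i\<bar>) / \<Psi>) \<partial>M)"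
    using c nn
    by (intro nn_integral_mono order_trans[OF ennreal_leI[OF exp_sum_le_convex[OF c]]])
      (simp add: ennreal_mult'[symmetric] sum_ennreal ennreal_plus[symmetric] sum_nonneg del: ennreal_plus)
  also have "\<dots> = (\<Sum>i\<in>I. ennreal (\<bar>c i\<bar> / \<Psi>) * (\<integral>\<^sup>+\<omega>. ennreal (exp (sgn (c i) * \<kappa> * \<Psi> * V i \<omega>)) \<partial>M))
        + ennreal (1 - (\<Sum>i\<in>I. \<bar>c i\<bar>) / \<Psi>)"
    by (subst nn_integral_add) (auto simp: nn_integral_sum nn_integral_cmult emeasure_space_1)
  also have "\<dots> \<le> (\<Sum>i\<in>I. ennreal (\<bar>c i\<bar> / \<Psi>) * ennreal R) + ennreal (1 - (\<Sum>i\<in>I. \<bar>c i\<bar>) / \<Psi>) * ennreal R"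
    using nn \<open>1 \<le> R\<close> mult_left_mono[OF \<open>1 \<le> R\<close> nn]
    by (intro add_mono sum_mono mult_left_mono sg) (auto simp: ennreal_mult[symmetric] intro!: ennreal_leI)
  also have "\<dots> = ennreal ((\<Sum>i\<in>I. \<bar>c i\<bar> / \<Psi> * R) + (1 - (\<Sum>i\<in>I. \<bar>c i\<bar>) / \<Psi>) * R)"
    using nn c(2) \<open>1 \<le> R\<close>
    by (simp add: ennreal_mult[symmetric] sum_ennreal ennreal_plus[symmetric] sum_nonneg del: ennreal_plus)
  also have "(\<Sum>i\<in>I. \<bar>c i\<bar> / \<Psi> * R) + (1 - (\<Sum>i\<in>I. \<bar>c i\<bar>) / \<Psi>) * R = R"
    by (simp add: algebra_simps sum_divide_distrib sum_distrib_left)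
  finally show ?thesis .
qed

lemma nn_integral_square_sum_le:
  fixes V :: "'i \<Rightarrow> 'a \<Rightarrow> real"
  assumes c: "(\<Sum>i\<in>I. \<bar>c i\<bar>) \<le> \<Psi>" and "0 \<le> R"
    and [measurable]: "\<And>i. i \<in> I \<Longrightarrow> V i \<in> borel_measurable M"
    and V: "\<And>i. i \<in> I \<Longrightarrow> (\<integral>\<^sup>+\<omega>. ennreal ((V i \<omega>)\<^sup>2) \<partial>M) \<le> ennreal R"
  shows "(\<integral>\<^sup>+\<omega>. ennreal ((\<Sum>i\<in>I. c i * V i \<omega>)\<^sup>2) \<partial>M) \<le> ennreal (\<Psi>\<^sup>2 * R)"
proof -
  have psi: "0 \<le> \<Psi>" using c by (rule order_trans[OF sum_nonneg, rotated]) auto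
  have "(\<integral>\<^sup>+\<omega>. ennreal ((\<Sum>i\<in>I. c i * V i \<omega>)\<^sup>2) \<partial>M)
     \<le> (\<integral>\<^sup>+\<omega>. (\<Sum>i\<in>I. ennreal (\<bar>c i\<bar> * \<Psi>) * ennreal ((V i \<omega>)\<^sup>2)) \<partial>M)"
    using psi
    by (intro nn_integral_mono order_trans[OF ennreal_leI[OF square_sum_le_convex[OF c]]])
      (simp add: ennreal_mult'[symmetric] sum_ennreal)
  also have "\<dots> = (\<Sum>i\<in>I. ennreal (\<bar>c i\<bar> * \<Psi>) * (\<integral>\<^sup>+\<omega>. ennreal ((V i \<omega>)\<^sup>2) \<partial>M))"
    by (subst nn_integral_sum) (auto simp: nn_integral_cmult)
  also have "\<dots> \<le> (\<Sum>i\<in>I. ennreal (\<bar>c i\<bar> * \<Psi>) * ennreal R)"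
    by (intro sum_mono mult_left_mono V) auto
  also have "\<dots> = ennreal ((\<Sum>i\<in>I. \<bar>c i\<bar>) * \<Psi> * R)"
    using psi \<open>0 \<le> R\<close> by (simp add: ennreal_mult'[symmetric] sum_ennreal sum_distrib_right)
  also have "\<dots> \<le> ennreal (\<Psi>\<^sup>2 * R)"
    using c psi \<open>0 \<le> R\<close> unfolding power2_eq_square by (intro ennreal_leI mult_right_mono) auto
  finally show ?thesis .
qed

lemma chernoff_two_sided:
  assumes [measurable]: "X \<in> borel_measurable M" and "0 < \<kappa>"
    and "(\<integral>\<^sup>+\<omega>. ennreal (exp (\<kappa> * X \<omega>)) \<partial>M) \<le> ennreal R"
    and "(\<integral>\<^sup>+\<omega>. ennreal (exp (- \<kappa> * X \<omega>)) \<partial>M) \<le> ennreal R" and "0 \<le> R"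
  shows "prob {\<omega> \<in> space M. t < \<bar>X \<omega>\<bar>} \<le> 2 * exp (- \<kappa> * t) * R"
proof -
  have "ennreal (prob {\<omega> \<in> space M. t < \<bar>X \<omega>\<bar>}) = (\<integral>\<^sup>+\<omega>. indicator {\<omega> \<in> space M. t < \<bar>X \<omega>\<bar>} \<omega> \<partial>M)"
    by (simp add: emeasure_eq_measure)
  also have "\<dots> \<le> (\<integral>\<^sup>+\<omega>. ennreal (exp (- \<kappa> * t)) * (ennreal (exp (\<kappa> * X \<omega>)) + ennreal (exp (- \<kappa> * X \<omega>))) \<partial>M)"
  proof (intro nn_integral_mono)
    fix \<omega>
    have "1 \<le> exp (- \<kappa> * t) * (exp (\<kappa> * X \<omega>) + exp (- \<kappa> * X \<omega>))" if "t < \<bar>X \<omega>\<bar>"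
    proof -
      have "1 \<le> exp (- \<kappa> * t) * exp (\<kappa> * \<bar>X \<omega>\<bar>)"
        using that \<open>0 < \<kappa>\<close> by (simp add: exp_add[symmetric])
      also have "\<dots> \<le> exp (- \<kappa> * t) * (exp (\<kappa> * X \<omega>) + exp (- \<kappa> * X \<omega>))"
        by (intro mult_left_mono) (auto simp: abs_if)
      finally show ?thesis .
    qed
    then have "1 \<le> ennreal (exp (- \<kappa> * t) * (exp (\<kappa> * X \<omega>) + exp (- \<kappa> * X \<omega>)))" if "t < \<bar>X \<omega>\<bar>"
      using that ennreal_leI by fastforce
    then show "indicator {\<omega> \<in> space M. t < \<bar>X \<omega>\<bar>} \<omega> \<le> ennreal (exp (- \<kappa> * t)) * (ennreal (exp (\<kappa> * X \<omega>)) + ennreal (exp (- \<kappa> * X \<omega>)))"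
      by (auto simp: indicator_def ennreal_mult'[symmetric] ennreal_plus[symmetric] simp del: ennreal_plus)
  qed
  also have "\<dots> = ennreal (exp (- \<kappa> * t)) * ((\<integral>\<^sup>+\<omega>. ennreal (exp (\<kappa> * X \<omega>)) \<partial>M) + (\<integral>\<^sup>+\<omega>. ennreal (exp (- \<kappa> * X \<omega>)) \<partial>M))"
    by (simp add: nn_integral_cmult nn_integral_add)
  also have "\<dots> \<le> ennreal (exp (- \<kappa> * t)) * (ennreal R + ennreal R)"
    using assms by (intro mult_left_mono add_mono) auto
  also have "\<dots> = ennreal (2 * exp (- \<kappa> * t) * R)"
    using \<open>0 \<le> R\<close> by (simp add: ennreal_mult'[symmetric] ennreal_plus[symmetric] del: ennreal_plus)
  finally show ?thesis using \<open>0 \<le> R\<close> by (simp add: ennreal_le_iff)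
qed

text \<open>A Taylor expansion of third order. The quadratic term costs
  \<open>\<kappa>\<^sup>2 * D / 2\<close>, and the upper bound on
  \<open>\<bar>\<kappa>\<bar>\<close> makes the cubic remainder no larger. So the exponent contains
  only the variance bound \<open>D\<close>, while the exponential moment \<open>c\<close> merely
  limits the range of \<open>\<kappa>\<close>; this is how \<open>K\<close> stays out of the leading
  constant.\<close>

lemma nn_integral_exp_le_of_variance:
  assumes [measurable]: "U \<in> borel_measurable M" and c: "0 < c"
    and exp: "(\<integral>\<^sup>+\<omega>. ennreal (exp (c * \<bar>U \<omega>\<bar>)) \<partial>M) \<le> ennreal 2"
    and mean: "expectation U = 0" and var: "expectation (\<lambda>\<omega>. (U \<omega>)\<^sup>2) \<le> D"
    and l: "\<bar>\<kappa>\<bar> \<le> c / 2" "\<bar>\<kappa>\<bar> \<le> D * c ^ 3 / 32"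
  shows "(\<integral>\<^sup>+\<omega>. ennreal (exp (\<kappa> * U \<omega>)) \<partial>M) \<le> ennreal (exp (\<kappa>\<^sup>2 * D))"
proof -
  have ie: "integrable M (\<lambda>\<omega>. exp (c * \<bar>U \<omega>\<bar>))"
    using exp by (intro integrableI_nonneg) (auto intro: le_less_trans)
  have ee: "expectation (\<lambda>\<omega>. exp (c * \<bar>U \<omega>\<bar>)) \<le> 2"
    using exp ennreal_le_iff[of 2 "expectation (\<lambda>\<omega>. exp (c * \<bar>U \<omega>\<bar>))"]
    by (simp add: nn_integral_eq_integral[OF ie])
  have u1: "\<bar>u\<bar> \<le> 1 / c * exp (c * \<bar>u\<bar>)" for u :: real
    using power_div_fact_le_exp[of "c * \<bar>u\<bar>" 1] c by (simp add: field_simps)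
  have u2: "u\<^sup>2 \<le> 2 / c\<^sup>2 * exp (c * \<bar>u\<bar>)" for u :: real
    using power_div_fact_le_exp[of "c * \<bar>u\<bar>" 2] c by (simp add: field_simps power_mult_distrib)
  have i1: "integrable M U"
    by (rule Bochner_Integration.integrable_bound[where f = "\<lambda>\<omega>. 1 / c * exp (c * \<bar>U \<omega>\<bar>)"])
      (use ie u1 c in \<open>auto\<close>)
  have i2: "integrable M (\<lambda>\<omega>. (U \<omega>)\<^sup>2)"
    by (rule Bochner_Integration.integrable_bound[where f = "\<lambda>\<omega>. 2 / c\<^sup>2 * exp (c * \<bar>U \<omega>\<bar>)"])
      (use ie u2 c in \<open>auto\<close>)
  have pt: "exp (\<kappa> * u) \<le> 1 + \<kappa> * u + \<kappa>\<^sup>2 * u\<^sup>2 / 2 + \<bar>\<kappa>\<bar> ^ 3 * (8 / c ^ 3) * exp (c * \<bar>u\<bar>)" for u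
  proof -
    obtain t where t: "\<bar>t\<bar> \<le> \<bar>\<kappa> * u\<bar>" "exp (\<kappa> * u) = (\<Sum>m<3. ((\<kappa> * u) ^ m) / fact m) + (exp t / fact 3) * (\<kappa> * u) ^ 3"
      using Maclaurin_exp_le[of "\<kappa> * u" 3] by blast
    have tc: "t \<le> c * \<bar>u\<bar> / 2"
      using t(1) mult_right_mono[OF l(1), of "\<bar>u\<bar>"] by (simp add: abs_mult)
    have "(\<kappa> * u) ^ 3 \<le> \<bar>\<kappa> * u\<bar> ^ 3" by (metis abs_ge_self power_abs)
    then have "(exp t / fact 3) * (\<kappa> * u) ^ 3 \<le> (exp t / fact 3) * \<bar>\<kappa> * u\<bar> ^ 3"
      by (intro mult_left_mono) auto
    also have "\<dots> \<le> exp (c * \<bar>u\<bar> / 2) / 6 * \<bar>\<kappa> * u\<bar> ^ 3"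
      using tc by (intro mult_right_mono) (auto simp: fact_numeral)
    \<comment> \<open>One half of \<open>c * \<bar>u\<bar>\<close> bounds the intermediate point of
      the Taylor formula, the other half absorbs the cube.\<close>
    also have "\<dots> = exp (c * \<bar>u\<bar> / 2) * \<bar>\<kappa>\<bar> ^ 3 * (8 / c ^ 3) * ((c * \<bar>u\<bar> / 2) ^ 3 / fact 3)"
      using c by (simp add: abs_mult power_mult_distrib power_divide fact_numeral field_simps)
    also have "\<dots> \<le> exp (c * \<bar>u\<bar> / 2) * \<bar>\<kappa>\<bar> ^ 3 * (8 / c ^ 3) * exp (c * \<bar>u\<bar> / 2)"
      using c by (intro mult_left_mono power_div_fact_le_exp) auto
    also have "\<dots> = \<bar>\<kappa>\<bar> ^ 3 * (8 / c ^ 3) * exp (c * \<bar>u\<bar>)"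
      by (simp add: exp_add[symmetric])
    finally have *: "(exp t / fact 3) * (\<kappa> * u) ^ 3 \<le> \<bar>\<kappa>\<bar> ^ 3 * (8 / c ^ 3) * exp (c * \<bar>u\<bar>)" .
    have "(\<Sum>m<3. ((\<kappa> * u) ^ m) / fact m) = 1 + \<kappa> * u + \<kappa>\<^sup>2 * u\<^sup>2 / 2"
      by (simp add: numeral_3_eq_3 power2_eq_square)
    then show ?thesis using * t(2) by linarith
  qed
  have "(\<integral>\<^sup>+\<omega>. ennreal (exp (\<kappa> * U \<omega>)) \<partial>M)
     \<le> (\<integral>\<^sup>+\<omega>. ennreal (1 + \<kappa> * U \<omega> + \<kappa>\<^sup>2 * (U \<omega>)\<^sup>2 / 2 + \<bar>\<kappa>\<bar> ^ 3 * (8 / c ^ 3) * exp (c * \<bar>U \<omega>\<bar>)) \<partial>M)"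
    by (intro nn_integral_mono ennreal_leI pt)
  also have "\<dots> = ennreal (expectation (\<lambda>\<omega>. 1 + \<kappa> * U \<omega> + \<kappa>\<^sup>2 * (U \<omega>)\<^sup>2 / 2 + \<bar>\<kappa>\<bar> ^ 3 * (8 / c ^ 3) * exp (c * \<bar>U \<omega>\<bar>)))"
    using i1 i2 ie by (intro nn_integral_eq_integral AE_I2 order_trans[OF exp_ge_zero pt]) auto
  also have "\<dots> \<le> ennreal (exp (\<kappa>\<^sup>2 * D))"
  proof (rule ennreal_leI)
    have "expectation (\<lambda>\<omega>. 1 + \<kappa> * U \<omega> + \<kappa>\<^sup>2 * (U \<omega>)\<^sup>2 / 2 + \<bar>\<kappa>\<bar> ^ 3 * (8 / c ^ 3) * exp (c * \<bar>U \<omega>\<bar>))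
       = 1 + \<kappa> * expectation U + \<kappa>\<^sup>2 * expectation (\<lambda>\<omega>. (U \<omega>)\<^sup>2) / 2 + \<bar>\<kappa>\<bar> ^ 3 * (8 / c ^ 3) * expectation (\<lambda>\<omega>. exp (c * \<bar>U \<omega>\<bar>))"
      using i1 i2 ie by (simp add: prob_space)
    also have "\<dots> \<le> 1 + \<kappa>\<^sup>2 * D / 2 + \<bar>\<kappa>\<bar> ^ 3 * (8 / c ^ 3) * 2"
    proof -
      have "\<kappa>\<^sup>2 * expectation (\<lambda>\<omega>. (U \<omega>)\<^sup>2) \<le> \<kappa>\<^sup>2 * D"
        using var by (rule mult_left_mono) simp
      moreover have "\<bar>\<kappa>\<bar> ^ 3 * (8 / c ^ 3) * expectation (\<lambda>\<omega>. exp (c * \<bar>U \<omega>\<bar>)) \<le> \<bar>\<kappa>\<bar> ^ 3 * (8 / c ^ 3) * 2"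
        using ee c by (intro mult_left_mono) auto
      moreover have "\<kappa> * expectation U = 0" using mean by simp
      ultimately show ?thesis by linarith
    qed
    also have "\<dots> \<le> 1 + \<kappa>\<^sup>2 * D"
    proof -
      have "\<bar>\<kappa>\<bar> ^ 3 * (8 / c ^ 3) * 2 = \<kappa>\<^sup>2 * (\<bar>\<kappa>\<bar> * (16 / c ^ 3))"
        by (simp add: power3_eq_cube power2_eq_square)
      also have "\<dots> \<le> \<kappa>\<^sup>2 * (D / 2)"
        using l(2) c by (intro mult_left_mono) (auto simp: field_simps)
      finally show ?thesis by simp
    qed
    also have "\<dots> \<le> exp (\<kappa>\<^sup>2 * D)" by (rule exp_ge_add_one_self)
    finally show "expectation (\<lambda>\<omega>. 1 + \<kappa> * U \<omega> + \<kappa>\<^sup>2 * (U \<omega>)\<^sup>2 / 2 + \<bar>\<kappa>\<bar> ^ 3 * (8 / c ^ 3) * exp (c * \<bar>U \<omega>\<bar>))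
       \<le> exp (\<kappa>\<^sup>2 * D)" .
  qed
  finally show ?thesis .
qed

end

section \<open>Exponential moments of products of innovations\<close>

context ar_proc begin

lemma w_mgf: "(\<integral>\<^sup>+\<omega>. ennreal (exp (t * w k \<omega>)) \<partial>M) \<le> ennreal (exp (K\<^sup>2 * \<sigma>\<^sup>2 * t\<^sup>2 / 2))"
proof -
  have "integrable M (\<lambda>\<omega>. exp (t * w k \<omega>))" "expectation (\<lambda>\<omega>. exp (t * w k \<omega>)) \<le> exp (K\<^sup>2 * \<sigma>\<^sup>2 * t\<^sup>2 / 2)"
    using ar by (auto simp: AR_process_def)
  then show ?thesis by (simp add: nn_integral_eq_integral ennreal_le_iff)
qed

text \<open>Scaled so that \<open>c0 * (exp 1 * K\<^sup>2 * \<sigma>\<^sup>2) = 1 / 4\<close>, which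
  makes the moment bounds in the exponential series of \<open>c0 * (w k \<omega>)\<^sup>2\<close>
  geometric.\<close>

definition c0 :: real where "c0 = 1 / (4 * exp 1 * K\<^sup>2 * \<sigma>\<^sup>2)"

lemma c0_pos: "K \<noteq> 0 \<Longrightarrow> 0 < c0"
  using sigma by (simp add: c0_def)

lemma w_even_moment:
  assumes "0 < j" "K \<noteq> 0"
  shows "(\<integral>\<^sup>+\<omega>. ennreal ((w k \<omega>) ^ (2 * j)) \<partial>M) \<le> ennreal (2 * fact j * (exp 1 * K\<^sup>2 * \<sigma>\<^sup>2) ^ j)"
proof -
  \<comment> \<open>This \<open>t\<close> minimises \<open>exp (K\<^sup>2 * \<sigma>\<^sup>2 *
    t\<^sup>2 / 2) / t ^ (2 * j)\<close>, and the exponent becomes \<open>j\<close>.\<close>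
  define t where "t = sqrt (2 * real j / (K\<^sup>2 * \<sigma>\<^sup>2))"
  have t: "t\<^sup>2 = 2 * real j / (K\<^sup>2 * \<sigma>\<^sup>2)" "0 < t"
    using assms sigma by (simp_all add: t_def)
  have pt: "y ^ (2 * j) \<le> fact (2 * j) / t ^ (2 * j) * (exp (t * y) + exp ((- t) * y))" for y
  proof -
    have "(t * \<bar>y\<bar>) ^ (2 * j) / fact (2 * j) \<le> exp (t * \<bar>y\<bar>)"
      using t by (intro power_div_fact_le_exp) auto
    also have "\<dots> \<le> exp (t * y) + exp ((- t) * y)" by (auto simp: abs_if)
    finally show ?thesis using t
      by (simp add: power_mult_distrib field_simps power_even_abs)
  qed
  have "(\<integral>\<^sup>+\<omega>. ennreal ((w k \<omega>) ^ (2 * j)) \<partial>M)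
     \<le> (\<integral>\<^sup>+\<omega>. ennreal (fact (2 * j) / t ^ (2 * j)) * (ennreal (exp (t * w k \<omega>)) + ennreal (exp ((- t) * w k \<omega>))) \<partial>M)"
    using t by (intro nn_integral_mono order_trans[OF ennreal_leI[OF pt]])
      (simp add: ennreal_mult'[symmetric] ennreal_plus[symmetric] del: ennreal_plus)
  also have "\<dots> = ennreal (fact (2 * j) / t ^ (2 * j)) * ((\<integral>\<^sup>+\<omega>. ennreal (exp (t * w k \<omega>)) \<partial>M) + (\<integral>\<^sup>+\<omega>. ennreal (exp ((- t) * w k \<omega>)) \<partial>M))"
    by (simp add: nn_integral_cmult nn_integral_add)
  also have "\<dots> \<le> ennreal (fact (2 * j) / t ^ (2 * j)) * (ennreal (exp (real j)) + ennreal (exp (real j)))"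
  proof (intro mult_left_mono add_mono)
    have "K\<^sup>2 * \<sigma>\<^sup>2 * t\<^sup>2 / 2 = real j"
      using assms sigma by (simp add: t(1))
    then show "(\<integral>\<^sup>+\<omega>. ennreal (exp (t * w k \<omega>)) \<partial>M) \<le> ennreal (exp (real j))"
      "(\<integral>\<^sup>+\<omega>. ennreal (exp ((- t) * w k \<omega>)) \<partial>M) \<le> ennreal (exp (real j))"
      using w_mgf[of t k] w_mgf[of "- t" k] by simp_all
  qed auto
  also have "\<dots> = ennreal (2 * (fact (2 * j) / t ^ (2 * j)) * exp (real j))"
    using t by (simp add: ennreal_mult'[symmetric] ennreal_plus[symmetric] del: ennreal_plus)
  also have "\<dots> \<le> ennreal (2 * fact j * (exp 1 * K\<^sup>2 * \<sigma>\<^sup>2) ^ j)"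
  proof (rule ennreal_leI)
    \<comment> \<open>Only \<open>fact j\<close> may remain, to cancel against the exponential
      series later; the other factor \<open>(2 * j) ^ j\<close> is exactly the one contained in
      \<open>t ^ (2 * j)\<close>.\<close>
    have "fact (2 * j) div fact (2 * j - j) \<le> (2 * j) ^ j"
      by (rule fact_div_fact_le_pow) simp
    then have "fact (2 * j) \<le> (2 * j) ^ j * (fact j :: nat)"
      using fact_dvd[of j "2 * j", where 'a = nat] by (auto elim!: dvdE simp: mult.commute)
    then have f: "(fact (2 * j) :: real) \<le> (2 * real j) ^ j * fact j"
      by (metis (mono_tags, lifting) of_nat_fact of_nat_le_iff of_nat_mult of_nat_numeral of_nat_power)
    have tt: "t ^ (2 * j) = (2 * real j) ^ j / (K\<^sup>2 * \<sigma>\<^sup>2) ^ j"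
      by (simp add: power_mult t(1) power_divide)
    have "fact (2 * j) / t ^ (2 * j) \<le> fact j * (K\<^sup>2 * \<sigma>\<^sup>2) ^ j"
      using f assms sigma unfolding tt by (simp add: field_simps)
    then have "2 * (fact (2 * j) / t ^ (2 * j)) * exp (real j) \<le> 2 * (fact j * (K\<^sup>2 * \<sigma>\<^sup>2) ^ j) * exp (real j)"
      by (intro mult_right_mono mult_left_mono) auto
    also have "\<dots> = 2 * fact j * (exp 1 * K\<^sup>2 * \<sigma>\<^sup>2) ^ j"
      by (simp add: power_mult_distrib exp_of_nat_mult[symmetric])
    finally show "2 * (fact (2 * j) / t ^ (2 * j)) * exp (real j) \<le> 2 * fact j * (exp 1 * K\<^sup>2 * \<sigma>\<^sup>2) ^ j" .
  qed
  finally show ?thesis .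
qed

text \<open>The term of order 0 is 1, and each later one is at most \<open>2 * (1 / 4) ^ j\<close>,
  hence at most \<open>(1 / 2) ^ j\<close>; the geometric series sums to 2.\<close>

lemma w_exp_square:
  assumes "K \<noteq> 0"
  shows "(\<integral>\<^sup>+\<omega>. ennreal (exp (c0 * (w k \<omega>)\<^sup>2)) \<partial>M) \<le> ennreal 2"
proof -
  have c0: "0 < c0" using c0_pos[OF assms] .
  have "ennreal (exp (c0 * y\<^sup>2)) = (\<Sum>j. ennreal (c0 ^ j / fact j) * ennreal (y ^ (2 * j)))" for y
  proof -
    have "(\<lambda>j. c0 ^ j / fact j * y ^ (2 * j)) sums exp (c0 * y\<^sup>2)"
      using exp_converges[of "c0 * y\<^sup>2"]
      by (simp add: power_mult power2_eq_square power_mult_distrib divide_inverse mult_ac)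
    then have "(\<lambda>j. ennreal (c0 ^ j / fact j * y ^ (2 * j))) sums ennreal (exp (c0 * y\<^sup>2))"
      using c0 by (subst sums_ennreal) auto
    then show ?thesis
      using c0 by (simp add: sums_iff ennreal_mult'[symmetric])
  qed
  then have "(\<integral>\<^sup>+\<omega>. ennreal (exp (c0 * (w k \<omega>)\<^sup>2)) \<partial>M)
     = (\<Sum>j. ennreal (c0 ^ j / fact j) * (\<integral>\<^sup>+\<omega>. ennreal ((w k \<omega>) ^ (2 * j)) \<partial>M))"
    by (simp add: nn_integral_suminf nn_integral_cmult)
  also have "\<dots> \<le> (\<Sum>j. ennreal ((1/2) ^ j))"
  proof (intro suminf_le summableI)
    fix j
    show "ennreal (c0 ^ j / fact j) * (\<integral>\<^sup>+\<omega>. ennreal ((w k \<omega>) ^ (2 * j)) \<partial>M) \<le> ennreal ((1/2) ^ j)"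
    proof (cases "j = 0")
      case False
      have "ennreal (c0 ^ j / fact j) * (\<integral>\<^sup>+\<omega>. ennreal ((w k \<omega>) ^ (2 * j)) \<partial>M)
          \<le> ennreal (c0 ^ j / fact j) * ennreal (2 * fact j * (exp 1 * K\<^sup>2 * \<sigma>\<^sup>2) ^ j)"
        using False assms by (intro mult_left_mono w_even_moment) auto
      also have "\<dots> = ennreal (2 * (c0 * (exp 1 * K\<^sup>2 * \<sigma>\<^sup>2)) ^ j)"
        using c0 by (simp add: ennreal_mult'[symmetric] power_mult_distrib mult_ac)
      also have "c0 * (exp 1 * K\<^sup>2 * \<sigma>\<^sup>2) = 1 / 4"
        using assms sigma by (simp add: c0_def)
      also have "2 * (1/4 :: real) ^ j \<le> (1/2) ^ j"
      proof -
        have "2 * (1/2 :: real) ^ j \<le> 1" using False power_decreasing[of 1 j "1/2 :: real"] by simp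
        then have "(2 * (1/2) ^ j) * (1/2 :: real) ^ j \<le> 1 * (1/2) ^ j" by (intro mult_right_mono) auto
        then show ?thesis by (simp add: power_mult_distrib[symmetric] mult.assoc)
      qed
      finally show ?thesis by (simp add: ennreal_leI)
    qed (simp add: emeasure_space_1)
  qed
  also have "\<dots> = ennreal 2"
    by (subst suminf_ennreal2) (auto simp: suminf_geometric)
  finally show ?thesis .
qed

end

lemma abs_mult_le_squares: "\<bar>a * b\<bar> \<le> a\<^sup>2 + b\<^sup>2" for a b :: real
proof -
  have "2 * \<bar>a * b\<bar> \<le> a\<^sup>2 + b\<^sup>2"
    using sum_squares_bound[of "\<bar>a\<bar>" "\<bar>b\<bar>"] by (simp add: abs_mult mult.assoc)
  then show ?thesis using abs_ge_zero[of "a * b"] by linarith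
qed

context ar_proc begin

definition wprod :: "int \<Rightarrow> int \<Rightarrow> 'a \<Rightarrow> real" where
  "wprod i j \<omega> = w i \<omega> * w j \<omega> - (if i = j then \<sigma>\<^sup>2 else 0)"

lemma wprod_meas [measurable]: "wprod i j \<in> borel_measurable M"
  unfolding wprod_def by measurable

lemma w_prod_int: "integrable M (\<lambda>\<omega>. w i \<omega> * w j \<omega>)"
proof (rule Bochner_Integration.integrable_bound[where f = "\<lambda>\<omega>. (w i \<omega>)\<^sup>2 + (w j \<omega>)\<^sup>2"])
  show "AE \<omega> in M. norm (w i \<omega> * w j \<omega>) \<le> norm ((w i \<omega>)\<^sup>2 + (w j \<omega>)\<^sup>2)"
    using abs_mult_le_squares by auto
qed (auto intro!: w_sq_int)

lemma w_prod_expectation: "expectation (\<lambda>\<omega>. w i \<omega> * w j \<omega>) = (if i = j then \<sigma>\<^sup>2 else 0)"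
proof (cases "i = j")
  case True
  then show ?thesis using w_var by (simp add: power2_eq_square)
next
  case False
  have "expectation (\<lambda>\<omega>. \<Prod>k\<in>{i, j}. w k \<omega>) = (\<Prod>k\<in>{i, j}. expectation (w k))"
    by (intro indep_vars_lebesgue_integral indep_vars_subset[OF w_indep] w_int) auto
  then show ?thesis using False w_mean by simp
qed

lemma wprod_mean: "expectation (wprod i j) = 0"
  unfolding wprod_def using w_prod_int by (subst Bochner_Integration.integral_diff) (auto simp: w_prod_expectation prob_space)

text \<open>A product is at most a sum of two squares, and convexity splits the exponential into the
  average of two exponentials, each of expectation at most 2. On the diagonal the second one is the
  constant \<open>exp (c0 * \<sigma>\<^sup>2)\<close>, which is at most 2 because
  \<open>1 \<le> K\<close>.\<close>

lemma wprod_exp: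
  assumes "1 \<le> K"
  shows "(\<integral>\<^sup>+\<omega>. ennreal (exp (c0 / 2 * \<bar>wprod i j \<omega>\<bar>)) \<partial>M) \<le> ennreal 2"
proof -
  have c0: "0 < c0" using c0_pos assms by simp
  have avg: "exp ((a + b) / 2) \<le> (exp a + exp b) / 2" for a b :: real
    using exp_sum_le_convex[of "\<lambda>_. 1/2" "{True, False}" 1 1 "\<lambda>t. if t then a else b"] by (simp add: add_divide_distrib)
  have half: "exp (c0 / 2 * u) \<le> (exp (c0 * a\<^sup>2) + exp b) / 2"
    if "u \<le> a\<^sup>2 + b / c0" for u a b
  proof -
    have "c0 / 2 * u \<le> (c0 * a\<^sup>2 + b) / 2" using that c0 by (simp add: field_simps)
    then show ?thesis by (intro order_trans[OF _ avg]) simp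
  qed
  define hf :: real where "hf = 1 / 2"
  have hf: "0 \<le> hf" "hf * 2 + 1 = 2" "hf * (2 + 2) = 2" by (auto simp: hf_def)
  show ?thesis
  proof (cases "i = j")
    case True
    have "c0 * \<sigma>\<^sup>2 = 1 / (4 * exp 1 * K\<^sup>2)"
      using sigma by (simp add: c0_def)
    also have "\<dots> \<le> 1 / 4"
      using assms mult_mono[of 1 "exp 1 :: real" 1 "K\<^sup>2"] by (simp add: field_simps)
    also have "1 / 4 \<le> ln (2 :: real)" using ln2_ge_two_thirds by simp
    finally have "exp (c0 * \<sigma>\<^sup>2) \<le> exp (ln (2 :: real))" by (simp only: exp_le_cancel_iff)
    then have s: "exp (c0 * \<sigma>\<^sup>2) \<le> 2" by simp

    have pt: "exp (c0 / 2 * \<bar>wprod i j \<omega>\<bar>) \<le> hf * exp (c0 * (w i \<omega>)\<^sup>2) + 1" for \<omega>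
    proof -
      have "exp (c0 / 2 * \<bar>wprod i j \<omega>\<bar>) \<le> (exp (c0 * (w i \<omega>)\<^sup>2) + exp (c0 * \<sigma>\<^sup>2)) / 2"
        using True c0 by (intro half) (auto simp: wprod_def abs_if power2_eq_square)
      then show ?thesis using s by (simp add: hf_def field_simps)
    qed
    have "(\<integral>\<^sup>+\<omega>. ennreal (exp (c0 / 2 * \<bar>wprod i j \<omega>\<bar>)) \<partial>M)
       \<le> (\<integral>\<^sup>+\<omega>. ennreal hf * ennreal (exp (c0 * (w i \<omega>)\<^sup>2)) + ennreal 1 \<partial>M)"
      using hf(1) by (intro nn_integral_mono order_trans[OF ennreal_leI[OF pt]])
        (simp only: ennreal_mult'[symmetric] ennreal_plus exp_ge_zero zero_le_one mult_nonneg_nonneg order_refl)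
    also have "\<dots> = ennreal hf * (\<integral>\<^sup>+\<omega>. ennreal (exp (c0 * (w i \<omega>)\<^sup>2)) \<partial>M) + ennreal 1"
      by (subst nn_integral_add) (auto simp: nn_integral_cmult emeasure_space_1)
    also have "\<dots> \<le> ennreal hf * ennreal 2 + ennreal 1"
      using assms by (intro add_mono mult_left_mono w_exp_square) auto
    also have "\<dots> = ennreal (hf * 2 + 1)"
      using hf(1) by (simp only: ennreal_mult'[symmetric] ennreal_plus mult_nonneg_nonneg zero_le_one zero_le_numeral)
    also have "\<dots> = ennreal 2" unfolding hf(2) ..
    finally show ?thesis .
  next
    case False
    have pt: "exp (c0 / 2 * \<bar>wprod i j \<omega>\<bar>) \<le> hf * (exp (c0 * (w i \<omega>)\<^sup>2) + exp (c0 * (w j \<omega>)\<^sup>2))" for \<omega>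
    proof (rule order_trans[OF half])
      show "\<bar>wprod i j \<omega>\<bar> \<le> (w i \<omega>)\<^sup>2 + c0 * (w j \<omega>)\<^sup>2 / c0"
        using False c0 abs_mult_le_squares[of "w i \<omega>" "w j \<omega>"] by (simp add: wprod_def)
    qed (simp add: hf_def)
    have "(\<integral>\<^sup>+\<omega>. ennreal (exp (c0 / 2 * \<bar>wprod i j \<omega>\<bar>)) \<partial>M)
       \<le> (\<integral>\<^sup>+\<omega>. ennreal hf * (ennreal (exp (c0 * (w i \<omega>)\<^sup>2)) + ennreal (exp (c0 * (w j \<omega>)\<^sup>2))) \<partial>M)"
      using hf(1) by (intro nn_integral_mono order_trans[OF ennreal_leI[OF pt]])
        (simp add: ennreal_mult'[symmetric] ennreal_plus[symmetric] del: ennreal_plus)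
    also have "\<dots> = ennreal hf * ((\<integral>\<^sup>+\<omega>. ennreal (exp (c0 * (w i \<omega>)\<^sup>2)) \<partial>M) + (\<integral>\<^sup>+\<omega>. ennreal (exp (c0 * (w j \<omega>)\<^sup>2)) \<partial>M))"
      by (simp add: nn_integral_cmult nn_integral_add)
    also have "\<dots> \<le> ennreal hf * (ennreal 2 + ennreal 2)"
      using assms by (intro add_mono mult_left_mono w_exp_square) auto
    also have "\<dots> = ennreal (hf * (2 + 2))"
      using hf(1) by (simp only: ennreal_mult' ennreal_plus zero_le_numeral)
    also have "\<dots> = ennreal 2" unfolding hf(3) ..
    finally show ?thesis .
  qed
qed

text \<open>The first bound comes from the exponential moment and depends on \<open>K\<close>. Off
  the diagonal, independence gives the variance exactly and without \<open>K\<close>; the constant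
  \<open>L\<close> rests on this.\<close>

lemma wprod_var:
  assumes "1 \<le> K"
  shows "expectation (\<lambda>\<omega>. (wprod i j \<omega>)\<^sup>2) \<le> 16 / c0\<^sup>2"
    and "i \<noteq> j \<Longrightarrow> expectation (\<lambda>\<omega>. (wprod i j \<omega>)\<^sup>2) = \<sigma> ^ 4"
proof -
  have c0: "0 < c0" using c0_pos assms by simp
  have pt: "u\<^sup>2 \<le> 8 / c0\<^sup>2 * exp (c0 / 2 * \<bar>u\<bar>)" for u
    using power_div_fact_le_exp[of "c0 / 2 * \<bar>u\<bar>" 2] c0 by (simp add: field_simps power_mult_distrib)
  have ie: "integrable M (\<lambda>\<omega>. exp (c0 / 2 * \<bar>wprod i j \<omega>\<bar>))"
    using le_less_trans[OF wprod_exp[OF assms, of i j] ennreal_less_top] by (intro integrableI_nonneg) auto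
  have "expectation (\<lambda>\<omega>. exp (c0 / 2 * \<bar>wprod i j \<omega>\<bar>)) \<le> 2"
    using wprod_exp[OF assms, of i j] by (subst (asm) nn_integral_eq_integral[OF ie], simp, subst (asm) ennreal_le_iff) auto
  then have "8 / c0\<^sup>2 * expectation (\<lambda>\<omega>. exp (c0 / 2 * \<bar>wprod i j \<omega>\<bar>)) \<le> 8 / c0\<^sup>2 * 2"
    by (rule mult_left_mono) simp
  moreover have "expectation (\<lambda>\<omega>. (wprod i j \<omega>)\<^sup>2) \<le> expectation (\<lambda>\<omega>. 8 / c0\<^sup>2 * exp (c0 / 2 * \<bar>wprod i j \<omega>\<bar>))"
  proof (rule integral_mono_AE')
    show "integrable M (\<lambda>\<omega>. 8 / c0\<^sup>2 * exp (c0 / 2 * \<bar>wprod i j \<omega>\<bar>))" using ie by simp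
  qed (use pt in auto)
  ultimately show "expectation (\<lambda>\<omega>. (wprod i j \<omega>)\<^sup>2) \<le> 16 / c0\<^sup>2" using ie by simp
  assume "i \<noteq> j"
  have "expectation (\<lambda>\<omega>. \<Prod>k\<in>{i, j}. (w k \<omega>)\<^sup>2) = (\<Prod>k\<in>{i, j}. expectation (\<lambda>\<omega>. (w k \<omega>)\<^sup>2))"
    by (intro indep_vars_lebesgue_integral w_sq_int
        indep_vars_compose2[where Y = "\<lambda>_ t. t\<^sup>2", OF indep_vars_subset[OF w_indep]]) auto
  then show "expectation (\<lambda>\<omega>. (wprod i j \<omega>)\<^sup>2) = \<sigma> ^ 4"
    using \<open>i \<noteq> j\<close> by (simp add: wprod_def power_mult_distrib w_var)
qed

text \<open>\<open>D\<close> bounds the variance of the products with index offsets \<open>i\<close>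
  and \<open>j\<close>, either by the crude bound for all pairs or by the exact value off the
  diagonal. The condition is invariant under a common shift of both indices.\<close>

definition mgf_var :: "real \<Rightarrow> int \<Rightarrow> int \<Rightarrow> bool" where
  "mgf_var D i j \<longleftrightarrow> 16 / c0\<^sup>2 \<le> D \<or> (i \<noteq> j \<and> \<sigma> ^ 4 \<le> D)"

lemma wprod_mgf:
  assumes "1 \<le> K" "mgf_var D i j" "\<bar>\<kappa>\<bar> \<le> c0 / 4" "\<bar>\<kappa>\<bar> \<le> D * c0 ^ 3 / 256"
  shows "(\<integral>\<^sup>+\<omega>. ennreal (exp (\<kappa> * wprod i j \<omega>)) \<partial>M) \<le> ennreal (exp (\<kappa>\<^sup>2 * D))"
proof (rule nn_integral_exp_le_of_variance[where c = "c0 / 2"])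
  show "0 < c0 / 2" using c0_pos assms by simp
  show "expectation (\<lambda>\<omega>. (wprod i j \<omega>)\<^sup>2) \<le> D"
    using assms wprod_var[of i j] by (auto simp: mgf_var_def)
  show "\<bar>\<kappa>\<bar> \<le> D * (c0 / 2) ^ 3 / 32" using assms by (simp add: power_divide)
qed (use assms wprod_exp wprod_mean in auto)

text \<open>Pairs of innovations without common members make the summands independent, so the moment
  generating function factorises.\<close>

lemma wprod_sum_mgf_disjoint:
  assumes "1 \<le> K" "mgf_var D i j" "\<bar>\<kappa>\<bar> \<le> c0 / 4" "\<bar>\<kappa>\<bar> \<le> D * c0 ^ 3 / 256"
    and fin: "finite C" and disj: "disjoint_family_on (\<lambda>k. {int k - i, int k - j}) C"
  shows "(\<integral>\<^sup>+\<omega>. ennreal (exp (\<kappa> * (\<Sum>k\<in>C. wprod (int k - i) (int k - j) \<omega>))) \<partial>M) \<le> ennreal (exp (real (card C) * \<kappa>\<^sup>2 * D))"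
proof -
  define f where "f k v = ennreal (exp (\<kappa> * (v (int k - i) * v (int k - j) - (if i = j then \<sigma>\<^sup>2 else 0))))"
    for k :: nat and v :: "int \<Rightarrow> real"
  have ind: "indep_vars (\<lambda>_. borel) (\<lambda>k \<omega>. f k (restrict (\<lambda>i. w i \<omega>) {int k - i, int k - j})) C"
    by (rule indep_vars_compose2[OF indep_vars_restrict[OF w_indep _ disj]])
      (auto simp: f_def intro!: borel_measurable_exp borel_measurable_times borel_measurable_diff
          measurable_component_singleton measurable_compose[OF _ measurable_ennreal])
  have f_eq: "f k (restrict (\<lambda>i. w i \<omega>) {int k - i, int k - j}) = ennreal (exp (\<kappa> * wprod (int k - i) (int k - j) \<omega>))" for k \<omega>
    by (simp add: f_def wprod_def)
  have "(\<integral>\<^sup>+\<omega>. ennreal (exp (\<kappa> * (\<Sum>k\<in>C. wprod (int k - i) (int k - j) \<omega>))) \<partial>M)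
     = (\<integral>\<^sup>+\<omega>. (\<Prod>k\<in>C. ennreal (exp (\<kappa> * wprod (int k - i) (int k - j) \<omega>))) \<partial>M)"
    using fin by (intro nn_integral_cong) (simp add: sum_distrib_left exp_sum prod_ennreal)
  also have "\<dots> = (\<Prod>k\<in>C. \<integral>\<^sup>+\<omega>. ennreal (exp (\<kappa> * wprod (int k - i) (int k - j) \<omega>)) \<partial>M)"
    using ind unfolding f_eq by (intro indep_vars_nn_integral[OF fin]) auto
  also have "\<dots> \<le> (\<Prod>k\<in>C. ennreal (exp (\<kappa>\<^sup>2 * D)))"
    using assms(1-4) by (intro prod_mono_ennreal wprod_mgf) (auto simp: mgf_var_def)
  also have "\<dots> = ennreal (exp (real (card C) * \<kappa>\<^sup>2 * D))"
    by (simp add: ennreal_power exp_of_nat_mult[symmetric] mult.assoc)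
  finally show ?thesis .
qed

text \<open>The summands with \<open>k div \<bar>i - j\<bar>\<close> even use pairwise disjoint pairs of innovations, and so do
  those with \<open>k div \<bar>i - j\<bar>\<close> odd.\<close>

lemma wprod_sum_mgf:
  assumes "1 \<le> K" "mgf_var D i j" "\<bar>2 * \<kappa>\<bar> \<le> c0 / 4" "\<bar>2 * \<kappa>\<bar> \<le> D * c0 ^ 3 / 256" "0 \<le> D"
  shows "(\<integral>\<^sup>+\<omega>. ennreal (exp (\<kappa> * (\<Sum>k = 1..n. wprod (int k - i) (int k - j) \<omega>))) \<partial>M) \<le> ennreal (exp (4 * real n * \<kappa>\<^sup>2 * D))"
proof (cases "i = j")
  case True
  have "disjoint_family_on (\<lambda>k. {int k - i, int k - j}) {1..n}"
    using True by (auto simp: disjoint_family_on_def)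
  then have "(\<integral>\<^sup>+\<omega>. ennreal (exp (\<kappa> * (\<Sum>k = 1..n. wprod (int k - i) (int k - j) \<omega>))) \<partial>M) \<le> ennreal (exp (real (card {1..n}) * \<kappa>\<^sup>2 * D))"
    using assms by (intro wprod_sum_mgf_disjoint) auto
  also have "\<dots> \<le> ennreal (exp (4 * real n * \<kappa>\<^sup>2 * D))"
    using assms by (intro ennreal_leI) (simp add: mult_right_mono)
  finally show ?thesis .
next
  case False
  define h where "h = nat \<bar>i - j\<bar>"
  have h: "0 < h" using False by (simp add: h_def)
  define C where "C b = {k \<in> {1..n}. even (k div h) = b}" for b
  have disj: "disjoint_family_on (\<lambda>k. {int k - i, int k - j}) (C b)" for b
  proof -
    \<comment> \<open>Two summands can share an innovation only if their indices differ by exactly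
      \<open>h\<close>, and adding \<open>h\<close> flips the parity of
      \<open>k div h\<close>.\<close>
    have *: False if "k' = k + h" "k \<in> C b" "k' \<in> C b" for k k'
      using that h by (auto simp: C_def)
    have **: False if "\<bar>int k - int k'\<bar> = \<bar>i - j\<bar>" "k \<in> C b" "k' \<in> C b" for k k'
    proof (cases "k \<le> k'")
      case True
      then have "k' = k + h" using that(1) by (simp add: h_def)
      then show ?thesis using * that by blast
    next
      case False
      then have "k = k' + h" using that(1) by (simp add: h_def)
      then show ?thesis using * that by blast
    qed
    show ?thesis
      unfolding disjoint_family_on_def
    proof (intro ballI impI)
      fix k k' assume k: "k \<in> C b" "k' \<in> C b" "k \<noteq> k'"
      show "{int k - i, int k - j} \<inter> {int k' - i, int k' - j} = {}"
      proof (rule ccontr)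
        assume "{int k - i, int k - j} \<inter> {int k' - i, int k' - j} \<noteq> {}"
        then have "int k - i = int k' - j \<or> int k - j = int k' - i" using k by auto
        then have "\<bar>int k - int k'\<bar> = \<bar>i - j\<bar>" by auto
        then show False using ** k by blast
      qed
    qed
  qed
  have fin: "finite (C b)" for b by (simp add: C_def)
  have card: "card (C b) \<le> n" for b
  proof -
    have "C b \<subseteq> {1..n}" by (auto simp: C_def)
    then show ?thesis using card_mono[of "{1..n}" "C b"] by simp
  qed
  let ?S = "\<lambda>b \<omega>. \<Sum>k\<in>C b. wprod (int k - i) (int k - j) \<omega>"
  have split: "(\<Sum>k = 1..n. wprod (int k - i) (int k - j) \<omega>) = (\<Sum>b\<in>{True, False}. 1 * ?S b \<omega>)" for \<omega>
  proof -
    have "{1..n} = C True \<union> C False" "C True \<inter> C False = {}" by (auto simp: C_def)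
    then show ?thesis using fin by (simp add: sum.union_disjoint)
  qed
  have mgf: "(\<integral>\<^sup>+\<omega>. ennreal (exp (\<kappa>' * ?S b \<omega>)) \<partial>M) \<le> ennreal (exp (4 * real n * \<kappa>\<^sup>2 * D))"
    if "\<bar>\<kappa>'\<bar> = \<bar>2 * \<kappa>\<bar>" for b \<kappa>'
  proof -
    have "\<kappa>'\<^sup>2 = (2 * \<kappa>)\<^sup>2" using that by (metis power2_abs)
    then have sq: "\<kappa>'\<^sup>2 = 4 * \<kappa>\<^sup>2" by (simp add: power_mult_distrib)
    have "(\<integral>\<^sup>+\<omega>. ennreal (exp (\<kappa>' * ?S b \<omega>)) \<partial>M) \<le> ennreal (exp (real (card (C b)) * \<kappa>'\<^sup>2 * D))"
      using assms that by (intro wprod_sum_mgf_disjoint fin disj) auto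
    also have "\<dots> \<le> ennreal (exp (4 * real n * \<kappa>\<^sup>2 * D))"
      using card[of b] assms unfolding sq by (intro ennreal_leI) (simp add: mult_right_mono)
    finally show ?thesis .
  qed
  show ?thesis
    unfolding split
  \<comment> \<open>The two halves are not independent of each other. As a combination with total
    weight 2 they are handled at parameter \<open>2 * \<kappa>\<close>, whence the factor 4 in the
    exponent.\<close>
  proof (rule nn_integral_exp_sum_le[where \<Psi> = 2])
    show "1 \<le> exp (4 * real n * \<kappa>\<^sup>2 * D)" using assms by simp
    show "(\<integral>\<^sup>+\<omega>. ennreal (exp (\<kappa> * 2 * ?S b \<omega>)) \<partial>M) \<le> ennreal (exp (4 * real n * \<kappa>\<^sup>2 * D))" for b
      by (rule mgf) (simp add: abs_mult)
    show "(\<integral>\<^sup>+\<omega>. ennreal (exp (- \<kappa> * 2 * ?S b \<omega>)) \<partial>M) \<le> ennreal (exp (4 * real n * \<kappa>\<^sup>2 * D))" for b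
      by (rule mgf) (simp add: abs_mult)
  qed auto
qed

subsection \<open>Second moments and deviations\<close>

abbreviation ma :: "nat \<Rightarrow> int \<Rightarrow> 'a \<Rightarrow> real" where
  "ma m k \<omega> \<equiv> (\<Sum>a<m. psi a * w (k - int a) \<omega>)"

lemma ma_tendsto: "AE \<omega> in M. \<forall>k. (\<lambda>m. ma m k \<omega>) \<longlonglongrightarrow> x k \<omega>"
  using ma_sums by eventually_elim (simp add: sums_def)

text \<open>The definition of the class gives no second moments of \<open>x\<close>. The series of
  absolute values is a square-integrable majorant of all truncations, so dominated convergence
  yields the moments of the limit.\<close>

lemma dominating_ma:
  obtains Y where "\<And>k. Y k \<in> borel_measurable M" "\<And>k. integrable M (\<lambda>\<omega>. (Y k \<omega>)\<^sup>2)"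
    "AE \<omega> in M. \<forall>k m. \<bar>ma m k \<omega>\<bar> \<le> Y k \<omega>"
proof -
  define Y where "Y k \<omega> = (\<Sum>a. \<bar>psi a * w (k - int a) \<omega>\<bar>)" for k \<omega>
  have [measurable]: "Y k \<in> borel_measurable M" for k unfolding Y_def by measurable
  have int: "integrable M (\<lambda>\<omega>. (Y k \<omega>)\<^sup>2)" for k
  proof (rule integrableI_nonneg)
    have "(\<integral>\<^sup>+\<omega>. ennreal ((Y k \<omega>)\<^sup>2) \<partial>M) \<le> ennreal ((1 / \<eta>)\<^sup>2 * \<sigma>\<^sup>2)"
    proof (rule nn_integral_lim_le[where X = "\<lambda>m \<omega>. \<Sum>a<m. \<bar>psi a\<bar> * \<bar>w (k - int a) \<omega>\<bar>" and f = "\<lambda>t. t\<^sup>2"])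
      show "AE \<omega> in M. (\<lambda>m. \<Sum>a<m. \<bar>psi a\<bar> * \<bar>w (k - int a) \<omega>\<bar>) \<longlonglongrightarrow> Y k \<omega>"
        using psi_w_summable
      proof eventually_elim
        case (elim \<omega>)
        then show ?case
          unfolding Y_def by (simp add: abs_mult[symmetric] summable_LIMSEQ)
      qed
      show "(\<integral>\<^sup>+\<omega>. ennreal ((\<Sum>a<m. \<bar>psi a\<bar> * \<bar>w (k - int a) \<omega>\<bar>)\<^sup>2) \<partial>M) \<le> ennreal ((1 / \<eta>)\<^sup>2 * \<sigma>\<^sup>2)" for m
        using psi_sum
        by (intro nn_integral_square_sum_le) (auto simp: nn_integral_eq_integral w_sq_int w_var)
    qed (auto intro: continuous_intros)
    then show "(\<integral>\<^sup>+\<omega>. ennreal ((Y k \<omega>)\<^sup>2) \<partial>M) < \<infinity>" by (auto intro: le_less_trans)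
  qed auto
  have "AE \<omega> in M. \<forall>k m. \<bar>ma m k \<omega>\<bar> \<le> Y k \<omega>"
    using psi_w_summable
  proof eventually_elim
    case (elim \<omega>)
    show ?case
    proof (intro allI)
      fix k m
      show "\<bar>ma m k \<omega>\<bar> \<le> Y k \<omega>"
        unfolding Y_def using elim by (intro order_trans[OF sum_abs] sum_le_suminf) auto
    qed
  qed
  with int show ?thesis by (intro that[of Y]) auto
qed

lemma ma_prod_expectation:
  "expectation (\<lambda>\<omega>. ma m (k - i) \<omega> * ma m (k - j) \<omega>)
     = (\<Sum>(a, b)\<in>{..<m} \<times> {..<m}. psi a * psi b * (if i + int a = j + int b then \<sigma>\<^sup>2 else 0))"
proof -
  have eq: "(\<lambda>\<omega>. ma m (k - i) \<omega> * ma m (k - j) \<omega>)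
     = (\<lambda>\<omega>. \<Sum>(a, b)\<in>{..<m} \<times> {..<m}. psi a * psi b * (w (k - i - int a) \<omega> * w (k - j - int b) \<omega>))"
    by (simp add: sum_product sum.cartesian_product mult_ac)
  have "expectation (\<lambda>\<omega>. ma m (k - i) \<omega> * ma m (k - j) \<omega>) = (\<Sum>(a, b)\<in>{..<m} \<times> {..<m}. psi a * psi b * expectation (\<lambda>\<omega>. w (k - i - int a) \<omega> * w (k - j - int b) \<omega>))"
    unfolding eq by (subst Bochner_Integration.integral_sum) (auto simp: w_prod_int split_beta)
  also have "\<dots> = (\<Sum>(a, b)\<in>{..<m} \<times> {..<m}. psi a * psi b * (if i + int a = j + int b then \<sigma>\<^sup>2 else 0))"
    by (intro sum.cong refl) (auto simp: w_prod_expectation)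
  finally show ?thesis .
qed

lemma x_prod_int: "integrable M (\<lambda>\<omega>. x i \<omega> * x j \<omega>)" (is ?A)
  and ma_prod_tendsto: "(\<lambda>m. expectation (\<lambda>\<omega>. ma m i \<omega> * ma m j \<omega>)) \<longlonglongrightarrow> expectation (\<lambda>\<omega>. x i \<omega> * x j \<omega>)" (is ?B)
proof -
  obtain Y where Y [measurable]: "\<And>k. Y k \<in> borel_measurable M" and Yint: "\<And>k. integrable M (\<lambda>\<omega>. (Y k \<omega>)\<^sup>2)"
    and dom: "AE \<omega> in M. \<forall>k m. \<bar>ma m k \<omega>\<bar> \<le> Y k \<omega>"
    using dominating_ma by blast
  have int: "integrable M (\<lambda>\<omega>. (Y i \<omega>)\<^sup>2 + (Y j \<omega>)\<^sup>2)" using Yint by simp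
  have lim: "AE \<omega> in M. (\<lambda>m. ma m i \<omega> * ma m j \<omega>) \<longlonglongrightarrow> x i \<omega> * x j \<omega>"
    using ma_tendsto by eventually_elim (intro tendsto_mult, auto)
  have bd: "AE \<omega> in M. norm (ma m i \<omega> * ma m j \<omega>) \<le> (Y i \<omega>)\<^sup>2 + (Y j \<omega>)\<^sup>2" for m
    using dom
  proof eventually_elim
    case (elim \<omega>)
    have "norm (ma m i \<omega> * ma m j \<omega>) \<le> Y i \<omega> * Y j \<omega>"
      using elim order_trans[OF abs_ge_zero, of "ma m i \<omega>" "Y i \<omega>"] unfolding real_norm_def abs_mult
      by (intro mult_mono) auto
    also have "\<dots> \<le> (Y i \<omega>)\<^sup>2 + (Y j \<omega>)\<^sup>2"
      using sum_squares_bound[of "Y i \<omega>" "Y j \<omega>"] zero_le_power2[of "Y i \<omega>"] zero_le_power2[of "Y j \<omega>"] by linarith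
    finally show ?case .
  qed
  show ?A by (rule integrable_dominated_convergence[OF _ _ int lim bd]) measurable
  show ?B by (rule integral_dominated_convergence[OF _ _ int lim bd]) measurable
qed

text \<open>By stationarity this is the covariance matrix of the \<open>p\<close> regressors at any
  time; time 0 is taken as reference.\<close>

definition gam :: "nat \<Rightarrow> nat \<Rightarrow> real" where
  "gam i j = expectation (\<lambda>\<omega>. x (- int i) \<omega> * x (- int j) \<omega>)"

lemma gam_quadratic:
  "(\<Sum>i = 1..p. \<Sum>j = 1..p. v i * v j * gam i j) = expectation (\<lambda>\<omega>. (\<Sum>i = 1..p. v i * x (- int i) \<omega>)\<^sup>2)"
proof -
  have "(\<lambda>\<omega>. (\<Sum>i = 1..p. v i * x (- int i) \<omega>)\<^sup>2)
     = (\<lambda>\<omega>. \<Sum>i = 1..p. \<Sum>j = 1..p. v i * v j * (x (- int i) \<omega> * x (- int j) \<omega>))"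
    by (simp add: power2_eq_square sum_product mult_ac)
  then show ?thesis
    by (simp add: gam_def Bochner_Integration.integral_sum x_prod_int)
qed

lemma lin_sq_int: "integrable M (\<lambda>\<omega>. (\<Sum>i\<in>I. v i * x (f i) \<omega>)\<^sup>2)"
proof -
  have "(\<lambda>\<omega>. (\<Sum>i\<in>I. v i * x (f i) \<omega>)\<^sup>2)
     = (\<lambda>\<omega>. \<Sum>i\<in>I. \<Sum>j\<in>I. v i * v j * (x (f i) \<omega> * x (f j) \<omega>))"
    by (simp add: power2_eq_square sum_product mult_ac)
  then show ?thesis by (simp add: x_prod_int)
qed

lemma w_lin_sq_expectation:
  assumes "finite I" "inj_on f I"
  shows "integrable M (\<lambda>\<omega>. (\<Sum>i\<in>I. v i * w (f i) \<omega>)\<^sup>2)"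
    and "expectation (\<lambda>\<omega>. (\<Sum>i\<in>I. v i * w (f i) \<omega>)\<^sup>2) = \<sigma>\<^sup>2 * (\<Sum>i\<in>I. (v i)\<^sup>2)"
proof -
  have eq: "(\<lambda>\<omega>. (\<Sum>i\<in>I. v i * w (f i) \<omega>)\<^sup>2)
     = (\<lambda>\<omega>. \<Sum>i\<in>I. \<Sum>j\<in>I. v i * v j * (w (f i) \<omega> * w (f j) \<omega>))"
    by (simp add: power2_eq_square sum_product mult_ac)
  show "integrable M (\<lambda>\<omega>. (\<Sum>i\<in>I. v i * w (f i) \<omega>)\<^sup>2)"
    unfolding eq by (simp add: w_prod_int)
  have "expectation (\<lambda>\<omega>. (\<Sum>i\<in>I. v i * w (f i) \<omega>)\<^sup>2)
     = (\<Sum>i\<in>I. \<Sum>j\<in>I. v i * v j * (if f i = f j then \<sigma>\<^sup>2 else 0))"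
    unfolding eq by (simp add: Bochner_Integration.integral_sum w_prod_int w_prod_expectation)
  also have "\<dots> = (\<Sum>i\<in>I. \<Sum>j\<in>I. if j = i then \<sigma>\<^sup>2 * (v i)\<^sup>2 else 0)"
    using assms by (intro sum.cong refl) (auto simp: inj_on_def power2_eq_square)
  also have "\<dots> = \<sigma>\<^sup>2 * (\<Sum>i\<in>I. (v i)\<^sup>2)"
    using assms by (simp add: sum_distrib_left)
  finally show "expectation (\<lambda>\<omega>. (\<Sum>i\<in>I. v i * w (f i) \<omega>)\<^sup>2) = \<sigma>\<^sup>2 * (\<Sum>i\<in>I. (v i)\<^sup>2)" .
qed

text \<open>Passing the process \<open>u\<close> through the filter with coefficients 1 and
  \<open>- \<theta> l\<close> returns the same linear combination of innovations, whose second
  moment is explicit. The filter has total weight at most 2, so by stationarity it multiplies second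
  moments by at most 4. This bounds the smallest eigenvalue of the covariance below, uniformly in
  \<open>p\<close>.\<close>

lemma gam_lower:
  "\<sigma>\<^sup>2 / 4 * (\<Sum>i = 1..p. (v i)\<^sup>2) \<le> (\<Sum>i = 1..p. \<Sum>j = 1..p. v i * v j * gam i j)"
proof -
  define u where "u k \<omega> = (\<Sum>i = 1..p. v i * x (k - int i) \<omega>)" for k \<omega>
  have [measurable]: "u k \<in> borel_measurable M" for k unfolding u_def by measurable
  have ui: "integrable M (\<lambda>\<omega>. (u k \<omega>)\<^sup>2)" for k unfolding u_def by (rule lin_sq_int)
  define R where "R = expectation (\<lambda>\<omega>. (u 0 \<omega>)\<^sup>2)"
  have uR: "(\<integral>\<^sup>+\<omega>. ennreal ((u k \<omega>)\<^sup>2) \<partial>M) = ennreal R" for k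
  proof -
    have "(\<integral>\<^sup>+\<omega>. ennreal ((u k \<omega>)\<^sup>2) \<partial>M) = (\<integral>\<^sup>+\<omega>. ennreal ((u 0 \<omega>)\<^sup>2) \<partial>M)"
      unfolding u_def using nn_integral_shift[of "\<lambda>y. ennreal ((\<Sum>i = 1..p. v i * y (- int i))\<^sup>2)" k]
      by (simp add: algebra_simps)
    then show ?thesis using ui by (simp add: R_def nn_integral_eq_integral)
  qed
  define th where "th l = (if l = 0 then 1 else - \<theta> l)" for l :: nat
  have th_sum: "(\<Sum>l\<in>{..p}. \<bar>th l\<bar>) \<le> 2"
  proof -
    have "(\<Sum>l\<in>{..p}. \<bar>th l\<bar>) = 1 + (\<Sum>l = 1..p. \<bar>th l\<bar>)"
      by (simp add: sum.atMost_shift th_def sum.atLeast1_atMost_eq lessThan_Suc_atMost)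
    also have "(\<Sum>l = 1..p. \<bar>th l\<bar>) = l1_norm p \<theta>"
      by (simp add: l1_norm_def th_def)
    finally show ?thesis using l1 eta by simp
  qed
  have eq: "AE \<omega> in M. (\<Sum>i = 1..p. v i * w (- int i) \<omega>) = (\<Sum>l\<in>{..p}. th l * u (- int l) \<omega>)"
    using ar_eq
  proof eventually_elim
    case (elim \<omega>)
    have w: "w k \<omega> = x k \<omega> - (\<Sum>l = 1..p. \<theta> l * x (k - int l) \<omega>)" for k
      using spec[OF elim, of k] by linarith
    have "(\<Sum>l\<in>{..p}. th l * u (- int l) \<omega>) = u 0 \<omega> - (\<Sum>l = 1..p. \<theta> l * u (- int l) \<omega>)"
      by (simp add: sum.atMost_shift th_def sum.atLeast1_atMost_eq lessThan_Suc_atMost sum_negf)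
    also have "(\<Sum>l = 1..p. \<theta> l * u (- int l) \<omega>) = (\<Sum>i = 1..p. v i * (\<Sum>l = 1..p. \<theta> l * x (- int i - int l) \<omega>))"
      unfolding u_def sum_distrib_left by (rule trans[OF sum.swap], intro sum.cong refl) (simp add: mult_ac minus_diff_commute)
    also have "u 0 \<omega> - \<dots> = (\<Sum>i = 1..p. v i * w (- int i) \<omega>)"
      unfolding w u_def by (simp add: right_diff_distrib sum_subtractf)
    finally show ?case by simp
  qed
  have "ennreal (\<sigma>\<^sup>2 * (\<Sum>i = 1..p. (v i)\<^sup>2)) = (\<integral>\<^sup>+\<omega>. ennreal ((\<Sum>i = 1..p. v i * w (- int i) \<omega>)\<^sup>2) \<partial>M)"
    using w_lin_sq_expectation[of "{1..p}" "\<lambda>i. - int i" v]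
    by (subst nn_integral_eq_integral) (auto simp: inj_on_def)
  also have "\<dots> = (\<integral>\<^sup>+\<omega>. ennreal ((\<Sum>l\<in>{..p}. th l * u (- int l) \<omega>)\<^sup>2) \<partial>M)"
    using eq by (intro nn_integral_cong_AE) auto
  also have "\<dots> \<le> ennreal (2\<^sup>2 * R)"
    using th_sum by (intro nn_integral_square_sum_le) (auto simp: uR R_def)
  finally have "\<sigma>\<^sup>2 * (\<Sum>i = 1..p. (v i)\<^sup>2) \<le> 4 * R"
    by (subst (asm) ennreal_le_iff) (auto simp: R_def)
  then show ?thesis
    unfolding gam_quadratic R_def u_def by simp
qed

end

section \<open>Deviations of the noise correlation and of the Gram matrix\<close>

context ar_proc begin

text \<open>A regressor with lag \<open>l \<ge> 1\<close> involves only innovations before time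
  \<open>k\<close>, so every product that occurs is off the diagonal and has variance
  \<open>\<sigma> ^ 4\<close>. The moving average has total weight
  \<open>1 / \<eta>\<close>.\<close>

lemma cross_mgf:
  assumes "1 \<le> K" "1 \<le> l" "\<bar>2 * (\<kappa> / \<eta>)\<bar> \<le> c0 / 4" "\<bar>2 * (\<kappa> / \<eta>)\<bar> \<le> \<sigma> ^ 4 * c0 ^ 3 / 256"
  shows "(\<integral>\<^sup>+\<omega>. ennreal (exp (\<kappa> * (\<Sum>k = 1..n. w (int k) \<omega> * x (int k - int l) \<omega>))) \<partial>M)
     \<le> ennreal (exp (4 * real n * (\<kappa> / \<eta>)\<^sup>2 * \<sigma> ^ 4))"
proof (rule nn_integral_lim_le[where X = "\<lambda>(m::nat) \<omega>. \<Sum>k = 1..n. w (int k) \<omega> * ma m (int k - int l) \<omega>" and f = "\<lambda>t. exp (\<kappa> * t)"])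
  show "AE \<omega> in M. (\<lambda>m. \<Sum>k = 1..n. w (int k) \<omega> * ma m (int k - int l) \<omega>) \<longlonglongrightarrow> (\<Sum>k = 1..n. w (int k) \<omega> * x (int k - int l) \<omega>)"
    using ma_tendsto by eventually_elim (auto intro!: tendsto_intros)
  fix m
  have eq: "(\<Sum>k = 1..n. w (int k) \<omega> * ma m (int k - int l) \<omega>)
     = (\<Sum>a<m. psi a * (\<Sum>k = 1..n. wprod (int k - 0) (int k - int (l + a)) \<omega>))" for \<omega>
    unfolding sum_distrib_left using assms(2)
    by (subst sum.swap) (auto simp: wprod_def algebra_simps intro!: sum.cong)
  show "(\<integral>\<^sup>+\<omega>. ennreal (exp (\<kappa> * (\<Sum>k = 1..n. w (int k) \<omega> * ma m (int k - int l) \<omega>))) \<partial>M)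
     \<le> ennreal (exp (4 * real n * (\<kappa> / \<eta>)\<^sup>2 * \<sigma> ^ 4))"
    unfolding eq
  proof (rule nn_integral_exp_sum_le[where \<Psi> = "1 / \<eta>"])
    have v: "mgf_var (\<sigma> ^ 4) 0 (int (l + a))" for a
      using assms(2) by (simp add: mgf_var_def)
    show "(\<integral>\<^sup>+\<omega>. ennreal (exp (\<kappa> * (1 / \<eta>) * (\<Sum>k = 1..n. wprod (int k - 0) (int k - int (l + a)) \<omega>))) \<partial>M)
       \<le> ennreal (exp (4 * real n * (\<kappa> / \<eta>)\<^sup>2 * \<sigma> ^ 4))" for a
      using wprod_sum_mgf[OF assms(1) v[of a], of "\<kappa> / \<eta>" n] assms by simp
    show "(\<integral>\<^sup>+\<omega>. ennreal (exp (- \<kappa> * (1 / \<eta>) * (\<Sum>k = 1..n. wprod (int k - 0) (int k - int (l + a)) \<omega>))) \<partial>M)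
       \<le> ennreal (exp (4 * real n * (\<kappa> / \<eta>)\<^sup>2 * \<sigma> ^ 4))" for a
      using wprod_sum_mgf[OF assms(1) v[of a], of "- (\<kappa> / \<eta>)" n] assms by simp
  qed (use psi_sum eta in auto)
qed (auto intro!: continuous_intros)

text \<open>Products of two moving averages do meet the diagonal, so the crude variance
  \<open>16 / c0\<^sup>2\<close> is used, with total weight \<open>1 / \<eta>\<^sup>2\<close>. Both
  the truncation and its expectation converge, which keeps the sums centred.\<close>

lemma autocov_mgf:
  assumes "1 \<le> K" "\<bar>2 * (\<kappa> / \<eta>\<^sup>2)\<bar> \<le> c0 / 4" "\<bar>2 * (\<kappa> / \<eta>\<^sup>2)\<bar> \<le> c0 / 16"
  shows "(\<integral>\<^sup>+\<omega>. ennreal (exp (\<kappa> * ((\<Sum>k = 1..n. x (int k - int i) \<omega> * x (int k - int j) \<omega>) - real n * gam i j))) \<partial>M)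
     \<le> ennreal (exp (4 * real n * (\<kappa> / \<eta>\<^sup>2)\<^sup>2 * (16 / c0\<^sup>2)))"
proof (rule nn_integral_lim_le[where X = "\<lambda>(m::nat) \<omega>. (\<Sum>k = 1..n. ma m (int k - int i) \<omega> * ma m (int k - int j) \<omega>)
      - real n * expectation (\<lambda>\<omega>. ma m (- int i) \<omega> * ma m (- int j) \<omega>)" and f = "\<lambda>t. exp (\<kappa> * t)"])
  have c0: "0 < c0" using c0_pos assms by simp
  show "AE \<omega> in M. (\<lambda>m. (\<Sum>k = 1..n. ma m (int k - int i) \<omega> * ma m (int k - int j) \<omega>)
      - real n * expectation (\<lambda>\<omega>. ma m (- int i) \<omega> * ma m (- int j) \<omega>))
     \<longlonglongrightarrow> (\<Sum>k = 1..n. x (int k - int i) \<omega> * x (int k - int j) \<omega>) - real n * gam i j"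
    unfolding gam_def using ma_tendsto
    by eventually_elim (intro tendsto_intros ma_prod_tendsto, auto)
  fix m :: nat
  let ?I = "{..<m} \<times> {..<m}"
  have ma_eq: "ma m (int k - int i) \<omega> * ma m (int k - int j) \<omega>
     = (\<Sum>(a, b)\<in>?I. psi a * psi b * (w (int k - int (i + a)) \<omega> * w (int k - int (j + b)) \<omega>))" for k \<omega>
    by (simp add: sum_product sum.cartesian_product algebra_simps)
  have ex: "expectation (\<lambda>\<omega>. ma m (- int i) \<omega> * ma m (- int j) \<omega>)
     = (\<Sum>(a, b)\<in>?I. psi a * psi b * (if i + a = j + b then \<sigma>\<^sup>2 else 0))"
    using ma_prod_expectation[where m = m and k = 0 and i = "int i" and j = "int j"] by (simp flip: of_nat_add cong: if_cong)
  have eq: "(\<Sum>k = 1..n. ma m (int k - int i) \<omega> * ma m (int k - int j) \<omega>)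
      - real n * expectation (\<lambda>\<omega>. ma m (- int i) \<omega> * ma m (- int j) \<omega>)
     = (\<Sum>ab\<in>?I. (psi (fst ab) * psi (snd ab)) * (\<Sum>k = 1..n. wprod (int k - int (i + fst ab)) (int k - int (j + snd ab)) \<omega>))" for \<omega>
  proof -
    have "(\<Sum>k = 1..n. ma m (int k - int i) \<omega> * ma m (int k - int j) \<omega>)
      - real n * expectation (\<lambda>\<omega>. ma m (- int i) \<omega> * ma m (- int j) \<omega>)
      = (\<Sum>k = 1..n. ma m (int k - int i) \<omega> * ma m (int k - int j) \<omega> - expectation (\<lambda>\<omega>. ma m (- int i) \<omega> * ma m (- int j) \<omega>))"
      by (simp add: sum_subtractf)
    also have "\<dots> = (\<Sum>k = 1..n. \<Sum>ab\<in>?I. (psi (fst ab) * psi (snd ab)) * wprod (int k - int (i + fst ab)) (int k - int (j + snd ab)) \<omega>)"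
      unfolding ma_eq ex sum_subtractf[symmetric]
      by (intro sum.cong refl) (auto simp: wprod_def right_diff_distrib simp flip: of_nat_add)
    finally show ?thesis
      unfolding sum_distrib_left by (subst sum.swap)
  qed
  have psi2: "(\<Sum>ab\<in>?I. \<bar>psi (fst ab) * psi (snd ab)\<bar>) \<le> 1 / \<eta>\<^sup>2"
  proof -
    have "(\<Sum>ab\<in>?I. \<bar>psi (fst ab) * psi (snd ab)\<bar>) = (\<Sum>a<m. \<bar>psi a\<bar>) * (\<Sum>b<m. \<bar>psi b\<bar>)"
      by (simp add: sum_product sum.cartesian_product abs_mult split_beta)
    also have "\<dots> \<le> 1 / \<eta> * (1 / \<eta>)"
      using eta by (intro mult_mono psi_sum sum_nonneg) auto
    finally show ?thesis by (simp add: power2_eq_square)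
  qed
  have d: "16 / c0\<^sup>2 * c0 ^ 3 / 256 = c0 / 16"
    using c0 by (simp add: power2_eq_square power3_eq_cube)
  show "(\<integral>\<^sup>+\<omega>. ennreal (exp (\<kappa> * ((\<Sum>k = 1..n. ma m (int k - int i) \<omega> * ma m (int k - int j) \<omega>)
      - real n * expectation (\<lambda>\<omega>. ma m (- int i) \<omega> * ma m (- int j) \<omega>)))) \<partial>M)
     \<le> ennreal (exp (4 * real n * (\<kappa> / \<eta>\<^sup>2)\<^sup>2 * (16 / c0\<^sup>2)))"
    unfolding eq
  proof (rule nn_integral_exp_sum_le[OF psi2])
    have v: "mgf_var (16 / c0\<^sup>2) i j" for i j by (simp add: mgf_var_def)
    show "(\<integral>\<^sup>+\<omega>. ennreal (exp (\<kappa> * (1 / \<eta>\<^sup>2) * (\<Sum>k = 1..n. wprod (int k - int (i + fst ab)) (int k - int (j + snd ab)) \<omega>))) \<partial>M)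
       \<le> ennreal (exp (4 * real n * (\<kappa> / \<eta>\<^sup>2)\<^sup>2 * (16 / c0\<^sup>2)))" for ab
      using wprod_sum_mgf[OF assms(1) v[of "int (i + fst ab)" "int (j + snd ab)"], of "\<kappa> / \<eta>\<^sup>2" n] assms d by simp
    show "(\<integral>\<^sup>+\<omega>. ennreal (exp (- \<kappa> * (1 / \<eta>\<^sup>2) * (\<Sum>k = 1..n. wprod (int k - int (i + fst ab)) (int k - int (j + snd ab)) \<omega>))) \<partial>M)
       \<le> ennreal (exp (4 * real n * (\<kappa> / \<eta>\<^sup>2)\<^sup>2 * (16 / c0\<^sup>2)))" for ab
      using wprod_sum_mgf[OF assms(1) v[of "int (i + fst ab)" "int (j + snd ab)"], of "- (\<kappa> / \<eta>\<^sup>2)" n] assms d by simp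
  qed (use eta in auto)
qed (auto intro!: continuous_intros)

text \<open>The noise is written as the residual of \<open>x\<close>, so that the event concerns the
  path alone and feeds the deterministic analysis directly. Only the threshold for the Gram matrix
  involves \<open>c0\<close>, and with it \<open>K\<close>.\<close>

definition good :: "nat \<Rightarrow> real \<Rightarrow> 'a \<Rightarrow> bool" where
  "good n r \<omega> \<longleftrightarrow>
     (\<forall>l\<in>{1..p}. \<bar>\<Sum>k = 1..n. (x (int k) \<omega> - (\<Sum>l = 1..p. \<theta> l * x (int k - int l) \<omega>)) * x (int k - int l) \<omega>\<bar> \<le> real n * (6 * \<sigma>\<^sup>2 / \<eta> * r)) \<and>
     (\<forall>i\<in>{1..p}. \<forall>j\<in>{1..p}. \<bar>(\<Sum>k = 1..n. x (int k - int i) \<omega> * x (int k - int j) \<omega>) - real n * gam i j\<bar> \<le> real n * (28 / (c0 * \<eta>\<^sup>2) * r))"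

lemma good_meas [measurable]: "Measurable.pred M (good n r)"
  unfolding good_def by measurable

lemma prob_not_good:
  assumes "1 \<le> K" and p: "2 \<le> p" and n: "1 \<le> n" and r: "r = sqrt (ln (real p) / real n)"
    and small: "r \<le> 1 / 8" "r \<le> \<sigma>\<^sup>2 * c0 / 8" "r \<le> \<sigma> ^ 6 * c0 ^ 3 / 512"
  shows "prob {\<omega> \<in> space M. \<not> good n r \<omega>} \<le> 4 / real p"
proof -
  have c0: "0 < c0" using c0_pos assms by simp
  have lnp: "0 < ln (real p)" using p by simp
  have r0: "0 < r" using lnp n r by simp
  have nr: "real n * r\<^sup>2 = ln (real p)" using lnp n r by simp
  define A where "A l = {\<omega> \<in> space M. real n * (6 * \<sigma>\<^sup>2 / \<eta> * r) < \<bar>\<Sum>k = 1..n. w (int k) \<omega> * x (int k - int l) \<omega>\<bar>}" for l :: nat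
  define B where "B ij = {\<omega> \<in> space M. real n * (28 / (c0 * \<eta>\<^sup>2) * r) <
      \<bar>(\<Sum>k = 1..n. x (int k - int (fst ij)) \<omega> * x (int k - int (snd ij)) \<omega>) - real n * gam (fst ij) (snd ij)\<bar>}" for ij :: "nat \<times> nat"
  have A: "prob (A l) \<le> 2 / real p ^ 2" if l: "1 \<le> l" for l
  proof -
    \<comment> \<open>With this choice the Chernoff exponent is
      \<open>(4 - 6) * n * r\<^sup>2 = - 2 * ln p\<close>, enough for a union over \<open>p\<close>
      lags.\<close>
    define \<kappa> where "\<kappa> = \<eta> / \<sigma>\<^sup>2 * r"
    have k: "0 < \<kappa>" using r0 eta sigma by (simp add: \<kappa>_def)
    have ke: "\<kappa> / \<eta> = r / \<sigma>\<^sup>2" using eta by (simp add: \<kappa>_def)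
    have s4: "\<sigma> ^ 6 = \<sigma> ^ 4 * \<sigma>\<^sup>2" by (simp add: power_add[symmetric])
    have b1: "2 * (r / \<sigma>\<^sup>2) \<le> c0 / 4" "2 * (r / \<sigma>\<^sup>2) \<le> \<sigma> ^ 4 * c0 ^ 3 / 256"
      using small sigma unfolding s4 by (simp_all add: field_simps)
    have "prob (A l) \<le> 2 * exp (- \<kappa> * (real n * (6 * \<sigma>\<^sup>2 / \<eta> * r))) * exp (4 * real n * (\<kappa> / \<eta>)\<^sup>2 * \<sigma> ^ 4)"
      unfolding A_def
    proof (rule chernoff_two_sided[OF _ k])
      show "(\<integral>\<^sup>+\<omega>. ennreal (exp (\<kappa> * (\<Sum>k = 1..n. w (int k) \<omega> * x (int k - int l) \<omega>))) \<partial>M)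
        \<le> ennreal (exp (4 * real n * (\<kappa> / \<eta>)\<^sup>2 * \<sigma> ^ 4))"
        using b1 r0 l assms unfolding ke by (intro order_trans[OF cross_mgf]) (auto simp: ke)
      show "(\<integral>\<^sup>+\<omega>. ennreal (exp (- \<kappa> * (\<Sum>k = 1..n. w (int k) \<omega> * x (int k - int l) \<omega>))) \<partial>M)
        \<le> ennreal (exp (4 * real n * (\<kappa> / \<eta>)\<^sup>2 * \<sigma> ^ 4))"
        using b1 r0 l assms cross_mgf[where l = l and \<kappa> = "- \<kappa>" and n = n] by (simp add: ke)
    qed auto
    also have "- \<kappa> * (real n * (6 * \<sigma>\<^sup>2 / \<eta> * r)) = - 6 * (real n * r\<^sup>2)"
      using eta sigma by (simp add: \<kappa>_def power2_eq_square)
    also have "4 * real n * (\<kappa> / \<eta>)\<^sup>2 * \<sigma> ^ 4 = 4 * (real n * r\<^sup>2)"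
      using sigma unfolding ke by (simp add: power_divide power_mult[symmetric])
    also have "2 * exp (- 6 * (real n * r\<^sup>2)) * exp (4 * (real n * r\<^sup>2)) = 2 / real p ^ 2"
    proof -
      have "exp (- 6 * ln (real p)) * exp (4 * ln (real p)) = exp (- (2 * ln (real p)))"
        by (simp add: exp_add[symmetric])
      also have "\<dots> = inverse (real p ^ 2)"
        using p exp_of_nat_mult[of 2 "ln (real p)"] by (simp add: exp_minus)
      finally show ?thesis unfolding nr by (simp add: divide_inverse mult.assoc)
    qed
    finally show ?thesis .
  qed
  have B: "prob (B ij) \<le> 2 / real p ^ 3" for ij
  proof -
    \<comment> \<open>Here the exponent is \<open>(4 - 7) * n * r\<^sup>2 = - 3 * ln p\<close>,
      enough for a union over the pairs of lags.\<close>
    define \<kappa> where "\<kappa> = \<eta>\<^sup>2 * r * c0 / 4"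
    have k: "0 < \<kappa>" using r0 eta c0 by (simp add: \<kappa>_def)
    have ke: "\<kappa> / \<eta>\<^sup>2 = r * c0 / 4" using eta by (simp add: \<kappa>_def)
    have b1: "2 * (r * c0 / 4) \<le> c0 / 4" "2 * (r * c0 / 4) \<le> c0 / 16"
      using mult_right_mono[OF small(1), of c0] c0 by (simp_all add: field_simps)
    have "prob (B ij) \<le> 2 * exp (- \<kappa> * (real n * (28 / (c0 * \<eta>\<^sup>2) * r))) * exp (4 * real n * (\<kappa> / \<eta>\<^sup>2)\<^sup>2 * (16 / c0\<^sup>2))"
      unfolding B_def
    proof (rule chernoff_two_sided[OF _ k])
      show "(\<integral>\<^sup>+\<omega>. ennreal (exp (\<kappa> * ((\<Sum>k = 1..n. x (int k - int (fst ij)) \<omega> * x (int k - int (snd ij)) \<omega>) - real n * gam (fst ij) (snd ij)))) \<partial>M)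
        \<le> ennreal (exp (4 * real n * (\<kappa> / \<eta>\<^sup>2)\<^sup>2 * (16 / c0\<^sup>2)))"
        using b1 r0 c0 assms by (intro autocov_mgf) (auto simp: ke abs_mult)
      show "(\<integral>\<^sup>+\<omega>. ennreal (exp (- \<kappa> * ((\<Sum>k = 1..n. x (int k - int (fst ij)) \<omega> * x (int k - int (snd ij)) \<omega>) - real n * gam (fst ij) (snd ij)))) \<partial>M)
        \<le> ennreal (exp (4 * real n * (\<kappa> / \<eta>\<^sup>2)\<^sup>2 * (16 / c0\<^sup>2)))"
        using b1 r0 c0 assms autocov_mgf[where \<kappa> = "- \<kappa>" and n = n and i = "fst ij" and j = "snd ij"] by (simp add: ke abs_mult)
    qed auto
    also have "- \<kappa> * (real n * (28 / (c0 * \<eta>\<^sup>2) * r)) = - 7 * (real n * r\<^sup>2)"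
      using eta c0 by (simp add: \<kappa>_def power2_eq_square)
    also have "4 * real n * (\<kappa> / \<eta>\<^sup>2)\<^sup>2 * (16 / c0\<^sup>2) = 4 * (real n * r\<^sup>2)"
      using c0 unfolding ke by (simp add: power_divide power_mult_distrib)
    also have "2 * exp (- 7 * (real n * r\<^sup>2)) * exp (4 * (real n * r\<^sup>2)) = 2 / real p ^ 3"
    proof -
      have "exp (- 7 * ln (real p)) * exp (4 * ln (real p)) = exp (- (3 * ln (real p)))"
        by (simp add: exp_add[symmetric])
      also have "\<dots> = inverse (real p ^ 3)"
        using p exp_of_nat_mult[of 3 "ln (real p)"] by (simp add: exp_minus)
      finally show ?thesis unfolding nr by (simp add: divide_inverse mult.assoc)
    qed
    finally show ?thesis .
  qed
  have [measurable]: "A l \<in> events" "B ij \<in> events" for l ij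
    unfolding A_def B_def by measurable
  have "prob {\<omega> \<in> space M. \<not> good n r \<omega>} \<le> prob ((\<Union>l\<in>{1..p}. A l) \<union> (\<Union>ij\<in>{1..p} \<times> {1..p}. B ij))"
  \<comment> \<open>The events \<open>A l\<close> speak of \<open>w\<close>, \<open>good\<close> of
    the residuals of \<open>x\<close>; the two agree only almost surely.\<close>
  proof (rule finite_measure_mono_AE)
    show "AE \<omega> in M. \<omega> \<in> {\<omega> \<in> space M. \<not> good n r \<omega>} \<longrightarrow> \<omega> \<in> (\<Union>l\<in>{1..p}. A l) \<union> (\<Union>ij\<in>{1..p} \<times> {1..p}. B ij)"
      using ar_eq
    proof eventually_elim
      case (elim \<omega>)
      have w: "x k \<omega> - (\<Sum>l = 1..p. \<theta> l * x (k - int l) \<omega>) = w k \<omega>" for k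
        using spec[OF elim, of k] by linarith
      show ?case
      proof
        assume \<omega>: "\<omega> \<in> {\<omega> \<in> space M. \<not> good n r \<omega>}"
        then have "\<not> good n r \<omega>" by simp
        then show "\<omega> \<in> (\<Union>l\<in>{1..p}. A l) \<union> (\<Union>ij\<in>{1..p} \<times> {1..p}. B ij)"
          using \<omega> unfolding good_def w A_def B_def by (auto simp: not_le)
      qed
    qed
  qed measurable
  also have "\<dots> \<le> prob (\<Union>l\<in>{1..p}. A l) + prob (\<Union>ij\<in>{1..p} \<times> {1..p}. B ij)"
    by (rule measure_Un_le) measurable
  also have "\<dots> \<le> (\<Sum>l\<in>{1..p}. prob (A l)) + (\<Sum>ij\<in>{1..p} \<times> {1..p}. prob (B ij))"
    by (intro add_mono finite_measure_subadditive_finite) auto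
  also have "\<dots> \<le> (\<Sum>l\<in>{1..p}. 2 / real p ^ 2) + (\<Sum>ij\<in>{1..p} \<times> {1..p}. 2 / real p ^ 3)"
    using A B by (intro add_mono sum_mono) auto
  also have "\<dots> = 4 / real p"
    using p by (simp add: power2_eq_square power3_eq_cube)
  finally show ?thesis .
qed

end

subsection \<open>The deterministic analysis of the lasso\<close>

lemma le_of_quadratic:
  fixes N a b :: real
  assumes "N\<^sup>2 \<le> a * N + b" "0 \<le> a" "0 \<le> b"
  shows "N \<le> a + sqrt b"
proof (rule ccontr)
  assume "\<not> N \<le> a + sqrt b"
  then have N: "a + sqrt b < N" by simp
  then have "0 \<le> sqrt b" "sqrt b \<le> N" "0 < N" using assms real_sqrt_ge_zero[OF assms(3)] by linarith+
  then have "b \<le> sqrt b * N" using assms(3) mult_left_mono[of "sqrt b" N "sqrt b"] by simp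
  moreover have "(a + sqrt b) * N < N * N" using N \<open>0 < N\<close> by (rule mult_strict_right_mono)
  ultimately show False using assms(1) by (simp add: power2_eq_square algebra_simps)
qed

text \<open>\<open>T1\<close> bounds the noise, \<open>T2\<close> the entrywise error of the Gram
  matrix, \<open>\<kappa>\<close> the smallest eigenvalue of \<open>g\<close>,
  \<open>\<zeta>\<close> the mass of \<open>\<theta>\<close> outside \<open>S\<close>. Optimality
  confines the error \<open>d\<close> to a cone in which its squared 1-norm is at most
  \<open>32 * s * N\<^sup>2 + 32 * \<zeta>\<^sup>2\<close>. The Gram error then costs at most half
  of \<open>\<kappa> * N\<^sup>2\<close> plus a term in \<open>\<zeta>\<close>, which leaves a
  quadratic inequality for \<open>N\<close>.\<close>

lemma lasso_deterministic:
  fixes x :: "int \<Rightarrow> real" and \<theta> v :: "nat \<Rightarrow> real" and g :: "nat \<Rightarrow> nat \<Rightarrow> real"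
  assumes n: "1 \<le> n"
    and noise: "\<And>l. l \<in> {1..p} \<Longrightarrow> \<bar>\<Sum>k = 1..n. (x (int k) - (\<Sum>l = 1..p. \<theta> l * x (int k - int l))) * x (int k - int l)\<bar> \<le> real n * T1"
    and gram: "\<And>i j. i \<in> {1..p} \<Longrightarrow> j \<in> {1..p} \<Longrightarrow> \<bar>(\<Sum>k = 1..n. x (int k - int i) * x (int k - int j)) - real n * g i j\<bar> \<le> real n * T2"
    and low: "\<And>u. \<kappa> * (\<Sum>i = 1..p. (u i)\<^sup>2) \<le> (\<Sum>i = 1..p. \<Sum>j = 1..p. u i * u j * g i j)"
    and obj: "lasso_objective n p \<gamma> x v \<le> lasso_objective n p \<gamma> x \<theta>"
    and gamma: "4 * T1 \<le> \<gamma>" "0 < \<gamma>" and T2: "0 \<le> T2" "64 * real s * T2 \<le> \<kappa>"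
    and S: "S \<subseteq> {1..p}" "card S \<le> s" and \<zeta>: "(\<Sum>l\<in>{1..p} - S. \<bar>\<theta> l\<bar>) \<le> \<zeta>"
    and kappa: "0 < \<kappa>"
  shows "L2_set (\<lambda>l. v l - \<theta> l) {1..p} \<le> 3 * \<gamma> * sqrt (real s) / \<kappa> + sqrt (2 / \<kappa> * (2 * \<gamma> * \<zeta> + 32 * T2 * \<zeta>\<^sup>2))"
proof -
  define d where "d l = v l - \<theta> l" for l
  define e where "e k = x (int k) - (\<Sum>l = 1..p. \<theta> l * x (int k - int l))" for k :: nat
  define X where "X k = (\<Sum>l = 1..p. d l * x (int k - int l))" for k :: nat
  define N where "N = L2_set d {1..p}"
  define dS where "dS = (\<Sum>l\<in>S. \<bar>d l\<bar>)"
  define dC where "dC = (\<Sum>l\<in>{1..p} - S. \<bar>d l\<bar>)"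
  define Q where "Q = 1 / real n * (\<Sum>k = 1..n. (X k)\<^sup>2)"
  have N0: "0 \<le> N" unfolding N_def by simp
  have z0: "0 \<le> \<zeta>" by (rule order_trans[OF sum_nonneg \<zeta>]) simp
  have Nsq: "N\<^sup>2 = (\<Sum>l = 1..p. (d l)\<^sup>2)"
    unfolding N_def L2_set_def by (simp add: sum_nonneg)
  have split: "(\<Sum>l = 1..p. f l) = (\<Sum>l\<in>S. f l) + (\<Sum>l\<in>{1..p} - S. f l)" for f :: "nat \<Rightarrow> real"
    using sum.subset_diff[OF S(1), of f] by simp
  have d1: "(\<Sum>l = 1..p. \<bar>d l\<bar>) = dS + dC"
    unfolding dS_def dC_def by (rule split)
  have nonneg: "0 \<le> dS" "0 \<le> dC" unfolding dS_def dC_def by (auto intro: sum_nonneg)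

  have res: "x (int k) - (\<Sum>l = 1..p. v l * x (int k - int l)) = e k - X k" for k :: nat
    unfolding e_def X_def d_def by (simp add: left_diff_distrib sum_subtractf)
  have "sq_loss n p x v - sq_loss n p x \<theta> = 1 / real n * (\<Sum>k = 1..n. (e k - X k)\<^sup>2 - (e k)\<^sup>2)"
    unfolding sq_loss_def res e_def[symmetric] by (simp add: sum_subtractf right_diff_distrib)
  also have "(\<Sum>k = 1..n. (e k - X k)\<^sup>2 - (e k)\<^sup>2) = (\<Sum>k = 1..n. (X k)\<^sup>2) - 2 * (\<Sum>k = 1..n. e k * X k)"
    by (simp add: power2_eq_square algebra_simps sum_subtractf sum.distrib sum_distrib_left)
  finally have loss: "sq_loss n p x v - sq_loss n p x \<theta> = Q - 2 / real n * (\<Sum>k = 1..n. e k * X k)"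
    by (simp add: Q_def right_diff_distrib)
  have "(\<Sum>k = 1..n. e k * X k) = (\<Sum>l = 1..p. d l * (\<Sum>k = 1..n. e k * x (int k - int l)))"
    unfolding X_def sum_distrib_left by (subst sum.swap) (simp add: mult_ac)
  also have "\<dots> \<le> (\<Sum>l = 1..p. \<bar>d l\<bar> * (real n * T1))"
  proof (rule sum_mono)
    fix l assume "l \<in> {1..p}"
    then have "\<bar>d l * (\<Sum>k = 1..n. e k * x (int k - int l))\<bar> \<le> \<bar>d l\<bar> * (real n * T1)"
      unfolding abs_mult e_def by (intro mult_left_mono noise) auto
    then show "d l * (\<Sum>k = 1..n. e k * x (int k - int l)) \<le> \<bar>d l\<bar> * (real n * T1)" by linarith
  qed
  also have "\<dots> = (dS + dC) * (real n * T1)" by (simp add: d1[symmetric] sum_distrib_right)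
  finally have "2 / real n * (\<Sum>k = 1..n. e k * X k) \<le> 2 / real n * ((dS + dC) * (real n * T1))"
    by (rule mult_left_mono) simp
  also have "\<dots> = 2 * T1 * (dS + dC)" using n by simp
  \<comment> \<open>The noise uses up half of the penalty; the other half still controls the error
    outside \<open>S\<close>.\<close>
  also have "\<dots> \<le> \<gamma> / 2 * (dS + dC)" using gamma nonneg by (intro mult_right_mono) auto
  finally have Q1: "Q \<le> \<gamma> / 2 * (dS + dC) + \<gamma> * (l1_norm p \<theta> - l1_norm p v)"
    using obj loss unfolding lasso_objective_def by (simp add: right_diff_distrib)
  have "l1_norm p \<theta> - l1_norm p v \<le> dS - dC + 2 * \<zeta>"
  proof -
    have "(\<Sum>l\<in>S. \<bar>\<theta> l\<bar>) \<le> (\<Sum>l\<in>S. \<bar>v l\<bar>) + dS"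
      unfolding dS_def sum.distrib[symmetric] d_def by (intro sum_mono) auto
    moreover have "dC \<le> (\<Sum>l\<in>{1..p} - S. \<bar>v l\<bar>) + (\<Sum>l\<in>{1..p} - S. \<bar>\<theta> l\<bar>)"
      unfolding dC_def sum.distrib[symmetric] d_def by (intro sum_mono) auto
    ultimately show ?thesis using \<zeta> unfolding l1_norm_def split by linarith
  qed
  then have "\<gamma> * (l1_norm p \<theta> - l1_norm p v) \<le> \<gamma> * (dS - dC + 2 * \<zeta>)"
    using gamma by (intro mult_left_mono) auto
  with Q1 have "Q \<le> \<gamma> / 2 * (dS + dC) + \<gamma> * (dS - dC + 2 * \<zeta>)" by linarith
  also have "\<dots> = \<gamma> * (3 / 2 * dS - dC / 2 + 2 * \<zeta>)" by (simp add: field_simps)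
  finally have Q2: "Q \<le> \<gamma> * (3 / 2 * dS - dC / 2 + 2 * \<zeta>)" .
  have "0 \<le> Q" unfolding Q_def by (intro mult_nonneg_nonneg sum_nonneg) auto
  with Q2 have "0 \<le> \<gamma> * (3 / 2 * dS - dC / 2 + 2 * \<zeta>)" by linarith
  then have "0 \<le> 3 / 2 * dS - dC / 2 + 2 * \<zeta>" using gamma by (simp add: zero_le_mult_iff)
  \<comment> \<open>The cone condition: the left side of the basic inequality is nonnegative, which
    bounds \<open>dC\<close> by \<open>3 * dS + 4 * \<zeta>\<close>.\<close>
  then have cone: "dS + dC \<le> 4 * dS + 4 * \<zeta>" by linarith
  have dS: "dS \<le> sqrt (real s) * N"
  proof -
    have "dS\<^sup>2 = (\<Sum>l\<in>S. 1 * \<bar>d l\<bar>)\<^sup>2" by (simp add: dS_def)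
    also have "\<dots> \<le> (\<Sum>l\<in>S. 1\<^sup>2) * (\<Sum>l\<in>S. \<bar>d l\<bar>\<^sup>2)" by (rule Cauchy_Schwarz_ineq_sum)
    also have "\<dots> \<le> real s * N\<^sup>2"
      unfolding Nsq split using S(2) by (intro mult_mono) (auto simp: sum_nonneg)
    finally have "dS \<le> sqrt (real s * N\<^sup>2)" by (rule real_le_rsqrt)
    then show ?thesis using N0 by (simp add: real_sqrt_mult)
  qed
  have l1sq: "(dS + dC)\<^sup>2 \<le> 32 * real s * N\<^sup>2 + 32 * \<zeta>\<^sup>2"
  proof -
    have "(dS + dC)\<^sup>2 \<le> (4 * (sqrt (real s) * N) + 4 * \<zeta>)\<^sup>2"
      using cone dS nonneg by (intro power_mono) auto
    also have "\<dots> \<le> 2 * (4 * (sqrt (real s) * N))\<^sup>2 + 2 * (4 * \<zeta>)\<^sup>2"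
      using sum_squares_bound[of "4 * (sqrt (real s) * N)" "4 * \<zeta>"] by (simp add: power2_sum)
    also have "\<dots> = 32 * real s * N\<^sup>2 + 32 * \<zeta>\<^sup>2"
      by (simp add: power_mult_distrib)
    finally show ?thesis .
  qed
  have "Q = 1 / real n * (\<Sum>i = 1..p. \<Sum>j = 1..p. d i * d j * (\<Sum>k = 1..n. x (int k - int i) * x (int k - int j)))"
  proof -
    have "(\<Sum>k = 1..n. (X k)\<^sup>2) = (\<Sum>k = 1..n. \<Sum>i = 1..p. \<Sum>j = 1..p. d i * d j * (x (int k - int i) * x (int k - int j)))"
      unfolding X_def power2_eq_square sum_product by (simp add: mult_ac)
    also have "\<dots> = (\<Sum>i = 1..p. \<Sum>j = 1..p. \<Sum>k = 1..n. d i * d j * (x (int k - int i) * x (int k - int j)))"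
      by (rule trans[OF sum.swap], rule sum.cong[OF refl], rule sum.swap)
    also have "\<dots> = (\<Sum>i = 1..p. \<Sum>j = 1..p. d i * d j * (\<Sum>k = 1..n. x (int k - int i) * x (int k - int j)))"
      by (simp only: sum_distrib_left)
    finally show ?thesis by (simp only: Q_def)
  qed
  also have "\<dots> = (\<Sum>i = 1..p. \<Sum>j = 1..p. d i * d j * g i j)
     + (\<Sum>i = 1..p. \<Sum>j = 1..p. d i * d j * (1 / real n * ((\<Sum>k = 1..n. x (int k - int i) * x (int k - int j)) - real n * g i j)))"
    unfolding sum.distrib[symmetric] sum_distrib_left using n
    by (intro sum.cong refl) (simp add: field_simps sum_distrib_left)
  also have "\<dots> \<ge> \<kappa> * N\<^sup>2 - T2 * (dS + dC)\<^sup>2"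
  proof -
    have "- (T2 * (dS + dC)\<^sup>2) = (\<Sum>i = 1..p. \<Sum>j = 1..p. - (\<bar>d i\<bar> * \<bar>d j\<bar> * T2))"
      unfolding d1[symmetric] power2_eq_square sum_product by (simp add: sum_distrib_left sum_negf mult_ac)
    also have "\<dots> \<le> (\<Sum>i = 1..p. \<Sum>j = 1..p. d i * d j * (1 / real n * ((\<Sum>k = 1..n. x (int k - int i) * x (int k - int j)) - real n * g i j)))"
    proof (intro sum_mono)
      fix i j assume ij: "i \<in> {1..p}" "j \<in> {1..p}"
      let ?z = "(\<Sum>k = 1..n. x (int k - int i) * x (int k - int j)) - real n * g i j"
      have "\<bar>1 / real n * ?z\<bar> \<le> T2"
        using gram[OF ij] n by (simp add: abs_mult field_simps)
      then have "\<bar>d i * d j * (1 / real n * ?z)\<bar> \<le> \<bar>d i\<bar> * \<bar>d j\<bar> * T2"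
        unfolding abs_mult[of "d i * d j"] abs_mult[of "d i"] by (intro mult_left_mono) auto
      then show "- (\<bar>d i\<bar> * \<bar>d j\<bar> * T2) \<le> d i * d j * (1 / real n * ?z)"
        using abs_le_D2 minus_le_iff by blast
    qed
    finally show ?thesis using low[of d] unfolding Nsq by linarith
  qed
  finally have "\<kappa> * N\<^sup>2 \<le> Q + T2 * (dS + dC)\<^sup>2" by linarith
  also have "\<dots> \<le> \<gamma> * (3 / 2 * (sqrt (real s) * N) + 2 * \<zeta>) + T2 * (32 * real s * N\<^sup>2 + 32 * \<zeta>\<^sup>2)"
  proof (intro add_mono mult_left_mono l1sq T2)
    have "\<gamma> * (3 / 2 * dS - dC / 2 + 2 * \<zeta>) \<le> \<gamma> * (3 / 2 * (sqrt (real s) * N) + 2 * \<zeta>)"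
      using dS nonneg gamma by (intro mult_left_mono) auto
    then show "Q \<le> \<gamma> * (3 / 2 * (sqrt (real s) * N) + 2 * \<zeta>)" using Q2 by linarith
  qed
  finally have main: "\<kappa> * N\<^sup>2 \<le> \<gamma> * (3 / 2 * (sqrt (real s) * N) + 2 * \<zeta>) + T2 * (32 * real s * N\<^sup>2 + 32 * \<zeta>\<^sup>2)" .
  \<comment> \<open>This moves half of \<open>\<kappa> * N\<^sup>2\<close> to the other side against
    the Gram error.\<close>
  have "64 * real s * T2 * N\<^sup>2 \<le> \<kappa> * N\<^sup>2" using T2 by (intro mult_right_mono) auto
  then have "\<kappa> * N\<^sup>2 \<le> 3 * \<gamma> * sqrt (real s) * N + 2 * (2 * \<gamma> * \<zeta> + 32 * T2 * \<zeta>\<^sup>2)"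
    using main by (simp add: algebra_simps)
  then have "N\<^sup>2 \<le> 3 * \<gamma> * sqrt (real s) / \<kappa> * N + 2 / \<kappa> * (2 * \<gamma> * \<zeta> + 32 * T2 * \<zeta>\<^sup>2)"
    using kappa by (simp add: field_simps)
  then have "N \<le> 3 * \<gamma> * sqrt (real s) / \<kappa> + sqrt (2 / \<kappa> * (2 * \<gamma> * \<zeta> + 32 * T2 * \<zeta>\<^sup>2))"
    by (rule le_of_quadratic) (use kappa gamma z0 T2 in auto)
  then show ?thesis unfolding N_def d_def .
qed

text \<open>A minimizer over the open feasible set also beats the points of its boundary, by continuity.\<close>

lemma lasso_solution_objective_le:
  assumes sol: "lasso_solution \<eta> \<gamma> n p x v" and \<theta>: "\<theta> \<in> {1..p} \<rightarrow>\<^sub>E UNIV" "l1_norm p \<theta> \<le> 1 - \<eta>" and "\<eta> < 1"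
  shows "lasso_objective n p \<gamma> x v \<le> lasso_objective n p \<gamma> x \<theta>"
proof (cases "\<exists>u. is_arg_min (lasso_objective n p \<gamma> x) (\<lambda>u. u \<in> lasso_params \<eta> p) u")
  case False
  then have "is_arg_min (lasso_objective n p \<gamma> x) (\<lambda>u. u \<in> lasso_params_closed \<eta> p) v"
    using sol by (simp add: lasso_solution_def)
  then show ?thesis using \<theta> by (auto simp: is_arg_min_linorder lasso_params_closed_def)
next
  case True
  then have v: "is_arg_min (lasso_objective n p \<gamma> x) (\<lambda>u. u \<in> lasso_params \<eta> p) v"
    using sol by (simp add: lasso_solution_def)
  \<comment> \<open>Shrinking by a factor below 1 moves a point of norm at most
    \<open>1 - \<eta>\<close> into the open feasible set; \<open>\<eta> < 1\<close> makes the last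
    inequality strict.\<close>
  define t where "t m = 1 - 1 / real (Suc m)" for m
  define u where "u m = (\<lambda>l\<in>{1..p}. t m * \<theta> l)" for m
  have t: "0 \<le> t m" "t m < 1" for m by (auto simp: t_def)
  have "u m \<in> lasso_params \<eta> p" for m
  proof -
    have "l1_norm p (u m) = t m * l1_norm p \<theta>"
      using t(1)[of m] by (simp add: l1_norm_def u_def abs_mult sum_distrib_left)
    also have "\<dots> \<le> t m * (1 - \<eta>)" using t \<theta> by (intro mult_left_mono) auto
    also have "\<dots> < 1 * (1 - \<eta>)" using t assms by (intro mult_strict_right_mono) auto
    finally show ?thesis by (simp add: lasso_params_def u_def)
  qed
  then have le: "lasso_objective n p \<gamma> x v \<le> lasso_objective n p \<gamma> x (u m)" for m
    using v by (auto simp: is_arg_min_linorder)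
  have tl: "t \<longlonglongrightarrow> 1 - 0"
    unfolding t_def by (intro tendsto_intros LIMSEQ_Suc[OF lim_1_over_n])
  have ul: "(\<lambda>m. u m l) \<longlonglongrightarrow> \<theta> l" if "l \<in> {1..p}" for l
    using that tendsto_mult[OF tl tendsto_const[of "\<theta> l"]] by (simp add: u_def)
  have "(\<lambda>m. lasso_objective n p \<gamma> x (u m)) \<longlonglongrightarrow> lasso_objective n p \<gamma> x \<theta>"
    unfolding lasso_objective_def sq_loss_def l1_norm_def by (intro tendsto_intros ul)
  then show ?thesis by (rule LIMSEQ_le_const) (use le in auto)
qed

section \<open>The lasso guarantee and the upper bound for the risk\<close>

text \<open>The first three entries keep the Chernoff parameters of the noise and of the Gram matrix
  in their admissible ranges. The last makes 64 times \<open>s\<close> times the Gram error at most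
  \<open>\<sigma>\<^sup>2 / 4\<close>, with \<open>7168 = 64 * 28 * 4\<close>.\<close>

definition small_rate :: "real \<Rightarrow> real \<Rightarrow> real \<Rightarrow> real" where
  "small_rate \<eta> \<sigma> K = (let c = 1 / (4 * exp 1 * K\<^sup>2 * \<sigma>\<^sup>2) in
     Min {1 / 8, \<sigma>\<^sup>2 * c / 8, \<sigma> ^ 6 * c ^ 3 / 512, \<sigma>\<^sup>2 * c * \<eta>\<^sup>2 / 7168})"

lemma small_rate_pos: "0 < \<eta> \<Longrightarrow> 0 < \<sigma> \<Longrightarrow> 1 \<le> K \<Longrightarrow> 0 < small_rate \<eta> \<sigma> K"
  by (simp add: small_rate_def Let_def)

text \<open>A single \<open>d3\<close> must serve both terms of the guarantee, hence the maximum of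
  the factor of the rate and of the factor of \<open>\<zeta>\<close> under the root. In the latter,
  48 is twice the 24 of the regularisation, 896 is \<open>32 * 28\<close>, and
  \<open>4 * exp 1 * K\<^sup>2 * \<sigma>\<^sup>2\<close> is \<open>1 / c0\<close>.\<close>

definition guarantee_const :: "real \<Rightarrow> real \<Rightarrow> real \<Rightarrow> real" where
  "guarantee_const \<eta> \<sigma> K = max (288 / \<eta>) (8 / \<sigma>\<^sup>2 * (48 * \<sigma>\<^sup>2 / \<eta> + 896 * (4 * exp 1 * K\<^sup>2 * \<sigma>\<^sup>2) / \<eta>\<^sup>2))"

abbreviation rate :: "nat \<Rightarrow> nat \<Rightarrow> real" where
  "rate n p \<equiv> sqrt (ln (real p) / real n)"

text \<open>As \<open>n < p\<close>, the bound with \<open>sqrt (p * ln p)\<close> implies the one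
  with \<open>sqrt (n * ln p)\<close>. So a large \<open>d1\<close> forces the rate below any
  threshold that depends on \<open>K\<close>.\<close>

lemma sparsity_times_rate_le:
  assumes "n < p" "1 \<le> s" "0 < d" "real s * (d * sqrt (real p * ln (real p))) \<le> real n" and n: "1 \<le> n"
  shows "real s * rate n p \<le> 1 / d"
proof -
  have lnp: "0 < ln (real p)" using n assms(1) by simp
  have "real s * d * sqrt (real n * ln (real p)) \<le> real s * d * sqrt (real p * ln (real p))"
    using assms lnp by (intro mult_left_mono) auto
  also have "\<dots> \<le> real n" using assms(4) by (simp add: mult_ac)
  finally have *: "real s * d * sqrt (real n * ln (real p)) \<le> real n" .
  have "rate n p = sqrt (real n * ln (real p)) / real n"
    using n by (simp add: real_sqrt_divide real_sqrt_mult field_simps)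
  then have "real s * rate n p * d = real s * d * sqrt (real n * ln (real p)) / real n" by simp
  also have "\<dots> \<le> 1" using * n by simp
  finally show "real s * rate n p \<le> 1 / d" using assms(3) by (simp add: field_simps)
qed

context ar_proc begin

lemma c0_small_rate:
  assumes "1 \<le> K" "1 \<le> s" "real s * r \<le> small_rate \<eta> \<sigma> K" "0 \<le> r"
  shows "r \<le> 1 / 8" "r \<le> \<sigma>\<^sup>2 * c0 / 8" "r \<le> \<sigma> ^ 6 * c0 ^ 3 / 512" "real s * r \<le> \<sigma>\<^sup>2 * c0 * \<eta>\<^sup>2 / 7168"
proof -
  have "1 * r \<le> real s * r" using assms by (intro mult_right_mono) auto
  then have "r \<le> small_rate \<eta> \<sigma> K" using assms(3) by linarith
  then show "r \<le> 1 / 8" "r \<le> \<sigma>\<^sup>2 * c0 / 8" "r \<le> \<sigma> ^ 6 * c0 ^ 3 / 512" "real s * r \<le> \<sigma>\<^sup>2 * c0 * \<eta>\<^sup>2 / 7168"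
    using assms(3) by (auto simp: small_rate_def c0_def Let_def)
qed

text \<open>The regularisation is four times the noise level
  \<open>6 * \<sigma>\<^sup>2 / \<eta> * rate n p\<close> of \<open>good\<close>, which fixes
  \<open>d2\<close> as \<open>24 * \<sigma>\<^sup>2 / \<eta>\<close>. The eigenvalue bound is
  \<open>\<sigma>\<^sup>2 / 4\<close>, and the factor 288 is \<open>3 * 24 * 4\<close>.\<close>

lemma lasso_error_le:
  assumes "1 \<le> K" "\<eta> < 1" and \<theta>: "\<theta> \<in> {1..p} \<rightarrow>\<^sub>E UNIV" and np: "1 \<le> n" "n < p" and "1 \<le> s"
    and rate: "real s * rate n p \<le> small_rate \<eta> \<sigma> K"
    and S: "S \<subseteq> {1..p}" "card S \<le> s" and \<zeta>: "(\<Sum>l\<in>{1..p} - S. \<bar>\<theta> l\<bar>) \<le> \<zeta>" "\<zeta> \<le> 1"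
    and good: "good n (rate n p) \<omega>"
    and sol: "lasso_solution \<eta> (reg_param (24 * \<sigma>\<^sup>2 / \<eta>) n p) n p (\<lambda>k. x k \<omega>) v"
  shows "L2_set (\<lambda>l. v l - \<theta> l) {1..p}
     \<le> 288 / \<eta> * sqrt (real s) * rate n p + sqrt (guarantee_const \<eta> \<sigma> K * \<zeta> * rate n p)"
proof -
  let ?r = "rate n p"
  let ?g = "reg_param (24 * \<sigma>\<^sup>2 / \<eta>) n p"
  let ?T2 = "28 / (c0 * \<eta>\<^sup>2) * ?r"
  have c0: "0 < c0" using c0_pos assms by simp
  have lnp: "0 < ln (real p)" using np by simp
  have r0: "0 < ?r" using lnp np by simp
  have g: "?g = 24 * \<sigma>\<^sup>2 / \<eta> * ?r" by (simp add: reg_param_def)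
  have z0: "0 \<le> \<zeta>" by (rule order_trans[OF sum_nonneg \<zeta>(1)]) simp
  have sr: "real s * ?r \<le> \<sigma>\<^sup>2 * c0 * \<eta>\<^sup>2 / 7168"
    using c0_small_rate(4)[OF assms(1) \<open>1 \<le> s\<close> rate] r0 by simp
  have "L2_set (\<lambda>l. v l - \<theta> l) {1..p} \<le> 3 * ?g * sqrt (real s) / (\<sigma>\<^sup>2 / 4) + sqrt (2 / (\<sigma>\<^sup>2 / 4) * (2 * ?g * \<zeta> + 32 * ?T2 * \<zeta>\<^sup>2))"
  proof (rule lasso_deterministic[where x = "\<lambda>k. x k \<omega>" and g = gam and S = S and ?T1.0 = "6 * \<sigma>\<^sup>2 / \<eta> * ?r"])
    show "lasso_objective n p ?g (\<lambda>k. x k \<omega>) v \<le> lasso_objective n p ?g (\<lambda>k. x k \<omega>) \<theta>"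
      by (rule lasso_solution_objective_le[OF sol \<theta> l1 \<open>\<eta> < 1\<close>])
    have "64 * real s * ?T2 = 1792 / (c0 * \<eta>\<^sup>2) * (real s * ?r)" by simp
    also have "\<dots> \<le> 1792 / (c0 * \<eta>\<^sup>2) * (\<sigma>\<^sup>2 * c0 * \<eta>\<^sup>2 / 7168)"
      using c0 by (intro mult_left_mono sr) auto
    also have "\<dots> = \<sigma>\<^sup>2 / 4" using c0 eta by simp
    finally show "64 * real s * ?T2 \<le> \<sigma>\<^sup>2 / 4" .
    show "\<sigma>\<^sup>2 / 4 * (\<Sum>i = 1..p. (u i)\<^sup>2) \<le> (\<Sum>i = 1..p. \<Sum>j = 1..p. u i * u j * gam i j)" for u
      by (rule gam_lower)
  qed (use good np c0 r0 eta sigma S \<zeta> in \<open>auto simp: good_def g\<close>)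
  also have "3 * ?g * sqrt (real s) / (\<sigma>\<^sup>2 / 4) = 288 / \<eta> * sqrt (real s) * ?r"
    using sigma by (simp add: g)
  also have "sqrt (2 / (\<sigma>\<^sup>2 / 4) * (2 * ?g * \<zeta> + 32 * ?T2 * \<zeta>\<^sup>2)) \<le> sqrt (guarantee_const \<eta> \<sigma> K * \<zeta> * ?r)"
  proof (rule real_sqrt_le_mono)
    \<comment> \<open>The guarantee allows only a term linear in \<open>\<zeta>\<close> under the
      root.\<close>
    have "\<zeta>\<^sup>2 \<le> \<zeta>" using z0 \<zeta>(2) by (simp add: power2_eq_square mult_left_le)
    then have "32 * ?T2 * \<zeta>\<^sup>2 \<le> 32 * ?T2 * \<zeta>"
      using c0 r0 by (intro mult_left_mono) auto
    then have "2 / (\<sigma>\<^sup>2 / 4) * (2 * ?g * \<zeta> + 32 * ?T2 * \<zeta>\<^sup>2) \<le> 2 / (\<sigma>\<^sup>2 / 4) * (2 * ?g * \<zeta> + 32 * ?T2 * \<zeta>)"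
      by (intro mult_left_mono) auto
    also have "\<dots> = (8 / \<sigma>\<^sup>2 * (48 * \<sigma>\<^sup>2 / \<eta> + 896 * (4 * exp 1 * K\<^sup>2 * \<sigma>\<^sup>2) / \<eta>\<^sup>2)) * \<zeta> * ?r"
      unfolding g c0_def by (simp add: field_simps)
    also have "\<dots> \<le> guarantee_const \<eta> \<sigma> K * \<zeta> * ?r"
      using z0 r0 unfolding guarantee_const_def by (intro mult_right_mono) auto
    finally show "2 / (\<sigma>\<^sup>2 / 4) * (2 * ?g * \<zeta> + 32 * ?T2 * \<zeta>\<^sup>2) \<le> guarantee_const \<eta> \<sigma> K * \<zeta> * ?r" .
  qed
  finally show ?thesis by simp
qed

end

lemma ar_proc_of_AR_laws:
  assumes "(\<theta>, P) \<in> AR_laws \<eta> \<sigma> K p" "0 < \<eta>" "0 < \<sigma>"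
  obtains w where "ar_proc P p \<theta> \<sigma> K \<eta> (\<lambda>k \<omega>. \<omega> k) w"
  using assms by (auto simp: AR_laws_def ar_proc_def)

text \<open>The zero vector is a competitor. The resulting bound by 1 is what linearises the term in
  \<open>\<zeta>\<^sup>2\<close>.\<close>

lemma best_term_approx_error_le:
  assumes "best_term_approx p s \<theta> u"
  shows "l1_norm p (\<lambda>l. \<theta> l - u l) \<le> l1_norm p \<theta>"
proof -
  define z :: "nat \<Rightarrow> real" where "z = (\<lambda>l\<in>{1..p}. 0)"
  have supp: "{l \<in> {1..p}. z l \<noteq> 0} = {}" by (auto simp: z_def)
  have "sparse p s z" unfolding sparse_def supp by simp
  moreover have "z \<in> {1..p} \<rightarrow>\<^sub>E UNIV" by (simp add: z_def)
  ultimately have "l1_norm p (\<lambda>l. \<theta> l - u l) \<le> l1_norm p (\<lambda>l. \<theta> l - z l)"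
    using assms unfolding best_term_approx_def is_arg_min_linorder by blast
  also have "\<dots> = l1_norm p \<theta>" by (simp add: l1_norm_def z_def)
  finally show ?thesis .
qed

text \<open>The witnesses are \<open>d4 = 1\<close> and \<open>C = 8\<close>: the exceptional event
  has probability at most \<open>4 / p\<close>, and \<open>n < p\<close> makes this strictly less
  than \<open>8 / n\<close>.\<close>

lemma lasso_guarantee_holds:
  assumes "0 < \<eta>" "\<eta> < 1" "0 < \<sigma>" "1 \<le> K" and d1: "1 / small_rate \<eta> \<sigma> K \<le> d1"
  shows "lasso_guarantee \<eta> \<sigma> K d0 d1 (24 * \<sigma>\<^sup>2 / \<eta>)"
  unfolding lasso_guarantee_def
proof (intro exI conjI allI impI)
  show "0 < guarantee_const \<eta> \<sigma> K" using assms by (simp add: guarantee_const_def less_max_iff_disj)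
  show "(0::real) < 1" by simp
  fix A :: real assume "0 < A"
  show "(0::real) < 8" by simp
  fix n p s :: nat and \<theta> \<theta>s :: "nat \<Rightarrow> real" and P
  assume np: "n < p" and s: "1 \<le> s"
    and large: "real s * max (d0 * (ln (real p))\<^sup>2) (d1 * sqrt (real p * ln (real p))) < real n"
    and law: "(\<theta>, P) \<in> AR_laws \<eta> \<sigma> K p" and best: "best_term_approx p s \<theta> \<theta>s"
  have sm: "0 < small_rate \<eta> \<sigma> K" using small_rate_pos assms by simp
  have d1p: "0 < d1" using d1 sm by (meson divide_pos_pos less_le_trans zero_less_one)
  have n1: "1 \<le> n"
  proof (rule ccontr)
    assume "\<not> 1 \<le> n"
    moreover have "0 \<le> real s * max (d0 * (ln (real p))\<^sup>2) (d1 * sqrt (real p * ln (real p)))"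
      using d1p np by (intro mult_nonneg_nonneg) (auto simp: le_max_iff_disj)
    ultimately show False using large by simp
  qed
  have "real s * (d1 * sqrt (real p * ln (real p))) \<le> real n"
    using large mult_left_mono[of "d1 * sqrt (real p * ln (real p))" "max (d0 * (ln (real p))\<^sup>2) (d1 * sqrt (real p * ln (real p)))" "real s"]
    by simp
  note rt = n1 sparsity_times_rate_le[OF np s d1p this n1]
  have rate: "real s * rate n p \<le> small_rate \<eta> \<sigma> K"
  proof -
    have "1 / d1 \<le> small_rate \<eta> \<sigma> K" using d1 d1p sm by (simp add: field_simps)
    then show ?thesis using rt(2) by linarith
  qed
  obtain w where "ar_proc P p \<theta> \<sigma> K \<eta> (\<lambda>k \<omega>. \<omega> k) w"
    using ar_proc_of_AR_laws[OF law assms(1,3)] .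
  then interpret ar_proc P p \<theta> \<sigma> K \<eta> "\<lambda>k \<omega>. \<omega> k" w .
  let ?r = "rate n p"
  have r0: "0 \<le> ?r" using np rt(1) by simp
  have "prob {\<omega> \<in> space P. \<not> good n ?r \<omega>} \<le> 4 / real p"
    using np rt(1) c0_small_rate[OF assms(4) s rate r0] by (intro prob_not_good assms) auto
  moreover have "{\<omega> \<in> space P. good n ?r \<omega>} \<in> events" by measurable
  moreover have "{\<omega> \<in> space P. \<not> good n ?r \<omega>} = space P - {\<omega> \<in> space P. good n ?r \<omega>}" by auto
  ultimately have pr: "1 - 4 / real p \<le> prob {\<omega> \<in> space P. good n ?r \<omega>}"
    by (simp add: prob_compl)
  have "4 / real p < 8 / real n" using np rt(1) by (simp add: field_simps)
  with pr have pr': "1 - 8 * real n powr - 1 < prob {\<omega> \<in> space P. good n ?r \<omega>}"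
    using rt(1) by (simp add: powr_minus divide_inverse)
  define \<zeta> where "\<zeta> = l1_norm p (\<lambda>l. \<theta> l - \<theta>s l)"
  \<comment> \<open>The support of the approximation, not of \<open>\<theta>\<close>: off this set
    the approximation error equals \<open>\<theta>\<close> itself.\<close>
  define S where "S = {l \<in> {1..p}. \<theta>s l \<noteq> 0}"
  have z1: "\<zeta> \<le> 1"
    using best_term_approx_error_le[OF best] l1 eta by (simp add: \<zeta>_def)
  have S: "S \<subseteq> {1..p}" "card S \<le> s"
    using best by (auto simp: S_def best_term_approx_def is_arg_min_def sparse_def)
  have zS: "(\<Sum>l\<in>{1..p} - S. \<bar>\<theta> l\<bar>) \<le> \<zeta>"
  proof -
    have "(\<Sum>l\<in>{1..p} - S. \<bar>\<theta> l\<bar>) = (\<Sum>l\<in>{1..p} - S. \<bar>\<theta> l - \<theta>s l\<bar>)"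
      by (intro sum.cong) (auto simp: S_def)
    also have "\<dots> \<le> \<zeta>" unfolding \<zeta>_def l1_norm_def by (intro sum_mono2) auto
    finally show ?thesis .
  qed
  have z0: "0 \<le> \<zeta>" by (simp add: \<zeta>_def l1_norm_def sum_nonneg)
  have \<theta>: "\<theta> \<in> {1..p} \<rightarrow>\<^sub>E UNIV" using law by (simp add: AR_laws_def)
  have bound: "L2_set (\<lambda>l. v l - \<theta> l) {1..p}
     \<le> guarantee_const \<eta> \<sigma> K * sqrt (real s * ln (real p) / real n) + sqrt (guarantee_const \<eta> \<sigma> K * \<zeta>) * root 4 (ln (real p) / real n)"
    if "good n ?r y" and sol: "lasso_solution \<eta> (reg_param (24 * \<sigma>\<^sup>2 / \<eta>) n p) n p y v" for y v
  proof -
    have "L2_set (\<lambda>l. v l - \<theta> l) {1..p} \<le> 288 / \<eta> * sqrt (real s) * ?r + sqrt (guarantee_const \<eta> \<sigma> K * \<zeta> * ?r)"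
      using np rt(1) s rate S zS z1 that \<theta> assms by (intro lasso_error_le[where S = S and \<omega> = y]) auto
    also have "288 / \<eta> * sqrt (real s) * ?r = 288 / \<eta> * sqrt (real s * ln (real p) / real n)"
      by (simp add: real_sqrt_mult real_sqrt_divide)
    also have "\<dots> \<le> guarantee_const \<eta> \<sigma> K * sqrt (real s * ln (real p) / real n)"
      using np rt(1) by (intro mult_right_mono) (auto simp: guarantee_const_def)
    also have "sqrt (guarantee_const \<eta> \<sigma> K * \<zeta> * ?r) = sqrt (guarantee_const \<eta> \<sigma> K * \<zeta>) * sqrt ?r"
      by (simp add: real_sqrt_mult)
    also have "sqrt ?r = root 4 (ln (real p) / real n)"
      unfolding sqrt_def by (subst real_root_mult_exp[symmetric]) auto
    finally show ?thesis by simp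
  qed
  show "\<exists>E\<in>events. 1 - 8 * real n powr - 1 < prob E \<and>
          (\<forall>x\<in>E. \<forall>v. lasso_solution \<eta> (reg_param (24 * \<sigma>\<^sup>2 / \<eta>) n p) n p x v \<longrightarrow>
              L2_set (\<lambda>l. v l - \<theta> l) {1..p}
              \<le> guarantee_const \<eta> \<sigma> K * sqrt (real s * ln (real p) / real n) +
                 sqrt (guarantee_const \<eta> \<sigma> K * l1_norm p (\<lambda>l. \<theta> l - \<theta>s l)) * root 4 (ln (real p) / real n))"
    using pr' bound unfolding \<zeta>_def by (intro bexI[of _ "{\<omega> \<in> space P. good n ?r \<omega>}"]) auto
qed

text \<open>The objective reads no value before time \<open>1 - p\<close>, reached at
  \<open>k = 1\<close> and \<open>l = p\<close>, and none after \<open>n\<close>.\<close>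

lemma lasso_solution_restrict:
  "lasso_solution \<eta> \<gamma> n p (restrict x (obs_times n p)) = lasso_solution \<eta> \<gamma> n p x"
proof -
  have "restrict x (obs_times n p) (int k - int l) = x (int k - int l)" if "k \<in> {1..n}" "l \<in> {1..p}" for k l
    using that by (simp add: obs_times_def)
  moreover have "restrict x (obs_times n p) (int k) = x (int k)" if "k \<in> {1..n}" for k
    using that by (simp add: obs_times_def)
  ultimately have eq: "lasso_objective n p \<gamma> (restrict x (obs_times n p)) = lasso_objective n p \<gamma> x"
    unfolding lasso_objective_def sq_loss_def by (intro ext) (simp cong: sum.cong_simp)
  show ?thesis by (intro ext) (simp only: lasso_solution_def eq)
qed

lemma lasso_solution_l1_le: "lasso_solution \<eta> \<gamma> n p x v \<Longrightarrow> l1_norm p v \<le> 1 - \<eta>"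
  by (auto simp: lasso_solution_def is_arg_min_def lasso_params_def lasso_params_closed_def split: if_splits)

lemma esqrt_le:
  assumes "a \<le> ennreal (b\<^sup>2)" "0 \<le> b"
  shows "esqrt a \<le> ennreal b"
proof -
  have "a \<noteq> top" using assms by (auto simp: top_unique)
  moreover have "sqrt (enn2real a) \<le> sqrt (b\<^sup>2)"
    using enn2real_mono[OF assms(1)] by (intro real_sqrt_le_mono) simp
  ultimately show ?thesis using assms by (simp add: esqrt_def ennreal_leI)
qed

text \<open>The estimate and the parameter both have 1-norm at most \<open>1 - \<eta>\<close>, so
  the error is below 2 even on the exceptional event. That event has probability at most
  \<open>4 / p\<close> and adds only a multiple of the squared rate.\<close>

lemma lasso_risk_le:
  assumes "0 < \<eta>" "\<eta> < 1" "0 < \<sigma>" "1 \<le> K" and np: "1 \<le> n" "n < p" and s: "1 \<le> s"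
    and rate: "real s * rate n p \<le> small_rate \<eta> \<sigma> K"
    and T: "T \<in> lasso_estimators \<eta> (reg_param (24 * \<sigma>\<^sup>2 / \<eta>) n p) n p"
  shows "est_risk \<eta> \<sigma> K n p s T \<le> ennreal ((288 / \<eta> + 8) * (sqrt (real s) * rate n p))"
  unfolding est_risk_def
proof (rule SUP_least, clarify)
  fix \<theta> P assume law: "(\<theta>, P) \<in> sparse_AR_laws \<eta> \<sigma> K p s"
  let ?r = "rate n p"
  let ?err = "\<lambda>x. L2_set (\<lambda>l. T (restrict x (obs_times n p)) l - \<theta> l) {1..p}"
  have law': "(\<theta>, P) \<in> AR_laws \<eta> \<sigma> K p" using law by (simp add: sparse_AR_laws_def)
  obtain w where "ar_proc P p \<theta> \<sigma> K \<eta> (\<lambda>k \<omega>. \<omega> k) w"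
    using ar_proc_of_AR_laws[OF law' assms(1,3)] .
  then interpret ar_proc P p \<theta> \<sigma> K \<eta> "\<lambda>k \<omega>. \<omega> k" w .
  have r0: "0 \<le> ?r" using np by simp
  define S where "S = {l \<in> {1..p}. \<theta> l \<noteq> 0}"
  have S: "S \<subseteq> {1..p}" "card S \<le> s" "(\<Sum>l\<in>{1..p} - S. \<bar>\<theta> l\<bar>) \<le> 0"
    using law by (auto simp: S_def sparse_AR_laws_def sparse_def intro!: sum_nonpos)
  have \<theta>: "\<theta> \<in> {1..p} \<rightarrow>\<^sub>E UNIV" using law' by (simp add: AR_laws_def)
  define a where "a = 288 / \<eta> * (sqrt (real s) * ?r)"
  have a0: "0 \<le> a" using r0 assms by (simp add: a_def)
  have sol: "lasso_solution \<eta> (reg_param (24 * \<sigma>\<^sup>2 / \<eta>) n p) n p x (T (restrict x (obs_times n p)))" for x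
  proof -
    have "restrict x (obs_times n p) \<in> space (PiM (obs_times n p) (\<lambda>_. borel))"
      by (simp add: space_PiM)
    then show ?thesis using T unfolding lasso_estimators_def by (auto simp: lasso_solution_restrict)
  qed
  have e1: "?err x \<le> a" if "good n ?r x" for x
    using lasso_error_le[OF assms(4,2) \<theta> np s rate S _ that sol] by (simp add: a_def mult_ac)
  have e2: "?err x \<le> 2" for x
  proof -
    have "?err x \<le> (\<Sum>l = 1..p. \<bar>T (restrict x (obs_times n p)) l - \<theta> l\<bar>)" by (rule L2_set_le_sum_abs)
    also have "\<dots> \<le> (\<Sum>l = 1..p. \<bar>T (restrict x (obs_times n p)) l\<bar> + \<bar>\<theta> l\<bar>)"
      by (intro sum_mono abs_triangle_ineq4)
    also have "\<dots> = l1_norm p (T (restrict x (obs_times n p))) + l1_norm p \<theta>"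
      by (simp add: l1_norm_def sum.distrib)
    also have "\<dots> \<le> (1 - \<eta>) + (1 - \<eta>)" by (intro add_mono l1 lasso_solution_l1_le[OF sol])
    finally show ?thesis using eta by simp
  qed
  let ?B = "{\<omega> \<in> space P. \<not> good n ?r \<omega>}"
  have pB: "prob ?B \<le> 4 / real p"
    using np c0_small_rate[OF assms(4) s rate r0] by (intro prob_not_good assms) auto
  have "(\<integral>\<^sup>+x. ennreal ((?err x)\<^sup>2) \<partial>P) \<le> (\<integral>\<^sup>+x. ennreal (a\<^sup>2) + 4 * indicator ?B x \<partial>P)"
  proof (rule nn_integral_mono)
    fix x assume x: "x \<in> space P"
    show "ennreal ((?err x)\<^sup>2) \<le> ennreal (a\<^sup>2) + 4 * indicator ?B x"
    proof (cases "good n ?r x")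
      case True
      then have "(?err x)\<^sup>2 \<le> a\<^sup>2" using e1 by (intro power_mono) auto
      then show ?thesis using True by (simp add: ennreal_leI)
    next
      case False
      have "(?err x)\<^sup>2 \<le> 2\<^sup>2" using e2 by (intro power_mono) auto
      then have "ennreal ((?err x)\<^sup>2) \<le> ennreal 4" by (intro ennreal_leI) simp
      also have "\<dots> \<le> ennreal (a\<^sup>2) + 4 * indicator ?B x" using False x by simp
      finally show ?thesis .
    qed
  qed
  also have "\<dots> = ennreal (a\<^sup>2) + 4 * emeasure P ?B"
    by (subst nn_integral_add) (auto simp: emeasure_space_1 nn_integral_cmult)
  also have "\<dots> = ennreal (a\<^sup>2 + 4 * prob ?B)"
    by (simp add: emeasure_eq_measure ennreal_plus ennreal_mult')
  also have "\<dots> \<le> ennreal (((288 / \<eta> + 8) * (sqrt (real s) * ?r))\<^sup>2)"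
  proof (rule ennreal_leI)
    have "2 / 3 \<le> ln (real p)"
    proof -
      have "ln 2 \<le> ln (real p)" using np by (subst ln_le_cancel_iff) auto
      then show ?thesis using ln2_ge_two_thirds by linarith
    qed
    then have "4 * prob ?B \<le> 4 * (4 / real p)" using pB by simp
    also have "\<dots> \<le> 16 / real n" using np by (simp add: field_simps)
    \<comment> \<open>The coefficient 64 is the square of the summand 8 in the final constant;
      \<open>16 \<le> 64 * ln p\<close> follows from \<open>p \<ge> 2\<close>.\<close>
    also have "\<dots> \<le> 64 * ln (real p) / real n"
      using \<open>2 / 3 \<le> ln (real p)\<close> np by (intro divide_right_mono) auto
    also have "\<dots> = 64 * (1 * ?r\<^sup>2)" using np by simp
    also have "\<dots> \<le> 64 * (real s * ?r\<^sup>2)" using s by (intro mult_left_mono mult_right_mono) auto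
    also have "\<dots> = (8 * (sqrt (real s) * ?r))\<^sup>2" by (simp add: power_mult_distrib)
    finally have "a\<^sup>2 + 4 * prob ?B \<le> a\<^sup>2 + (8 * (sqrt (real s) * ?r))\<^sup>2" by simp
    also have "\<dots> \<le> (a + 8 * (sqrt (real s) * ?r))\<^sup>2"
      using a0 r0 by (simp add: power2_sum)
    also have "a + 8 * (sqrt (real s) * ?r) = (288 / \<eta> + 8) * (sqrt (real s) * ?r)"
      unfolding a_def by (simp add: algebra_simps)
    finally show "a\<^sup>2 + 4 * prob ?B \<le> ((288 / \<eta> + 8) * (sqrt (real s) * ?r))\<^sup>2" .
  qed
  finally show "esqrt (\<integral>\<^sup>+x. ennreal ((?err x)\<^sup>2) \<partial>P) \<le> ennreal ((288 / \<eta> + 8) * (sqrt (real s) * ?r))"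
    using r0 assms by (intro esqrt_le) auto
qed

subsection \<open>Gaussian autoregressive laws\<close>

definition gauss :: "real \<Rightarrow> real measure" where
  "gauss \<sigma> = density lborel (\<lambda>x. ennreal (normal_density 0 \<sigma> x))"

lemma sets_gauss [measurable_cong, simp]: "sets (gauss \<sigma>) = sets borel"
  by (simp add: gauss_def)

lemma space_gauss [simp]: "space (gauss \<sigma>) = UNIV"
  by (simp add: gauss_def)

lemma sets_PiM_gauss [measurable_cong]: "sets (PiM I (\<lambda>_. gauss \<sigma>)) = sets (PiM I (\<lambda>_. borel))"
  by (rule sets_PiM_cong) auto

lemma prob_space_gauss: "0 < \<sigma> \<Longrightarrow> prob_space (gauss \<sigma>)"
  unfolding gauss_def by (rule prob_space_normal_density)

text \<open>The Cameron-Martin formula in one dimension, by completing the square in the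
  density.\<close>

lemma gauss_shift:
  assumes "0 < \<sigma>" and [measurable]: "h \<in> borel_measurable borel"
  shows "(\<integral>\<^sup>+w. h (w + u) \<partial>gauss \<sigma>) = (\<integral>\<^sup>+z. h z * ennreal (exp ((z * u - u\<^sup>2 / 2) / \<sigma>\<^sup>2)) \<partial>gauss \<sigma>)"
proof -
  have dens: "normal_density 0 \<sigma> z * exp ((z * u - u\<^sup>2 / 2) / \<sigma>\<^sup>2) = normal_density 0 \<sigma> (z - u)" for z
  proof -
    have "- (z - 0)\<^sup>2 / (2 * \<sigma>\<^sup>2) + (z * u - u\<^sup>2 / 2) / \<sigma>\<^sup>2 = - (z - u - 0)\<^sup>2 / (2 * \<sigma>\<^sup>2)"
      using assms(1) by (simp add: field_simps power2_eq_square)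
    then show ?thesis unfolding normal_density_def mult.assoc exp_add[symmetric] by simp
  qed
  have "(\<integral>\<^sup>+w. h (w + u) \<partial>gauss \<sigma>) = (\<integral>\<^sup>+w. ennreal (normal_density 0 \<sigma> w) * h (w + u) \<partial>lborel)"
    unfolding gauss_def by (subst nn_integral_density) auto
  also have "\<dots> = (\<integral>\<^sup>+z. ennreal (normal_density 0 \<sigma> (z - u)) * h z \<partial>lborel)"
    using nn_integral_real_affine[of "\<lambda>z. ennreal (normal_density 0 \<sigma> (z - u)) * h z" 1 u]
    by (simp add: add.commute)
  also have "\<dots> = (\<integral>\<^sup>+z. ennreal (normal_density 0 \<sigma> z) * (h z * ennreal (exp ((z * u - u\<^sup>2 / 2) / \<sigma>\<^sup>2))) \<partial>lborel)"
    unfolding dens[symmetric] by (intro nn_integral_cong) (simp add: ennreal_mult' mult_ac)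
  also have "\<dots> = (\<integral>\<^sup>+z. h z * ennreal (exp ((z * u - u\<^sup>2 / 2) / \<sigma>\<^sup>2)) \<partial>gauss \<sigma>)"
    unfolding gauss_def by (subst nn_integral_density) auto
  finally show ?thesis .
qed

text \<open>The shift formula for the constant function 1, with shift
  \<open>\<sigma>\<^sup>2 * t\<close>, up to a constant factor.\<close>

lemma gauss_mgf:
  assumes "0 < \<sigma>"
  shows "(\<integral>\<^sup>+z. ennreal (exp (t * z)) \<partial>gauss \<sigma>) = ennreal (exp (\<sigma>\<^sup>2 * t\<^sup>2 / 2))"
proof -
  interpret prob_space "gauss \<sigma>" using prob_space_gauss assms .
  have "ennreal (exp (\<sigma>\<^sup>2 * t\<^sup>2 / 2)) * ennreal (exp ((z * (\<sigma>\<^sup>2 * t) - (\<sigma>\<^sup>2 * t)\<^sup>2 / 2) / \<sigma>\<^sup>2)) = ennreal (exp (t * z))" for z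
    using assms by (simp add: ennreal_mult'[symmetric] exp_add[symmetric] field_simps power2_eq_square)
  then have "(\<integral>\<^sup>+z. ennreal (exp (t * z)) \<partial>gauss \<sigma>)
     = ennreal (exp (\<sigma>\<^sup>2 * t\<^sup>2 / 2)) * (\<integral>\<^sup>+z. 1 * ennreal (exp ((z * (\<sigma>\<^sup>2 * t) - (\<sigma>\<^sup>2 * t)\<^sup>2 / 2) / \<sigma>\<^sup>2)) \<partial>gauss \<sigma>)"
    by (subst nn_integral_cmult[symmetric]) auto
  also have "\<dots> = ennreal (exp (\<sigma>\<^sup>2 * t\<^sup>2 / 2)) * (\<integral>\<^sup>+z. 1 \<partial>gauss \<sigma>)"
    using gauss_shift[OF assms, of "\<lambda>_. 1" "\<sigma>\<^sup>2 * t"] by simp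
  finally show ?thesis using emeasure_space_1 by simp
qed

lemma gauss_moments:
  assumes "0 < \<sigma>"
  shows "integrable (gauss \<sigma>) (\<lambda>z. z)" "integral\<^sup>L (gauss \<sigma>) (\<lambda>z. z) = 0"
    "integrable (gauss \<sigma>) (\<lambda>z. z\<^sup>2)" "integral\<^sup>L (gauss \<sigma>) (\<lambda>z. z\<^sup>2) = \<sigma>\<^sup>2"
proof -
  interpret prob_space "gauss \<sigma>" using prob_space_gauss assms .
  have d: "distributed (gauss \<sigma>) lborel (\<lambda>z. z) (\<lambda>x. ennreal (normal_density 0 \<sigma> x))"
    unfolding distributed_def by (auto simp: distr_id2 gauss_def)
  show i1: "integrable (gauss \<sigma>) (\<lambda>z. z)"
    using integrable_normal_moment[OF assms, of 0 1] unfolding gauss_def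
    by (subst integrable_real_density) auto
  show "integrable (gauss \<sigma>) (\<lambda>z. z\<^sup>2)"
    using integrable_normal_moment[OF assms, of 0 2] unfolding gauss_def
    by (subst integrable_real_density) auto
  show e: "integral\<^sup>L (gauss \<sigma>) (\<lambda>z. z) = 0"
    using normal_distributed_expectation[OF assms d] by simp
  show "integral\<^sup>L (gauss \<sigma>) (\<lambda>z. z\<^sup>2) = \<sigma>\<^sup>2"
    using normal_distributed_variance[OF assms d] e by simp
qed

text \<open>The coefficient of \<open>w (k - int i)\<close> on the left is the coefficient of order
  \<open>i\<close> in the product of the autoregressive polynomial and its inverse power series,
  that is, of 1.\<close>

lemma impulse_inverts:
  fixes w x :: "int \<Rightarrow> real"
  assumes x: "\<And>k. (\<lambda>j. impulse p \<theta> j * w (k - int j)) sums x k"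
  shows "x k - (\<Sum>l = 1..p. \<theta> l * x (k - int l)) = w k"
proof -
  have shift: "(\<lambda>i. (if l \<le> i then impulse p \<theta> (i - l) else 0) * w (k - int i)) sums x (k - int l)" for l
  proof -
    define f where "f i = (if l \<le> i then impulse p \<theta> (i - l) else 0) * w (k - int i)" for i
    have "(\<lambda>i. f (i + l)) = (\<lambda>j. impulse p \<theta> j * w (k - int l - int j))"
      by (simp add: f_def algebra_simps)
    moreover have "(\<Sum>i<l. f i) = 0" by (simp add: f_def)
    ultimately show ?thesis
      using x[of "k - int l"] sums_iff_shift[of f l "x (k - int l)"] by (simp add: f_def[abs_def])
  qed
  have "(\<lambda>i. impulse p \<theta> i * w (k - int i) - (\<Sum>l = 1..p. \<theta> l * ((if l \<le> i then impulse p \<theta> (i - l) else 0) * w (k - int i))))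
     sums (x k - (\<Sum>l = 1..p. \<theta> l * x (k - int l)))"
    by (intro sums_diff sums_sum sums_mult shift x)
  moreover have "(\<lambda>i. impulse p \<theta> i * w (k - int i) - (\<Sum>l = 1..p. \<theta> l * ((if l \<le> i then impulse p \<theta> (i - l) else 0) * w (k - int i))))
     = (\<lambda>i. if i = 0 then w k else 0)"
  proof
    fix i
    have "(\<Sum>l = 1..p. \<theta> l * ((if l \<le> i then impulse p \<theta> (i - l) else 0) * w (k - int i)))
       = (\<Sum>l = 1..p. \<theta> l * (if l \<le> i then impulse p \<theta> (i - l) else 0)) * w (k - int i)"
      by (simp only: sum_distrib_right mult.assoc)
    moreover have "(\<Sum>l = 1..p. \<theta> l * (if l \<le> i then impulse p \<theta> (i - l) else 0)) = (if i = 0 then 0 else impulse p \<theta> i)"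
      by (auto simp: impulse_rec)
    ultimately show "impulse p \<theta> i * w (k - int i) - (\<Sum>l = 1..p. \<theta> l * ((if l \<le> i then impulse p \<theta> (i - l) else 0) * w (k - int i)))
       = (if i = 0 then w k else 0)" by simp
  qed
  ultimately show ?thesis
    using sums_unique2[OF _ sums_single[of 0 "\<lambda>_. w k"]] by simp
qed

text \<open>\<open>P\<close> is the law of the moving average of independent Gaussian coordinates.
  The bound \<open>1 \<le> K\<close> places their moment generating function below the one allowed
  by the class.\<close>

lemma gaussian_AR_law_exists:
  assumes \<theta>: "\<theta> \<in> {1..p} \<rightarrow>\<^sub>E UNIV" and l1: "l1_norm p \<theta> \<le> 1 - \<eta>" and pos: "0 < \<eta>" "0 < \<sigma>" and K: "1 \<le> K"
  obtains P w where "(\<theta>, P) \<in> AR_laws \<eta> \<sigma> K p" "AR_process P p \<theta> \<sigma> K (\<lambda>k \<omega>. \<omega> k) w"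
    "\<And>k. distr P borel (w k) = gauss \<sigma>" "sets P = sets (PiM UNIV (\<lambda>_. borel))"
proof -
  let ?B = "PiM UNIV (\<lambda>_::int. borel :: real measure)"
  define \<Omega> where "\<Omega> = PiM UNIV (\<lambda>_::int. gauss \<sigma>)"
  interpret G: prob_space "gauss \<sigma>" using prob_space_gauss pos(2) .
  interpret O: prob_space \<Omega> unfolding \<Omega>_def by (intro prob_space_PiM G.prob_space_axioms)
  have sO [measurable_cong]: "sets \<Omega> = sets ?B" unfolding \<Omega>_def by (rule sets_PiM_gauss)
  have coord [measurable]: "(\<lambda>\<omega>. \<omega> k) \<in> borel_measurable \<Omega>" for k :: int
    using measurable_component_singleton[of k UNIV "\<lambda>_. borel :: real measure"] by measurable
  have dist: "distr \<Omega> borel (\<lambda>\<omega>. \<omega> k) = gauss \<sigma>" for k :: int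
  proof -
    have "distr \<Omega> borel (\<lambda>\<omega>. \<omega> k) = distr \<Omega> (gauss \<sigma>) (\<lambda>\<omega>. \<omega> k)" by (rule distr_cong) auto
    also have "\<dots> = gauss \<sigma>" unfolding \<Omega>_def by (rule distr_PiM_component) (auto intro: G.prob_space_axioms)
    finally show ?thesis .
  qed
  define X where "X \<omega> k = (\<Sum>j. impulse p \<theta> j * \<omega> (k - int j))" for \<omega> and k :: int
  have X1 [measurable]: "(\<lambda>\<omega>. X \<omega> k) \<in> borel_measurable \<Omega>" for k
    unfolding X_def by measurable
  have X [measurable]: "X \<in> \<Omega> \<rightarrow>\<^sub>M ?B"
    by (rule measurable_PiM_single') auto
  define P where "P = distr \<Omega> ?B X"
  have sP [measurable_cong]: "sets P = sets ?B" by (simp add: P_def)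
  have distP: "distr P ?B f = distr \<Omega> ?B (f \<circ> X)" if "f \<in> ?B \<rightarrow>\<^sub>M ?B" for f
    unfolding P_def using that X by (rule distr_distr)
  interpret P: prob_space P unfolding P_def by (rule O.prob_space_distr) measurable
  \<comment> \<open>Innovations must live on the path space. As residuals they satisfy the
    autoregression for every path, and it remains to identify them with the Gaussian
    coordinates.\<close>
  define w where "w k y = y k - (\<Sum>l = 1..p. \<theta> l * y (k - int l))" for k :: int and y :: "int \<Rightarrow> real"
  have c [measurable]: "(\<lambda>y. y k) \<in> borel_measurable ?B" for k :: int
    by (rule measurable_component_singleton) simp
  have w [measurable]: "w k \<in> borel_measurable ?B" for k
    unfolding w_def by measurable
  have w2 [measurable]: "w k \<in> borel_measurable P" for k by measurable
  have "AE \<omega> in \<Omega>. \<forall>k. summable (\<lambda>j. \<bar>impulse p \<theta> j * \<omega> (k - int j)\<bar>)"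
  proof (rule AE_summable_ma)
    show "(\<integral>\<^sup>+\<omega>. ennreal \<bar>\<omega> k\<bar> \<partial>\<Omega>) = (\<integral>\<^sup>+z. ennreal \<bar>z\<bar> \<partial>gauss \<sigma>)" for k
      unfolding dist[of k, symmetric] by (subst nn_integral_distr) auto
    show "(\<integral>\<^sup>+z. ennreal \<bar>z\<bar> \<partial>gauss \<sigma>) < \<infinity>"
      using gauss_moments(1)[OF pos(2)] by (simp add: integrable_iff_bounded)
    show "summable (\<lambda>j. \<bar>impulse p \<theta> j\<bar>)" by (rule summable_abs_impulse[OF l1 pos(1)])
  qed measurable
  then have wX: "AE \<omega> in \<Omega>. \<forall>k. w k (X \<omega>) = \<omega> k"
  proof eventually_elim
    case (elim \<omega>)
    have "(\<lambda>j. impulse p \<theta> j * \<omega> (k - int j)) sums X \<omega> k" for k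
      unfolding X_def by (rule summable_sums, rule summable_rabs_cancel, rule spec[OF elim])
    then show ?case unfolding w_def by (intro allI impulse_inverts)
  qed
  have distw: "distr P borel (w k) = gauss \<sigma>" for k
  proof -
    have "distr P borel (w k) = distr \<Omega> borel (\<lambda>\<omega>. w k (X \<omega>))"
      unfolding P_def by (subst distr_distr) (auto simp: comp_def)
    also have "\<dots> = distr \<Omega> borel (\<lambda>\<omega>. \<omega> k)"
      using wX by (intro distr_cong_AE) auto
    finally show ?thesis by (simp add: dist)
  qed
  have intw: "(\<integral>\<^sup>+y. f (w k y) \<partial>P) = (\<integral>\<^sup>+z. f z \<partial>gauss \<sigma>)" if "f \<in> borel_measurable borel" for f :: "real \<Rightarrow> ennreal" and k
    using that unfolding distw[of k, symmetric] by (subst nn_integral_distr) auto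
  have AR: "AR_process P p \<theta> \<sigma> K (\<lambda>k \<omega>. \<omega> k) w"
    unfolding AR_process_def
  proof (intro conjI allI)
    show "prob_space P" by (rule P.prob_space_axioms)
    show "(\<lambda>\<omega>. \<omega> k) \<in> borel_measurable P" for k :: int by measurable
    fix h :: int
    \<comment> \<open>Stationarity holds because the shift preserves the product measure and
      commutes with the moving average.\<close>
    define sh where "sh \<omega> = (\<lambda>k. \<omega> (k + h))" for \<omega> :: "int \<Rightarrow> real"
    have shm [measurable]: "sh \<in> \<Omega> \<rightarrow>\<^sub>M \<Omega>"
    proof -
      have "sh \<in> \<Omega> \<rightarrow>\<^sub>M ?B" by (rule measurable_PiM_single') (auto simp: sh_def)
      then show ?thesis by (simp add: sO cong: measurable_cong_sets)
    qed
    have "distr \<Omega> \<Omega> (\<lambda>\<omega>. \<lambda>k\<in>UNIV. \<omega> (k + h)) = \<Omega>"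
      unfolding \<Omega>_def
      by (rule distr_PiM_reindex[of UNIV "\<lambda>_. gauss \<sigma>" "\<lambda>k. k + h" UNIV]) (auto intro: G.prob_space_axioms)
    moreover have "(\<lambda>\<omega>. \<lambda>k\<in>UNIV. \<omega> (k + h)) = sh" by (intro ext) (simp add: sh_def)
    ultimately have "distr \<Omega> \<Omega> sh = \<Omega>" by (simp only:)
    moreover have "(\<lambda>\<omega>. X (sh \<omega>)) = (\<lambda>\<omega> k. X \<omega> (k + h))"
      by (simp add: X_def sh_def algebra_simps fun_eq_iff)
    moreover have "distr (distr \<Omega> \<Omega> sh) ?B X = distr \<Omega> ?B (\<lambda>\<omega>. X (sh \<omega>))"
      using distr_distr[OF X shm] by (simp only: comp_def)
    ultimately have st: "distr \<Omega> ?B X = distr \<Omega> ?B (\<lambda>\<omega> k. X \<omega> (k + h))" by (simp only:)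
    have "(\<lambda>\<omega> k. \<omega> (k + h)) \<in> ?B \<rightarrow>\<^sub>M ?B" by (rule measurable_PiM_single') auto
    from distP[OF this] distP[OF measurable_ident]
    show "distr P ?B (\<lambda>\<omega> k. \<omega> (k + h)) = distr P ?B (\<lambda>\<omega> k. \<omega> k)"
      by (simp only: comp_def id_def st)
  next
    show "AE \<omega> in P. \<omega> k = (\<Sum>l = 1..p. \<theta> l * \<omega> (k - int l)) + w k \<omega>" for k
      by (simp add: w_def)
    show "P.indep_vars (\<lambda>_. borel) w UNIV"
    proof (subst P.indep_vars_iff_distr_eq_PiM)
      have "distr P ?B (\<lambda>y. \<lambda>i\<in>UNIV. w i y) = distr \<Omega> ?B (\<lambda>\<omega> i. w i (X \<omega>))"
      proof -
        have "(\<lambda>y i. w i y) \<in> ?B \<rightarrow>\<^sub>M ?B" by (rule measurable_PiM_single') auto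
        from distP[OF this] show ?thesis by (simp only: comp_def restrict_UNIV)
      qed
      also have "\<dots> = distr \<Omega> ?B (\<lambda>\<omega>. \<omega>)"
      proof (rule distr_cong_AE)
        show "AE \<omega> in \<Omega>. (\<lambda>i. w i (X \<omega>)) = \<omega>" using wX by eventually_elim auto
        show "(\<lambda>\<omega> i. w i (X \<omega>)) \<in> \<Omega> \<rightarrow>\<^sub>M ?B" by (rule measurable_PiM_single') auto
      qed (auto simp: sO cong: measurable_cong_sets)
      also have "\<dots> = \<Omega>" by (rule distr_id2) (simp add: sO)
      also have "\<dots> = PiM UNIV (\<lambda>i. distr P borel (w i))" by (simp add: distw \<Omega>_def)
      finally show "distr P ?B (\<lambda>y. \<lambda>i\<in>UNIV. w i y) = PiM UNIV (\<lambda>i. distr P borel (w i))" .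
    qed auto
    show "distr P borel (w k) = distr P borel (w 0)" for k by (simp add: distw)
    fix k
    have i: "integrable P (\<lambda>y. f (w k y))" if "integrable (gauss \<sigma>) f" for f :: "real \<Rightarrow> real"
      using that integrable_distr[OF w2[of k], of f] unfolding distw by blast
    have e: "P.expectation (\<lambda>y. f (w k y)) = integral\<^sup>L (gauss \<sigma>) f" if "f \<in> borel_measurable borel" for f :: "real \<Rightarrow> real"
      using integral_distr[OF w2[of k] that] unfolding distw by (rule sym)
    note m = gauss_moments[OF pos(2)]
    show "integrable P (w k)" by (rule i[OF m(1)])
    show ex: "P.expectation (w k) = 0" using e[of "\<lambda>z. z"] unfolding m(2) by simp
    show "integrable P (\<lambda>\<omega>. (w k \<omega>)\<^sup>2)" by (rule i[OF m(3)])
    show "P.variance (w k) = \<sigma>\<^sup>2" using e[of "\<lambda>z. z\<^sup>2"] unfolding m(4) ex by simp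
    fix t
    have "(\<lambda>z. ennreal (exp (t * z))) \<in> borel_measurable borel" by measurable
    from intw[OF this, of k] have nn: "(\<integral>\<^sup>+\<omega>. ennreal (exp (t * w k \<omega>)) \<partial>P) = ennreal (exp (\<sigma>\<^sup>2 * t\<^sup>2 / 2))"
      unfolding gauss_mgf[OF pos(2)] .
    have "(\<integral>\<^sup>+\<omega>. ennreal (exp (t * w k \<omega>)) \<partial>P) < \<infinity>" unfolding nn by simp
    moreover have "(\<lambda>\<omega>. exp (t * w k \<omega>)) \<in> borel_measurable P"
      by (rule measurable_compose[OF w2[of k]]) measurable
    ultimately show ie: "integrable P (\<lambda>\<omega>. exp (t * w k \<omega>))"
      by (intro integrableI_nonneg) auto
    have "P.expectation (\<lambda>\<omega>. exp (t * w k \<omega>)) = exp (\<sigma>\<^sup>2 * t\<^sup>2 / 2)"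
      using nn by (subst (asm) nn_integral_eq_integral[OF ie]) auto
    also have "\<dots> \<le> exp (K\<^sup>2 * \<sigma>\<^sup>2 * t\<^sup>2 / 2)"
    proof -
      have "1 * (\<sigma>\<^sup>2 * t\<^sup>2) \<le> K\<^sup>2 * (\<sigma>\<^sup>2 * t\<^sup>2)" using K by (intro mult_right_mono) auto
      then show ?thesis by simp
    qed
    finally show "P.expectation (\<lambda>\<omega>. exp (t * w k \<omega>)) \<le> exp (K\<^sup>2 * \<sigma>\<^sup>2 * t\<^sup>2 / 2)" .
  qed
  show ?thesis
    by (rule that[OF _ AR distw sP]) (use \<theta> l1 sP AR in \<open>auto simp: AR_laws_def\<close>)
qed

subsection \<open>Change of measure for a Gaussian vector with adapted drift\<close>

text \<open>The solution \<open>z\<close> of \<open>z k = w k + u k z\<close>, built one coordinate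
  at a time. The start is the only point of the product over the empty index set, so that all values
  lie in the product over \<open>{..<N}\<close>.\<close>

primrec drift :: "(nat \<Rightarrow> (nat \<Rightarrow> real) \<Rightarrow> real) \<Rightarrow> nat \<Rightarrow> (nat \<Rightarrow> real) \<Rightarrow> (nat \<Rightarrow> real)" where
  "drift u 0 w = (\<lambda>_. undefined)"
| "drift u (Suc N) w = (drift u N w)(N := w N + u N (drift u N w))"

text \<open>Each \<open>u k\<close> looks only at the coordinates below \<open>k\<close>. As it is
  applied to vectors of different lengths, measurability is demanded on every product that contains
  these coordinates.\<close>

definition adapted :: "(nat \<Rightarrow> (nat \<Rightarrow> real) \<Rightarrow> real) \<Rightarrow> bool" where
  "adapted u \<longleftrightarrow> (\<forall>k z z'. (\<forall>i<k. z i = z' i) \<longrightarrow> u k z = u k z') \<and>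
     (\<forall>k N. k \<le> N \<longrightarrow> u k \<in> borel_measurable (PiM {..<N} (\<lambda>_. borel)))"

text \<open>The density at \<open>z\<close> of the Gaussian with mean \<open>u\<close> relative to
  the centred one, both of variance \<open>\<sigma>\<^sup>2\<close>.\<close>

definition lr :: "real \<Rightarrow> real \<Rightarrow> real \<Rightarrow> real" where
  "lr \<sigma> z u = exp ((z * u - u\<^sup>2 / 2) / \<sigma>\<^sup>2)"

lemma adaptedD: "adapted u \<Longrightarrow> (\<And>i. i < k \<Longrightarrow> z i = z' i) \<Longrightarrow> u k z = u k z'"
  unfolding adapted_def by blast

lemma adapted_measurable: "adapted u \<Longrightarrow> k \<le> N \<Longrightarrow> u k \<in> borel_measurable (PiM {..<N} (\<lambda>_. borel))"
  unfolding adapted_def by blast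

lemma lr_meas [measurable]:
  assumes [measurable]: "f \<in> borel_measurable M" "g \<in> borel_measurable M"
  shows "(\<lambda>x. lr \<sigma> (f x) (g x)) \<in> borel_measurable M"
  unfolding lr_def by measurable

lemma drift_cong: "(\<And>i. i < N \<Longrightarrow> w i = w' i) \<Longrightarrow> drift u N w = drift u N w'"
  by (induction N) auto

lemma drift_measurable:
  assumes "adapted u"
  shows "drift u N \<in> PiM {..<N} (\<lambda>_. borel) \<rightarrow>\<^sub>M PiM {..<N} (\<lambda>_. borel)"
proof (induction N)
  case 0
  show ?case by (rule measurable_PiM_single') auto
next
  case (Suc N)
  have r: "(\<lambda>w. restrict w {..<N}) \<in> PiM {..<Suc N} (\<lambda>_. borel) \<rightarrow>\<^sub>M PiM {..<N} (\<lambda>_. borel :: real measure)"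
    by (rule measurable_restrict_subset) auto
  have "(\<lambda>w. drift u N (restrict w {..<N})) \<in> PiM {..<Suc N} (\<lambda>_. borel) \<rightarrow>\<^sub>M PiM {..<N} (\<lambda>_. borel)"
    using measurable_compose[OF r Suc] .
  moreover have "(\<lambda>w. drift u N (restrict w {..<N})) = drift u N"
    by (intro ext drift_cong) auto
  ultimately have d [measurable]: "drift u N \<in> PiM {..<Suc N} (\<lambda>_. borel) \<rightarrow>\<^sub>M PiM {..<N} (\<lambda>_. borel)" by simp
  have u [measurable]: "u N \<in> borel_measurable (PiM {..<N} (\<lambda>_. borel))"
    using assms by (simp add: adapted_def)
  have c [measurable]: "(\<lambda>w. w N) \<in> borel_measurable (PiM {..<Suc N} (\<lambda>_. borel :: real measure))"
    by (rule measurable_component_singleton) simp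
  show ?case
    unfolding drift.simps
  proof (rule measurable_fun_upd[where J = "{..<N}"])
    show "{..<Suc N} = {..<N} \<union> {N}" by auto
    show "(\<lambda>w. w N + u N (drift u N w)) \<in> borel_measurable (PiM {..<Suc N} (\<lambda>_. borel))"
      by (intro borel_measurable_add c measurable_compose[OF d u])
  qed (rule d)
qed

text \<open>A discrete Girsanov formula. Given the earlier coordinates, the last drift is a
  constant, so the one-dimensional shift applies; induction treats the rest.\<close>

lemma gauss_change_of_measure:
  assumes \<sigma>: "0 < \<sigma>" and u: "adapted u" and h: "h \<in> borel_measurable (PiM {..<N} (\<lambda>_. borel))"
  shows "(\<integral>\<^sup>+w. h (drift u N w) \<partial>PiM {..<N} (\<lambda>_. gauss \<sigma>))
       = (\<integral>\<^sup>+z. h z * (\<Prod>k<N. ennreal (lr \<sigma> (z k) (u k z))) \<partial>PiM {..<N} (\<lambda>_. gauss \<sigma>))"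
  using h
proof (induction N arbitrary: h)
  case 0
  have "PiM {..<0::nat} (\<lambda>_. gauss \<sigma>) = count_space {\<lambda>_. undefined}" by (simp add: PiM_empty)
  then show ?case by (simp add: nn_integral_count_space_finite)
next
  case (Suc N)
  note h [measurable] = Suc.prems
  interpret product_sigma_finite "\<lambda>_::nat. gauss \<sigma>"
    by (intro product_sigma_finite.intro prob_space_imp_sigma_finite prob_space_gauss \<sigma>)
  note d [measurable] = drift_measurable[OF u]
  have um [measurable]: "u k \<in> borel_measurable (PiM {..<N'} (\<lambda>_. borel))" if "k \<le> N'" for k N'
    using that by (rule adapted_measurable[OF u])
  have loc: "u k (v(N := z)) = u k v" if "k \<le> N" for k v z
    using that by (intro adaptedD[OF u]) auto
  have cm [measurable]: "(\<lambda>z. z k) \<in> borel_measurable (PiM {..<N'} (\<lambda>_. borel :: real measure))" if "k < N'" for k N'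
    using that by (intro measurable_component_singleton) simp
  have upd: "(\<lambda>(v, z). v(N := z)) \<in> PiM {..<N} (\<lambda>_. borel) \<Otimes>\<^sub>M borel \<rightarrow>\<^sub>M PiM {..<Suc N} (\<lambda>_. borel :: real measure)"
    using measurable_add_dim[of N "{..<N}" "\<lambda>_. borel :: real measure"] by (simp add: lessThan_Suc)
  have hu [measurable]: "(\<lambda>vz. h ((fst vz)(N := snd vz))) \<in> borel_measurable (PiM {..<N} (\<lambda>_. borel) \<Otimes>\<^sub>M borel)"
    using measurable_compose[OF upd h] unfolding split_beta' .
  \<comment> \<open>The last coordinate is integrated out together with its likelihood factor, and
    the induction hypothesis is applied to the resulting function.\<close>
  define H where "H v = (\<integral>\<^sup>+z. h (v(N := z)) * ennreal (lr \<sigma> z (u N v)) \<partial>gauss \<sigma>)" for v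
  have nm: "N \<notin> {..<N}" by simp
  have sf: "sigma_finite_measure (gauss \<sigma>)" by (intro prob_space_imp_sigma_finite prob_space_gauss \<sigma>)
  have H [measurable]: "H \<in> borel_measurable (PiM {..<N} (\<lambda>_. borel))"
  proof -
    have uf: "(\<lambda>vz. u N (fst vz)) \<in> borel_measurable (PiM {..<N} (\<lambda>_. borel) \<Otimes>\<^sub>M borel)"
      by (rule measurable_compose[OF measurable_fst um[OF order_refl]])
    have "(\<lambda>vz. h ((fst vz)(N := snd vz)) * ennreal (lr \<sigma> (snd vz) (u N (fst vz)))) \<in> borel_measurable (PiM {..<N} (\<lambda>_. borel) \<Otimes>\<^sub>M borel)"
      by (intro borel_measurable_times_ennreal hu measurable_compose[OF _ measurable_ennreal] lr_meas measurable_snd uf)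
    then have "(\<lambda>(v, z). h (v(N := z)) * ennreal (lr \<sigma> z (u N v))) \<in> borel_measurable (PiM {..<N} (\<lambda>_. borel) \<Otimes>\<^sub>M gauss \<sigma>)"
      unfolding split_beta' by (subst measurable_cong_sets[OF sets_pair_measure_cong[OF refl sets_gauss] refl])
    then show ?thesis unfolding H_def[abs_def] by (rule sigma_finite_measure.borel_measurable_nn_integral[OF sf])
  qed
  have "(\<integral>\<^sup>+w. h (drift u (Suc N) w) \<partial>PiM {..<Suc N} (\<lambda>_. gauss \<sigma>))
     = (\<integral>\<^sup>+v. \<integral>\<^sup>+y. h (drift u (Suc N) (v(N := y))) \<partial>gauss \<sigma> \<partial>PiM {..<N} (\<lambda>_. gauss \<sigma>))"
  proof -
    have "(\<lambda>w. h (drift u (Suc N) w)) \<in> borel_measurable (PiM (insert N {..<N}) (\<lambda>_. gauss \<sigma>))"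
      using measurable_compose[OF d h] unfolding lessThan_Suc by (subst measurable_cong_sets[OF sets_PiM_gauss refl])
    from product_nn_integral_insert[OF finite_lessThan nm this] show ?thesis
      unfolding lessThan_Suc .
  qed
  also have "\<dots> = (\<integral>\<^sup>+v. H (drift u N v) \<partial>PiM {..<N} (\<lambda>_. gauss \<sigma>))"
  proof (intro nn_integral_cong)
    fix v assume "v \<in> space (PiM {..<N} (\<lambda>_. gauss \<sigma>))"
    then have v: "v \<in> space (PiM {..<N} (\<lambda>_. borel))" by (simp add: space_PiM)
    then have dv: "drift u N v \<in> space (PiM {..<N} (\<lambda>_. borel))" using measurable_space[OF d] by blast
    have hm: "(\<lambda>z. h ((drift u N v)(N := z))) \<in> borel_measurable borel"
      using measurable_compose[OF measurable_Pair1'[OF dv] hu] by simp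
    have "drift u (Suc N) (v(N := y)) = (drift u N v)(N := y + u N (drift u N v))" for y
    proof -
      have "drift u N (v(N := y)) = drift u N v" by (rule drift_cong) auto
      then show ?thesis by simp
    qed
    then show "(\<integral>\<^sup>+y. h (drift u (Suc N) (v(N := y))) \<partial>gauss \<sigma>) = H (drift u N v)"
      unfolding H_def lr_def using gauss_shift[OF \<sigma> hm] by simp
  qed
  also have "\<dots> = (\<integral>\<^sup>+v. H v * (\<Prod>k<N. ennreal (lr \<sigma> (v k) (u k v))) \<partial>PiM {..<N} (\<lambda>_. gauss \<sigma>))"
    by (rule Suc.IH[OF H])
  also have "\<dots> = (\<integral>\<^sup>+v. \<integral>\<^sup>+z. h (v(N := z)) * (\<Prod>k<Suc N. ennreal (lr \<sigma> ((v(N := z)) k) (u k (v(N := z))))) \<partial>gauss \<sigma> \<partial>PiM {..<N} (\<lambda>_. gauss \<sigma>))"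
  proof (intro nn_integral_cong)
    fix v assume "v \<in> space (PiM {..<N} (\<lambda>_. gauss \<sigma>))"
    then have v: "v \<in> space (PiM {..<N} (\<lambda>_. borel))" by (simp add: space_PiM)
    have hm [measurable]: "(\<lambda>z. h (v(N := z))) \<in> borel_measurable borel"
      using measurable_compose[OF measurable_Pair1'[OF v] hu] by simp
    have "(\<lambda>z. h (v(N := z)) * ennreal (lr \<sigma> z (u N v))) \<in> borel_measurable borel"
      by (intro borel_measurable_times_ennreal hm measurable_compose[OF _ measurable_ennreal] lr_meas) auto
    then have hm2: "(\<lambda>z. h (v(N := z)) * ennreal (lr \<sigma> z (u N v))) \<in> borel_measurable (gauss \<sigma>)"
      by (subst measurable_cong_sets[OF sets_gauss refl])
    have "(\<Prod>k<Suc N. ennreal (lr \<sigma> ((v(N := z)) k) (u k (v(N := z)))))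
       = (\<Prod>k<N. ennreal (lr \<sigma> (v k) (u k v))) * ennreal (lr \<sigma> z (u N v))" for z
    proof -
      have "(\<Prod>k<N. ennreal (lr \<sigma> ((v(N := z)) k) (u k (v(N := z))))) = (\<Prod>k<N. ennreal (lr \<sigma> (v k) (u k v)))"
        by (rule prod.cong) (auto simp: loc)
      then show ?thesis unfolding prod.lessThan_Suc by (simp add: loc[OF order_refl])
    qed
    note prodeq = this
    have "H v * (\<Prod>k<N. ennreal (lr \<sigma> (v k) (u k v)))
       = (\<integral>\<^sup>+z. h (v(N := z)) * ennreal (lr \<sigma> z (u N v)) * (\<Prod>k<N. ennreal (lr \<sigma> (v k) (u k v))) \<partial>gauss \<sigma>)"
      unfolding H_def by (rule nn_integral_multc[OF hm2, symmetric])
    then show "H v * (\<Prod>k<N. ennreal (lr \<sigma> (v k) (u k v)))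
       = (\<integral>\<^sup>+z. h (v(N := z)) * (\<Prod>k<Suc N. ennreal (lr \<sigma> ((v(N := z)) k) (u k (v(N := z))))) \<partial>gauss \<sigma>)"
      unfolding prodeq by (simp only: mult.assoc mult.commute mult.left_commute)
  qed
  also have "\<dots> = (\<integral>\<^sup>+z. h z * (\<Prod>k<Suc N. ennreal (lr \<sigma> (z k) (u k z))) \<partial>PiM {..<Suc N} (\<lambda>_. gauss \<sigma>))"
  proof -
    have "(\<lambda>z. ennreal (lr \<sigma> (z k) (u k z))) \<in> borel_measurable (PiM {..<Suc N} (\<lambda>_. borel))" if "k \<in> {..<Suc N}" for k
      using cm[of k "Suc N"] um[of k "Suc N"] that
      by (intro measurable_compose[OF _ measurable_ennreal] lr_meas) auto
    then have "(\<lambda>z. h z * (\<Prod>k<Suc N. ennreal (lr \<sigma> (z k) (u k z)))) \<in> borel_measurable (PiM {..<Suc N} (\<lambda>_. borel))"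
      by (intro borel_measurable_times_ennreal borel_measurable_prod_ennreal h)
    then have "(\<lambda>z. h z * (\<Prod>k<Suc N. ennreal (lr \<sigma> (z k) (u k z)))) \<in> borel_measurable (PiM (insert N {..<N}) (\<lambda>_. gauss \<sigma>))"
      unfolding lessThan_Suc by (subst measurable_cong_sets[OF sets_PiM_gauss refl])
    from product_nn_integral_insert[OF finite_lessThan nm this, symmetric] show ?thesis
      unfolding lessThan_Suc .
  qed
  finally show ?case .
qed

lemma drift_eqI:
  assumes u: "adapted u" and z: "\<And>i. i < N \<Longrightarrow> z i = w i + u i z" "z \<in> extensional {..<N}"
  shows "drift u N w = z"
proof -
  have "m \<le> N \<Longrightarrow> drift u m w = restrict z {..<m}" for m
  proof (induction m)
    case 0
    show ?case by (auto simp: restrict_def)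
  next
    case (Suc m)
    have "u m (restrict z {..<m}) = u m z" by (rule adaptedD[OF u]) auto
    then have *: "w m + u m (restrict z {..<m}) = z m" using z(1)[of m] Suc.prems by simp
    have IH: "drift u m w = restrict z {..<m}" by (rule Suc.IH) (use Suc.prems in simp)
    show ?case unfolding drift.simps IH * by (auto simp: restrict_def fun_eq_iff less_Suc_eq)
  qed
  then show ?thesis using z(2) by (simp add: extensional_restrict)
qed

subsection \<open>The likelihood relative to white noise\<close>

locale ar_gauss = ar_proc +
  fixes n :: nat
  assumes w_gauss: "\<And>k. distr M borel (w k) = gauss \<sigma>"
    and n_p: "1 \<le> n" "n < p"
    and long_lags: "\<And>l. 1 \<le> l \<Longrightarrow> l \<le> p - n \<Longrightarrow> \<theta> l = 0"
begin

text \<open>The observations are indexed by \<open>i < N\<close> and taken at \<open>time i\<close>, starting at \<open>1 - p\<close>. As no lag is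
  smaller than \<open>p - n + 1\<close>, the first \<open>q\<close> of them regress only on values from the unobserved \<open>past\<close>.\<close>

definition N :: nat where "N = n + p"
definition q :: nat where "q = p + 1 - n"
definition time :: "nat \<Rightarrow> int" where "time i = int i + 1 - int p"
definition past :: "int set" where "past = {..- int p}"

abbreviation S where "S \<equiv> PiM past (\<lambda>_. borel :: real measure)"
abbreviation Z where "Z \<equiv> PiM {..<N} (\<lambda>_. borel :: real measure)"
abbreviation Q where "Q \<equiv> PiM {..<N} (\<lambda>_. gauss \<sigma>)"

text \<open>Lags lead further into the past, so the past of the process is a function of the past
  innovations alone.\<close>

definition ma_past :: "(int \<Rightarrow> real) \<Rightarrow> (int \<Rightarrow> real)" where
  "ma_past v = (\<lambda>k\<in>past. \<Sum>j. psi j * v (k - int j))"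

text \<open>A version of the past of \<open>x\<close>, almost surely equal to it, that is literally
  a function of past innovations and therefore independent of \<open>W\<close>.\<close>

definition F :: "'a \<Rightarrow> int \<Rightarrow> real" where "F \<omega> = ma_past (restrict (\<lambda>k. w k \<omega>) past)"
definition W :: "'a \<Rightarrow> nat \<Rightarrow> real" where "W \<omega> = (\<lambda>i\<in>{..<N}. w (time i) \<omega>)"
definition X :: "'a \<Rightarrow> nat \<Rightarrow> real" where "X \<omega> = (\<lambda>i\<in>{..<N}. x (time i) \<omega>)"
definition LF where "LF = distr M S F"

text \<open>The conditional mean of observation \<open>i\<close> given the past \<open>y\<close> and
  the earlier observations; it plays the role of the drift.\<close>

definition U :: "(int \<Rightarrow> real) \<Rightarrow> nat \<Rightarrow> (nat \<Rightarrow> real) \<Rightarrow> real" where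
  "U y i z = (\<Sum>l = 1..p. \<theta> l * (if i < l then y (time i - int l) else z (i - l)))"

definition reg :: "int \<Rightarrow> 'a \<Rightarrow> real" where "reg k \<omega> = (\<Sum>l = 1..p. \<theta> l * x (k - int l) \<omega>)"

lemma reg_meas [measurable]: "reg k \<in> borel_measurable M"
  unfolding reg_def by measurable

lemma past_diff: "k \<in> past \<Longrightarrow> k - int j \<in> past"
  by (simp add: past_def)

lemma ma_past_meas: "ma_past \<in> S \<rightarrow>\<^sub>M S"
proof (rule measurable_PiM_single')
  fix k assume k: "k \<in> past"
  have c [measurable]: "(\<lambda>v. v (k - int j)) \<in> borel_measurable S" for j
    by (rule measurable_component_singleton[OF past_diff[OF k]])
  have "(\<lambda>v. \<Sum>j. psi j * v (k - int j)) \<in> borel_measurable S" by measurable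
  then show "(\<lambda>v. ma_past v k) \<in> borel_measurable S" using k by (simp add: ma_past_def)
qed (auto simp: ma_past_def)

lemma F_meas [measurable]: "F \<in> M \<rightarrow>\<^sub>M S"
  unfolding F_def
  by (rule measurable_compose[OF _ ma_past_meas]) (rule measurable_restrict, measurable)

lemma F_AE: "AE \<omega> in M. \<forall>k\<in>past. F \<omega> k = x k \<omega>"
  using ma_sums
proof eventually_elim
  case (elim \<omega>)
  show ?case
  proof
    fix k assume k: "k \<in> past"
    have "F \<omega> k = (\<Sum>j. psi j * w (k - int j) \<omega>)"
      using k past_diff[OF k] by (simp add: F_def ma_past_def)
    also have "\<dots> = x k \<omega>" using spec[OF elim, of k] by (rule sums_unique[symmetric])
    finally show "F \<omega> k = x k \<omega>" .
  qed
qed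

lemma W_meas [measurable]: "W \<in> M \<rightarrow>\<^sub>M Z"
  unfolding W_def by (rule measurable_restrict) measurable

lemma X_meas [measurable]: "X \<in> M \<rightarrow>\<^sub>M Z"
  unfolding X_def by (rule measurable_restrict) measurable

lemma w_reindex_indep: "inj_on f I \<Longrightarrow> indep_vars (\<lambda>_. borel) (\<lambda>i. w (f i)) I" for f :: "'i \<Rightarrow> int"
proof -
  assume f: "inj_on f I"
  have "disjoint_family_on (\<lambda>i. {f i}) I"
    using f by (auto simp: disjoint_family_on_def inj_on_def)
  then have "indep_vars (\<lambda>i. PiM {f i} (\<lambda>_. borel)) (\<lambda>i \<omega>. restrict (\<lambda>k. w k \<omega>) {f i}) I"
    by (intro indep_vars_restrict[OF w_indep]) auto
  then have "indep_vars (\<lambda>_. borel) (\<lambda>i \<omega>. (\<lambda>v. v (f i)) (restrict (\<lambda>k. w k \<omega>) {f i})) I"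
    by (rule indep_vars_compose2) (auto intro: measurable_component_singleton)
  then show ?thesis by simp
qed

lemma W_law: "distr M Z W = Q"
proof (cases "N = 0")
  case False
  have "inj_on time {..<N}" by (auto simp: inj_on_def time_def)
  then have "indep_vars (\<lambda>_. borel) (\<lambda>i. w (time i)) {..<N}" by (rule w_reindex_indep)
  moreover have "{..<N} \<noteq> {}" using False by auto
  ultimately show ?thesis
    unfolding W_def by (subst (asm) indep_vars_iff_distr_eq_PiM') (auto simp: w_gauss)
qed (use n_p in \<open>simp add: N_def\<close>)

text \<open>The innovations up to time \<open>- p\<close> and those from \<open>1 - p\<close> on
  have disjoint index sets.\<close>

lemma F_W_law: "distr M (S \<Otimes>\<^sub>M Z) (\<lambda>\<omega>. (F \<omega>, W \<omega>)) = LF \<Otimes>\<^sub>M Q"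
proof -
  define pres where "pres = {- int p + 1..int n}"
  have "indep_var S (\<lambda>\<omega>. restrict (\<lambda>k. w k \<omega>) past) (PiM pres (\<lambda>_. borel)) (\<lambda>\<omega>. restrict (\<lambda>k. w k \<omega>) pres)"
    by (rule indep_var_restrict[OF w_indep]) (auto simp: past_def pres_def)
  then have "indep_var S (ma_past \<circ> (\<lambda>\<omega>. restrict (\<lambda>k. w k \<omega>) past)) (PiM pres (\<lambda>_. borel)) (id \<circ> (\<lambda>\<omega>. restrict (\<lambda>k. w k \<omega>) pres))"
    using ma_past_meas by (rule indep_var_compose) (rule measurable_ident)
  moreover have "ma_past \<circ> (\<lambda>\<omega>. restrict (\<lambda>k. w k \<omega>) past) = F"
    by (simp add: F_def fun_eq_iff)
  moreover define V where "V = (\<lambda>\<omega>. restrict (\<lambda>k. w k \<omega>) pres)"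
  ultimately have "indep_var S F (PiM pres (\<lambda>_. borel)) V" by simp
  then have joint: "LF \<Otimes>\<^sub>M distr M (PiM pres (\<lambda>_. borel)) V = distr M (S \<Otimes>\<^sub>M PiM pres (\<lambda>_. borel)) (\<lambda>\<omega>. (F \<omega>, V \<omega>))"
    unfolding LF_def using indep_var_distribution_eq by blast
  define g where "g = (\<lambda>v. \<lambda>i\<in>{..<N}. v (time i) :: real)"
  have g [measurable]: "g \<in> PiM pres (\<lambda>_. borel) \<rightarrow>\<^sub>M Z"
    unfolding g_def
    by (intro measurable_restrict measurable_component_singleton) (auto simp: pres_def time_def N_def)
  have V [measurable]: "V \<in> M \<rightarrow>\<^sub>M PiM pres (\<lambda>_. borel)"
    unfolding V_def by (rule measurable_restrict) measurable
  have gV: "g (V \<omega>) = W \<omega>" for \<omega>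
    unfolding g_def V_def W_def by (auto simp: restrict_def pres_def time_def N_def)
  have Q: "distr (distr M (PiM pres (\<lambda>_. borel)) V) Z g = Q"
    using distr_distr[OF g V] by (simp add: comp_def gV W_law)
  have id: "distr LF S (\<lambda>y. y) = LF" by (rule distr_id2) (simp add: LF_def)
  have "distr M (S \<Otimes>\<^sub>M Z) (\<lambda>\<omega>. (F \<omega>, W \<omega>)) = distr (LF \<Otimes>\<^sub>M distr M (PiM pres (\<lambda>_. borel)) V) (S \<Otimes>\<^sub>M Z) (\<lambda>(y, v). (y, g v))"
    unfolding joint by (subst distr_distr) (auto simp: comp_def gV)
  also have "\<dots> = distr LF S (\<lambda>y. y) \<Otimes>\<^sub>M distr (distr M (PiM pres (\<lambda>_. borel)) V) Z g"
  proof (rule pair_measure_distr[symmetric])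
    show "(\<lambda>y. y) \<in> LF \<rightarrow>\<^sub>M S" by (rule measurable_ident_sets) (simp add: LF_def)
    show "sigma_finite_measure (distr (distr M (PiM pres (\<lambda>_. borel)) V) Z g)"
      unfolding Q by (intro prob_space_imp_sigma_finite prob_space_PiM prob_space_gauss sigma)
  qed simp
  finally show ?thesis unfolding id Q .
qed

lemma U_adapted: "adapted (U y)"
  unfolding adapted_def
proof (intro conjI allI impI)
  fix k :: nat and z z' :: "nat \<Rightarrow> real" assume "\<forall>i<k. z i = z' i"
  then show "U y k z = U y k z'" unfolding U_def by (intro sum.cong refl) auto
next
  fix k N' :: nat assume kN: "k \<le> N'"
  have "(\<lambda>z. if k < l then y (time k - int l) else z (k - l)) \<in> borel_measurable (PiM {..<N'} (\<lambda>_. borel))" if "l \<in> {1..p}" for l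
  proof (cases "k < l")
    case False
    then have "k - l \<in> {..<N'}" using that kN by auto
    then show ?thesis using False by (simp add: measurable_component_singleton)
  qed simp
  then show "U y k \<in> borel_measurable (PiM {..<N'} (\<lambda>_. borel))"
    unfolding U_def[abs_def] by (intro borel_measurable_sum borel_measurable_times borel_measurable_const)
qed

lemma U_meas_gen:
  assumes "i \<le> m" "i < N" and A: "A \<in> L \<rightarrow>\<^sub>M S" and B: "B \<in> L \<rightarrow>\<^sub>M PiM {..<m} (\<lambda>_. borel)"
  shows "(\<lambda>e. U (A e) i (B e)) \<in> borel_measurable L"
proof -
  have "(\<lambda>e. if i < l then A e (time i - int l) else B e (i - l)) \<in> borel_measurable L" if "l \<in> {1..p}" for l
  proof (cases "i < l")
    case True
    then have "time i - int l \<in> past" by (simp add: time_def past_def)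
    then show ?thesis using True measurable_compose[OF A measurable_component_singleton] by simp
  next
    case False
    then have "i - l \<in> {..<m}" using that assms(1) by auto
    then show ?thesis using False measurable_compose[OF B measurable_component_singleton] by simp
  qed
  then show ?thesis
    unfolding U_def by (intro borel_measurable_sum borel_measurable_times borel_measurable_const)
qed

lemma drift_U_meas: "m \<le> N \<Longrightarrow> (\<lambda>yv. drift (U (fst yv)) m (snd yv)) \<in> S \<Otimes>\<^sub>M Z \<rightarrow>\<^sub>M PiM {..<m} (\<lambda>_. borel)"
proof (induction m)
  case 0
  show ?case by (rule measurable_PiM_single') auto
next
  case (Suc m)
  then have m: "m < N" and IH: "(\<lambda>yv. drift (U (fst yv)) m (snd yv)) \<in> S \<Otimes>\<^sub>M Z \<rightarrow>\<^sub>M PiM {..<m} (\<lambda>_. borel)" by auto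
  have c: "(\<lambda>yv. snd yv m) \<in> borel_measurable (S \<Otimes>\<^sub>M Z)"
    by (rule measurable_compose[OF measurable_snd measurable_component_singleton]) (use m in auto)
  show ?case
    unfolding drift.simps
  proof (rule measurable_fun_upd[where J = "{..<m}"])
    show "{..<Suc m} = {..<m} \<union> {m}" by auto
    show "(\<lambda>yv. snd yv m + U (fst yv) m (drift (U (fst yv)) m (snd yv))) \<in> borel_measurable (S \<Otimes>\<^sub>M Z)"
      by (intro borel_measurable_add c U_meas_gen[OF _ m _ IH] measurable_fst) auto
  qed (rule IH)
qed

lemma X_AE: "AE \<omega> in M. X \<omega> = drift (U (F \<omega>)) N (W \<omega>) \<and> (\<forall>i<N. U (F \<omega>) i (X \<omega>) = reg (time i) \<omega>)"
  using F_AE ar_eq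
proof eventually_elim
  case (elim \<omega>)
  have U: "U (F \<omega>) i (X \<omega>) = reg (time i) \<omega>" if i: "i < N" for i
    unfolding U_def reg_def
  proof (intro sum.cong refl arg_cong2[where f = "(*)"])
    fix l assume l: "l \<in> {1..p}"
    show "(if i < l then F \<omega> (time i - int l) else X \<omega> (i - l)) = x (time i - int l) \<omega>"
    proof (cases "i < l")
      case True
      then have "time i - int l \<in> past" by (simp add: time_def past_def)
      then show ?thesis using True elim(1) by simp
    next
      case False
      then have "time (i - l) = time i - int l" by (simp add: time_def of_nat_diff)
      moreover have "i - l < N" using i by simp
      ultimately show ?thesis using False by (simp add: X_def)
    qed
  qed
  have "drift (U (F \<omega>)) N (W \<omega>) = X \<omega>"
  proof (rule drift_eqI[OF U_adapted])
    fix i assume i: "i < N"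
    have "x (time i) \<omega> = reg (time i) \<omega> + w (time i) \<omega>"
      unfolding reg_def by (rule spec[OF elim(2)])
    then show "X \<omega> i = W \<omega> i + U (F \<omega>) i (X \<omega>)"
      unfolding U[OF i] using i by (simp add: X_def W_def)
  qed (simp add: X_def)
  then show ?case using U by auto
qed

lemma sets_LF [measurable_cong]: "sets LF = sets S" by (simp add: LF_def)

lemma prob_LF: "prob_space LF" unfolding LF_def by (rule prob_space_distr) measurable

lemma prob_Q: "prob_space Q" by (intro prob_space_PiM prob_space_gauss sigma)

text \<open>Given the past, the innovations of the observations are still independent Gaussians. The
  observations arise from them by an adapted drift, so the change of measure can be applied for each
  fixed past.\<close>

lemma law_density:
  assumes \<Phi>: "\<Phi> \<in> borel_measurable (S \<Otimes>\<^sub>M Z)"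
  shows "(\<integral>\<^sup>+\<omega>. \<Phi> (F \<omega>, X \<omega>) \<partial>M) = (\<integral>\<^sup>+y. \<integral>\<^sup>+z. \<Phi> (y, z) * (\<Prod>i<N. ennreal (lr \<sigma> (z i) (U y i z))) \<partial>Q \<partial>LF)"
proof -
  let ?D = "\<lambda>yv. \<Phi> (fst yv, drift (U (fst yv)) N (snd yv))"
  have D: "?D \<in> borel_measurable (S \<Otimes>\<^sub>M Z)"
    by (rule measurable_compose[OF _ \<Phi>]) (intro measurable_Pair measurable_fst drift_U_meas order_refl)
  then have D': "?D \<in> borel_measurable (LF \<Otimes>\<^sub>M Q)"
    by (subst measurable_cong_sets[OF sets_pair_measure_cong[OF sets_LF sets_PiM_gauss] refl])
  have FW: "(\<lambda>\<omega>. (F \<omega>, W \<omega>)) \<in> M \<rightarrow>\<^sub>M S \<Otimes>\<^sub>M Z" by measurable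
  have "(\<integral>\<^sup>+\<omega>. \<Phi> (F \<omega>, X \<omega>) \<partial>M) = (\<integral>\<^sup>+\<omega>. ?D (F \<omega>, W \<omega>) \<partial>M)"
    using X_AE by (intro nn_integral_cong_AE) auto
  also have "\<dots> = (\<integral>\<^sup>+yv. ?D yv \<partial>distr M (S \<Otimes>\<^sub>M Z) (\<lambda>\<omega>. (F \<omega>, W \<omega>)))"
    using D by (subst nn_integral_distr[OF FW]) simp_all
  also have "\<dots> = (\<integral>\<^sup>+y. \<integral>\<^sup>+v. ?D (y, v) \<partial>Q \<partial>LF)"
    unfolding F_W_law
    by (rule sigma_finite_measure.nn_integral_fst[OF prob_space_imp_sigma_finite[OF prob_Q] D', symmetric])
  also have "\<dots> = (\<integral>\<^sup>+y. \<integral>\<^sup>+z. \<Phi> (y, z) * (\<Prod>i<N. ennreal (lr \<sigma> (z i) (U y i z))) \<partial>Q \<partial>LF)"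
  proof (rule nn_integral_cong)
    fix y assume "y \<in> space LF"
    then have y: "y \<in> space S" by (simp add: LF_def)
    have "(\<lambda>z. \<Phi> (y, z)) \<in> borel_measurable Z"
      by (rule measurable_compose[OF measurable_Pair1'[OF y] \<Phi>])
    from gauss_change_of_measure[OF sigma U_adapted this]
    show "(\<integral>\<^sup>+v. ?D (y, v) \<partial>Q) = (\<integral>\<^sup>+z. \<Phi> (y, z) * (\<Prod>i<N. ennreal (lr \<sigma> (z i) (U y i z))) \<partial>Q)"
      by simp
  qed
  finally show ?thesis .
qed

lemma lr_prod_integral: "adapted u \<Longrightarrow> (\<integral>\<^sup>+z. (\<Prod>i<N. ennreal (lr \<sigma> (z i) (u i z))) \<partial>Q) = 1"
  using gauss_change_of_measure[OF sigma, of u "\<lambda>_. 1" N] prob_space.emeasure_space_1[OF prob_Q]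
  by simp

text \<open>Exchanging the sums over lags and over the moving average leaves, with total weight
  \<open>1 / \<eta>\<close>, linear forms in distinct innovations whose variance is
  explicit.\<close>

lemma reg_second_moment: "(\<integral>\<^sup>+\<omega>. ennreal ((reg k \<omega>)\<^sup>2) \<partial>M) \<le> ennreal ((1 / \<eta>)\<^sup>2 * (\<sigma>\<^sup>2 * (\<Sum>l = 1..p. (\<theta> l)\<^sup>2)))"
proof (rule nn_integral_lim_le[where X = "\<lambda>m \<omega>. \<Sum>l = 1..p. \<theta> l * ma m (k - int l) \<omega>" and f = "\<lambda>t. t\<^sup>2"])
  show "AE \<omega> in M. (\<lambda>m. \<Sum>l = 1..p. \<theta> l * ma m (k - int l) \<omega>) \<longlonglongrightarrow> reg k \<omega>"
    unfolding reg_def using ma_tendsto by eventually_elim (intro tendsto_intros, auto)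
  fix m
  have eq: "(\<Sum>l = 1..p. \<theta> l * ma m (k - int l) \<omega>) = (\<Sum>a<m. psi a * (\<Sum>l = 1..p. \<theta> l * w (k - int l - int a) \<omega>))" for \<omega>
    unfolding sum_distrib_left by (subst sum.swap) (simp add: mult_ac)
  show "(\<integral>\<^sup>+\<omega>. ennreal ((\<Sum>l = 1..p. \<theta> l * ma m (k - int l) \<omega>)\<^sup>2) \<partial>M) \<le> ennreal ((1 / \<eta>)\<^sup>2 * (\<sigma>\<^sup>2 * (\<Sum>l = 1..p. (\<theta> l)\<^sup>2)))"
    unfolding eq
  proof (rule nn_integral_square_sum_le[OF psi_sum])
    fix a
    have inj: "inj_on (\<lambda>l. k - int l - int a) {1..p}" by (auto simp: inj_on_def)
    show "(\<integral>\<^sup>+\<omega>. ennreal ((\<Sum>l = 1..p. \<theta> l * w (k - int l - int a) \<omega>)\<^sup>2) \<partial>M) \<le> ennreal (\<sigma>\<^sup>2 * (\<Sum>l = 1..p. (\<theta> l)\<^sup>2))"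
      using w_lin_sq_expectation[OF _ inj, of \<theta>] by (subst nn_integral_eq_integral) auto
  qed (auto intro!: mult_nonneg_nonneg sum_nonneg)
qed (auto intro!: continuous_intros)

lemma w_lin_mgf:
  assumes "finite I" "inj_on f I"
  shows "(\<integral>\<^sup>+\<omega>. ennreal (exp (\<kappa> * (\<Sum>i\<in>I. b i * w (f i) \<omega>))) \<partial>M) = ennreal (exp (\<kappa>\<^sup>2 * \<sigma>\<^sup>2 * (\<Sum>i\<in>I. (b i)\<^sup>2) / 2))"
proof -
  have one: "(\<integral>\<^sup>+\<omega>. ennreal (exp (t * w k \<omega>)) \<partial>M) = ennreal (exp (\<sigma>\<^sup>2 * t\<^sup>2 / 2))" for t k
  proof -
    have m: "(\<lambda>z. ennreal (exp (t * z))) \<in> borel_measurable borel" by measurable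
    show ?thesis
      unfolding gauss_mgf[OF sigma, symmetric] w_gauss[of k, symmetric] using m
      by (subst nn_integral_distr[OF w_meas]) simp_all
  qed
  have ind: "indep_vars (\<lambda>_. borel) (\<lambda>i \<omega>. ennreal (exp (\<kappa> * b i * w (f i) \<omega>))) I"
    by (rule indep_vars_compose2[OF w_reindex_indep[OF assms(2)]]) measurable
  have "(\<integral>\<^sup>+\<omega>. ennreal (exp (\<kappa> * (\<Sum>i\<in>I. b i * w (f i) \<omega>))) \<partial>M) = (\<integral>\<^sup>+\<omega>. (\<Prod>i\<in>I. ennreal (exp (\<kappa> * b i * w (f i) \<omega>))) \<partial>M)"
    using assms(1) by (intro nn_integral_cong) (simp add: sum_distrib_left exp_sum prod_ennreal mult.assoc)
  also have "\<dots> = (\<Prod>i\<in>I. ennreal (exp (\<sigma>\<^sup>2 * (\<kappa> * b i)\<^sup>2 / 2)))"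
    using indep_vars_nn_integral[OF assms(1) ind] by (simp add: one)
  also have "\<dots> = ennreal (exp (\<Sum>i\<in>I. \<sigma>\<^sup>2 * (\<kappa> * b i)\<^sup>2 / 2))"
    using assms(1) by (simp add: prod_ennreal exp_sum)
  also have "(\<Sum>i\<in>I. \<sigma>\<^sup>2 * (\<kappa> * b i)\<^sup>2 / 2) = \<kappa>\<^sup>2 * \<sigma>\<^sup>2 * (\<Sum>i\<in>I. (b i)\<^sup>2) / 2"
    by (simp add: power_mult_distrib sum_distrib_left sum_divide_distrib mult_ac)
  finally show ?thesis .
qed

text \<open>Here the lags join the weights of the convex combination: their total is
  \<open>l1_norm p \<theta> / \<eta>\<close>, and the remaining linear forms in the innovations have
  squared coefficients \<open>(b i)\<^sup>2\<close>. The squared 1-norm thus enters the exponent,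
  which makes the early observations nearly uninformative.\<close>

lemma reg_mgf:
  assumes pos: "0 < l1_norm p \<theta>"
  shows "(\<integral>\<^sup>+\<omega>. ennreal (exp (\<Sum>i<m. b i * reg (time i) \<omega>)) \<partial>M)
     \<le> ennreal (exp ((l1_norm p \<theta> / \<eta>)\<^sup>2 * \<sigma>\<^sup>2 * (\<Sum>i<m. (b i)\<^sup>2) / 2))"
proof (rule nn_integral_lim_le[where X = "\<lambda>(r::nat) \<omega>. \<Sum>i<m. b i * (\<Sum>l = 1..p. \<theta> l * ma r (time i - int l) \<omega>)" and f = exp])
  show "AE \<omega> in M. (\<lambda>r. \<Sum>i<m. b i * (\<Sum>l = 1..p. \<theta> l * ma r (time i - int l) \<omega>)) \<longlonglongrightarrow> (\<Sum>i<m. b i * reg (time i) \<omega>)"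
    unfolding reg_def using ma_tendsto by eventually_elim (intro tendsto_intros, auto)
  fix r :: nat
  let ?I = "{1..p} \<times> {..<r}"
  let ?V = "\<lambda>la \<omega>. \<Sum>i<m. b i * w (time i - int (fst la) - int (snd la)) \<omega>"
  have eq: "(\<Sum>i<m. b i * (\<Sum>l = 1..p. \<theta> l * ma r (time i - int l) \<omega>)) = 1 * (\<Sum>la\<in>?I. (\<theta> (fst la) * psi (snd la)) * ?V la \<omega>)" for \<omega>
  proof -
    have "(\<Sum>i<m. b i * (\<Sum>l = 1..p. \<theta> l * ma r (time i - int l) \<omega>))
       = (\<Sum>i<m. \<Sum>la\<in>?I. (\<theta> (fst la) * psi (snd la)) * (b i * w (time i - int (fst la) - int (snd la)) \<omega>))"
      unfolding sum_distrib_left sum.cartesian_product by (intro sum.cong refl) (auto simp: mult_ac)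
    also have "\<dots> = (\<Sum>la\<in>?I. (\<theta> (fst la) * psi (snd la)) * ?V la \<omega>)"
      unfolding sum_distrib_left by (rule sum.swap)
    finally show ?thesis by simp
  qed
  have weights: "(\<Sum>la\<in>?I. \<bar>\<theta> (fst la) * psi (snd la)\<bar>) \<le> l1_norm p \<theta> / \<eta>"
  proof -
    have "(\<Sum>la\<in>?I. \<bar>\<theta> (fst la) * psi (snd la)\<bar>) = l1_norm p \<theta> * (\<Sum>a<r. \<bar>psi a\<bar>)"
      by (simp add: l1_norm_def sum_product sum.cartesian_product abs_mult split_beta)
    also have "\<dots> \<le> l1_norm p \<theta> * (1 / \<eta>)"
      using pos psi_sum by (intro mult_left_mono) auto
    finally show ?thesis by simp
  qed
  have inj: "inj_on (\<lambda>i. time i - int (fst la) - int (snd la)) {..<m}" for la :: "nat \<times> nat"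
    by (auto simp: inj_on_def time_def)
  show "(\<integral>\<^sup>+\<omega>. ennreal (exp (\<Sum>i<m. b i * (\<Sum>l = 1..p. \<theta> l * ma r (time i - int l) \<omega>))) \<partial>M)
     \<le> ennreal (exp ((l1_norm p \<theta> / \<eta>)\<^sup>2 * \<sigma>\<^sup>2 * (\<Sum>i<m. (b i)\<^sup>2) / 2))"
    unfolding eq
  proof (rule nn_integral_exp_sum_le[OF weights])
    show "0 < l1_norm p \<theta> / \<eta>" using pos eta by simp
    show "1 \<le> exp ((l1_norm p \<theta> / \<eta>)\<^sup>2 * \<sigma>\<^sup>2 * (\<Sum>i<m. (b i)\<^sup>2) / 2)"
      by (simp add: sum_nonneg)
    show "(\<integral>\<^sup>+\<omega>. ennreal (exp (1 * (l1_norm p \<theta> / \<eta>) * ?V la \<omega>)) \<partial>M) \<le> ennreal (exp ((l1_norm p \<theta> / \<eta>)\<^sup>2 * \<sigma>\<^sup>2 * (\<Sum>i<m. (b i)\<^sup>2) / 2))" for la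
      by (subst w_lin_mgf[OF _ inj]) simp_all
    show "(\<integral>\<^sup>+\<omega>. ennreal (exp (- 1 * (l1_norm p \<theta> / \<eta>) * ?V la \<omega>)) \<partial>M) \<le> ennreal (exp ((l1_norm p \<theta> / \<eta>)\<^sup>2 * \<sigma>\<^sup>2 * (\<Sum>i<m. (b i)\<^sup>2) / 2))" for la
      by (subst w_lin_mgf[OF _ inj]) simp_all
  qed measurable
qed (auto intro!: continuous_intros)

end

lemma adapted_scale: "adapted u \<Longrightarrow> adapted (\<lambda>k z. a k * u k z)"
  unfolding adapted_def by (auto intro: borel_measurable_times)

lemma adapted_const: "adapted (\<lambda>k z. a k)"
  unfolding adapted_def by auto

lemma lr_zero [simp]: "lr \<sigma> z 0 = 1"
  by (simp add: lr_def)

lemma lr_nonneg [simp]: "0 \<le> lr \<sigma> z u"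
  by (simp add: lr_def)

text \<open>The interaction factor is what remains of a product of two likelihoods after integration
  over white noise.\<close>

lemma lr_mult: "lr \<sigma> z a * lr \<sigma> z b = lr \<sigma> z (a + b) * exp (a * b / \<sigma>\<^sup>2)"
  unfolding lr_def exp_add[symmetric] by (cases "\<sigma> = 0") (simp_all add: field_simps power2_eq_square)

text \<open>The first factor thus has expectation 1 under the drifted law, which yields an
  exponential tail bound for the log-likelihood.\<close>

lemma lr_double: "exp ((z * a - 3 / 2 * a\<^sup>2) / \<sigma>\<^sup>2) * lr \<sigma> z a = lr \<sigma> z (2 * a)"
  unfolding lr_def exp_add[symmetric] by (cases "\<sigma> = 0") (simp_all add: field_simps power2_eq_square)

section \<open>Early observations, late observations, and the probability of a hit\<close>

context ar_gauss begin

text \<open>The drift of an early observation. The zero vector is a dummy: for \<open>i < q\<close>,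
  every lag that could reach an observed value has coefficient 0.\<close>

definition V :: "(int \<Rightarrow> real) \<Rightarrow> nat \<Rightarrow> real" where "V y i = U y i (\<lambda>_. 0)"

lemma q_le_N: "q \<le> N" using n_p by (simp add: q_def N_def)

lemma U_V: "i < q \<Longrightarrow> U y i z = V y i"
  unfolding U_def V_def using long_lags by (intro sum.cong refl) (auto simp: q_def)

definition energy :: "(int \<Rightarrow> real) \<Rightarrow> real" where "energy y = (\<Sum>i<q. (V y i)\<^sup>2)"

definition early :: "(int \<Rightarrow> real) \<Rightarrow> (nat \<Rightarrow> real) \<Rightarrow> ennreal" where
  "early y z = (\<Prod>i<q. ennreal (lr \<sigma> (z i) (V y i)))"

definition late :: "(int \<Rightarrow> real) \<Rightarrow> (nat \<Rightarrow> real) \<Rightarrow> real" where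
  "late y z = (\<Prod>i\<in>{q..<N}. lr \<sigma> (z i) (U y i z))"

lemma prod_split: "(\<Prod>i<N. f i) = (\<Prod>i<q. f i) * (\<Prod>i\<in>{q..<N}. f i)" for f :: "nat \<Rightarrow> ennreal"
proof -
  have "{..<q} \<union> {q..<N} = {..<N}" using q_le_N by auto
  moreover have "(\<Prod>i\<in>{..<q} \<union> {q..<N}. f i) = (\<Prod>i<q. f i) * (\<Prod>i\<in>{q..<N}. f i)"
    by (rule prod.union_disjoint) auto
  ultimately show ?thesis by (simp only:)
qed

lemma density_split: "(\<Prod>i<N. ennreal (lr \<sigma> (z i) (U y i z))) = early y z * ennreal (late y z)"
proof -
  have "(\<Prod>i<N. ennreal (lr \<sigma> (z i) (U y i z)))
      = (\<Prod>i<q. ennreal (lr \<sigma> (z i) (U y i z))) * (\<Prod>i\<in>{q..<N}. ennreal (lr \<sigma> (z i) (U y i z)))"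
    by (rule prod_split)
  also have "(\<Prod>i<q. ennreal (lr \<sigma> (z i) (U y i z))) = early y z"
    unfolding early_def by (intro prod.cong refl) (simp add: U_V)
  also have "(\<Prod>i\<in>{q..<N}. ennreal (lr \<sigma> (z i) (U y i z))) = ennreal (late y z)"
    unfolding late_def by (rule prod_ennreal) (simp add: lr_def)
  finally show ?thesis .
qed

lemma z_meas: "i < N \<Longrightarrow> (\<lambda>yz. snd yz i) \<in> borel_measurable (S \<Otimes>\<^sub>M Z)"
  by (rule measurable_compose[OF measurable_snd measurable_component_singleton]) simp

lemma U_meas: "i < N \<Longrightarrow> (\<lambda>yz. U (fst yz) i (snd yz)) \<in> borel_measurable (S \<Otimes>\<^sub>M Z)"
  by (rule U_meas_gen[where A = fst and B = snd and m = N]) (simp_all only: less_imp_le measurable_fst measurable_snd)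

lemma V_meas: "i < q \<Longrightarrow> (\<lambda>y. V y i) \<in> borel_measurable S"
  unfolding V_def
proof -
  assume "i < q"
  then have i: "i < N" using q_le_N by simp
  have "(\<lambda>y. U (id y) i ((\<lambda>_. (\<lambda>_\<in>{..<N}. 0)) y)) \<in> borel_measurable S"
    by (rule U_meas_gen[OF less_imp_le[OF i] i]) (auto intro!: measurable_restrict)
  moreover have "U y i (\<lambda>_\<in>{..<N}. 0) = U y i (\<lambda>_. 0)" for y
    by (rule adaptedD[OF U_adapted]) (use i in auto)
  ultimately show "(\<lambda>y. U y i (\<lambda>_. 0)) \<in> borel_measurable S" by simp
qed

lemma energy_meas: "energy \<in> borel_measurable S"
  unfolding energy_def[abs_def] by (intro borel_measurable_sum borel_measurable_power V_meas) auto

lemma late_meas: "(\<lambda>yz. late (fst yz) (snd yz)) \<in> borel_measurable (S \<Otimes>\<^sub>M Z)"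
  unfolding late_def by (intro borel_measurable_prod lr_meas z_meas U_meas) auto

lemma early_meas: "(\<lambda>yz. early (fst yz) (snd yz)) \<in> borel_measurable (S \<Otimes>\<^sub>M Z)"
  unfolding early_def using q_le_N
  by (intro borel_measurable_prod_ennreal measurable_compose[OF _ measurable_ennreal] lr_meas z_meas
      measurable_compose[OF measurable_fst V_meas]) auto

text \<open>The second moment of the density of the early observations, relative to white noise, is a
  Gaussian interaction of two independent pasts; restricting to pasts of small energy keeps it
  bounded.\<close>

definition kern :: "real \<Rightarrow> (int \<Rightarrow> real) \<Rightarrow> (nat \<Rightarrow> real) \<Rightarrow> ennreal" where
  "kern R y z = indicator {y. energy y \<le> R} y * early y z"

lemma kern_meas: "(\<lambda>yz. kern R (fst yz) (snd yz)) \<in> borel_measurable (S \<Otimes>\<^sub>M Z)"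
proof -
  have "{y \<in> space S. energy y \<le> R} \<in> sets S"
    using energy_meas by measurable
  then have "(\<lambda>y. indicator {y. energy y \<le> R} y :: ennreal) \<in> borel_measurable S"
    by (subst borel_measurable_indicator_iff) (auto simp: Int_def conj_commute)
  then show ?thesis
    unfolding kern_def by (intro borel_measurable_times_ennreal early_meas measurable_compose[OF measurable_fst])
qed

text \<open>Integrating over white noise leaves the exponential of the inner product of two drifts.
  For fixed \<open>y'\<close> this is a linear form in the regressions of an independent past, and
  its moment generating function is controlled by the energy of \<open>y'\<close>.\<close>

lemma kern_overlap:
  assumes pos: "0 < l1_norm p \<theta>" and y': "y' \<in> space S" and R: "0 \<le> R"
  shows "(\<integral>\<^sup>+y. \<integral>\<^sup>+z. kern R y z * kern R y' z \<partial>Q \<partial>LF) \<le> ennreal (exp ((l1_norm p \<theta>)\<^sup>2 * R / (2 * \<eta>\<^sup>2 * \<sigma>\<^sup>2)))"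
proof (cases "energy y' \<le> R")
  case False
  then show ?thesis by (simp add: kern_def)
next
  case True
  have inner: "(\<integral>\<^sup>+z. early y z * early y' z \<partial>Q) = ennreal (exp (\<Sum>i<q. V y i * V y' i / \<sigma>\<^sup>2))" for y
  proof -
    \<comment> \<open>The drift is extended by 0 to the late coordinates, whose likelihood factors
      are then 1, so that the product integrates to 1.\<close>
    let ?b = "\<lambda>i. if i < q then V y i + V y' i else 0"
    have bm: "(\<lambda>z. \<Prod>i<N. ennreal (lr \<sigma> (z i) (?b i))) \<in> borel_measurable Q"
    proof (intro borel_measurable_prod_ennreal measurable_compose[OF _ measurable_ennreal] lr_meas borel_measurable_const)
      fix i assume "i \<in> {..<N}"
      then have "(\<lambda>z. z i) \<in> borel_measurable Z" by (rule measurable_component_singleton)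
      then show "(\<lambda>z. z i) \<in> borel_measurable Q" by (subst measurable_cong_sets[OF sets_PiM_gauss refl])
    qed
    have "early y z * early y' z = ennreal (exp (\<Sum>i<q. V y i * V y' i / \<sigma>\<^sup>2)) * (\<Prod>i<N. ennreal (lr \<sigma> (z i) (?b i)))" for z
    proof -
      have "early y z * early y' z = (\<Prod>i<q. ennreal (exp (V y i * V y' i / \<sigma>\<^sup>2)) * ennreal (lr \<sigma> (z i) (V y i + V y' i)))"
        unfolding early_def prod.distrib[symmetric]
        by (intro prod.cong refl) (simp add: ennreal_mult'[symmetric] lr_mult mult.commute add.commute)
      also have "\<dots> = ennreal (exp (\<Sum>i<q. V y i * V y' i / \<sigma>\<^sup>2)) * (\<Prod>i<q. ennreal (lr \<sigma> (z i) (V y i + V y' i)))"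
        unfolding prod.distrib by (simp add: prod_ennreal exp_sum)
      also have "(\<Prod>i<q. ennreal (lr \<sigma> (z i) (V y i + V y' i))) = (\<Prod>i<N. ennreal (lr \<sigma> (z i) (?b i)))"
        using q_le_N by (intro prod.mono_neutral_cong_left) auto
      finally show ?thesis .
    qed
    then show ?thesis
      using lr_prod_integral[OF adapted_const[of ?b]] by (simp add: nn_integral_cmult[OF bm])
  qed
  define b where "b i = V y' i / \<sigma>\<^sup>2" for i
  have em: "(\<lambda>y. ennreal (exp (\<Sum>i<q. b i * V y i))) \<in> borel_measurable S"
    by (intro measurable_compose[OF _ measurable_ennreal] measurable_compose[OF _ borel_measurable_exp]
        borel_measurable_sum borel_measurable_times borel_measurable_const V_meas) auto
  have "(\<integral>\<^sup>+y. \<integral>\<^sup>+z. kern R y z * kern R y' z \<partial>Q \<partial>LF) \<le> (\<integral>\<^sup>+y. \<integral>\<^sup>+z. early y z * early y' z \<partial>Q \<partial>LF)"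
    by (intro nn_integral_mono mult_mono) (auto simp: kern_def indicator_def)
  also have "\<dots> = (\<integral>\<^sup>+y. ennreal (exp (\<Sum>i<q. b i * V y i)) \<partial>LF)"
    unfolding inner by (simp add: b_def mult.commute)
  also have "\<dots> = (\<integral>\<^sup>+\<omega>. ennreal (exp (\<Sum>i<q. b i * V (F \<omega>) i)) \<partial>M)"
    unfolding LF_def using em by (subst nn_integral_distr[OF F_meas]) simp_all
  also have "\<dots> = (\<integral>\<^sup>+\<omega>. ennreal (exp (\<Sum>i<q. b i * reg (time i) \<omega>)) \<partial>M)"
  proof (intro nn_integral_cong_AE)
    show "AE \<omega> in M. ennreal (exp (\<Sum>i<q. b i * V (F \<omega>) i)) = ennreal (exp (\<Sum>i<q. b i * reg (time i) \<omega>))"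
      using X_AE
    proof eventually_elim
      case (elim \<omega>)
      have "V (F \<omega>) i = reg (time i) \<omega>" if "i < q" for i
        using elim that q_le_N U_V[OF that, of "F \<omega>" "X \<omega>"] by auto
      then show ?case by simp
    qed
  qed
  also have "\<dots> \<le> ennreal (exp ((l1_norm p \<theta> / \<eta>)\<^sup>2 * \<sigma>\<^sup>2 * (\<Sum>i<q. (b i)\<^sup>2) / 2))"
    by (rule reg_mgf[OF pos])
  also have "\<dots> \<le> ennreal (exp ((l1_norm p \<theta>)\<^sup>2 * R / (2 * \<eta>\<^sup>2 * \<sigma>\<^sup>2)))"
  proof -
    have "(\<Sum>i<q. (b i)\<^sup>2) = energy y' / \<sigma> ^ 4"
      unfolding b_def energy_def by (simp add: power_divide sum_divide_distrib power_mult[symmetric])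
    then have "(l1_norm p \<theta> / \<eta>)\<^sup>2 * \<sigma>\<^sup>2 * (\<Sum>i<q. (b i)\<^sup>2) / 2 = (l1_norm p \<theta>)\<^sup>2 / (2 * \<eta>\<^sup>2 * \<sigma>\<^sup>2) * energy y'"
      using sigma eta by (simp add: field_simps power_divide power4_eq_xxxx power2_eq_square)
    also have "\<dots> \<le> (l1_norm p \<theta>)\<^sup>2 / (2 * \<eta>\<^sup>2 * \<sigma>\<^sup>2) * R"
      using True by (intro mult_left_mono) auto
    finally show ?thesis by (intro ennreal_leI) simp
  qed
  finally show ?thesis .
qed

text \<open>Let \<open>f\<close> be the truncated early likelihood averaged over the past. Where
  \<open>f\<close> is below \<open>\<tau>\<close> it contributes at most \<open>\<tau>\<close> times
  the measure of \<open>G\<close>; elsewhere it is at most \<open>f\<^sup>2 / \<tau>\<close>. The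
  integral of \<open>f\<^sup>2\<close> is the overlap of two independent pasts.\<close>

lemma early_bound:
  assumes pos: "0 < l1_norm p \<theta>" and R: "0 \<le> R" and G: "G \<in> sets Z" and \<tau>: "0 < \<tau>"
  shows "(\<integral>\<^sup>+y. \<integral>\<^sup>+z. indicator G z * kern R y z \<partial>Q \<partial>LF)
     \<le> ennreal \<tau> * emeasure Q G + ennreal (exp ((l1_norm p \<theta>)\<^sup>2 * R / (2 * \<eta>\<^sup>2 * \<sigma>\<^sup>2)) / \<tau>)"
proof -
  let ?c = "exp ((l1_norm p \<theta>)\<^sup>2 * R / (2 * \<eta>\<^sup>2 * \<sigma>\<^sup>2))"
  interpret LF: prob_space LF by (rule prob_LF)
  interpret Q: prob_space Q by (rule prob_Q)
  interpret LQ: pair_sigma_finite LF Q ..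
  interpret LL: pair_sigma_finite LF LF ..
  have cong: "borel_measurable (LF \<Otimes>\<^sub>M Q) = borel_measurable (S \<Otimes>\<^sub>M Z)"
    by (rule measurable_cong_sets[OF sets_pair_measure_cong[OF sets_LF sets_PiM_gauss] refl])
  have GQ: "G \<in> sets Q" using G by (simp add: sets_PiM_gauss)
  have k2: "(\<lambda>yz. kern R (fst yz) (snd yz)) \<in> borel_measurable (LF \<Otimes>\<^sub>M Q)"
    unfolding cong by (rule kern_meas)
  have kz: "(\<lambda>y. kern R y z) \<in> borel_measurable LF" if "z \<in> space Q" for z
    using measurable_compose[OF measurable_Pair2'[OF that] k2] by simp
  have ky: "(\<lambda>z. kern R y z) \<in> borel_measurable Q" if "y \<in> space LF" for y
    using measurable_compose[OF measurable_Pair1'[OF that] k2] by simp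
  define f where "f z = (\<integral>\<^sup>+y. kern R y z \<partial>LF)" for z
  have fm: "f \<in> borel_measurable Q"
  proof -
    have "(\<lambda>(z, y). kern R y z) \<in> borel_measurable (Q \<Otimes>\<^sub>M LF)"
      using measurable_compose[OF measurable_pair_swap' k2] by (simp add: split_beta')
    then show ?thesis unfolding f_def[abs_def] by (rule LF.borel_measurable_nn_integral)
  qed
  have "(\<integral>\<^sup>+y. \<integral>\<^sup>+z. indicator G z * kern R y z \<partial>Q \<partial>LF) = (\<integral>\<^sup>+z. \<integral>\<^sup>+y. indicator G z * kern R y z \<partial>LF \<partial>Q)"
  proof (rule LQ.Fubini'[symmetric])
    have "(\<lambda>yz. indicator G (snd yz) * kern R (fst yz) (snd yz)) \<in> borel_measurable (LF \<Otimes>\<^sub>M Q)"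
      using GQ by (intro borel_measurable_times_ennreal k2 measurable_compose[OF measurable_snd]) auto
    then show "(\<lambda>(y, z). indicator G z * kern R y z) \<in> borel_measurable (LF \<Otimes>\<^sub>M Q)"
      by (simp add: split_beta')
  qed
  also have "\<dots> = (\<integral>\<^sup>+z. indicator G z * f z \<partial>Q)"
    unfolding f_def by (intro nn_integral_cong nn_integral_cmult kz)
  also have "\<dots> \<le> (\<integral>\<^sup>+z. ennreal \<tau> * indicator G z + ennreal (1 / \<tau>) * (f z * f z) \<partial>Q)"
  proof (intro nn_integral_mono)
    fix z
    show "indicator G z * f z \<le> ennreal \<tau> * indicator G z + ennreal (1 / \<tau>) * (f z * f z)"
    proof (cases "z \<in> G \<and> ennreal \<tau> \<le> f z")
      case True
      have "ennreal (1 / \<tau>) * (ennreal \<tau> * f z) = f z"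
        using \<tau> by (simp add: mult.assoc[symmetric] ennreal_mult'[symmetric])
      moreover have "ennreal (1 / \<tau>) * (ennreal \<tau> * f z) \<le> ennreal (1 / \<tau>) * (f z * f z)"
        using True by (intro mult_left_mono mult_right_mono) auto
      ultimately have "f z \<le> ennreal (1 / \<tau>) * (f z * f z)" by simp
      then have "f z \<le> ennreal \<tau> + ennreal (1 / \<tau>) * (f z * f z)"
        by (rule add_increasing[OF zero_le])
      then show ?thesis using True by simp
    next
      case False
      then have "indicator G z * f z \<le> ennreal \<tau> * indicator G z"
        by (auto simp: indicator_def not_le)
      then show ?thesis by (rule order_trans) simp
    qed
  qed
  also have "\<dots> = ennreal \<tau> * emeasure Q G + ennreal (1 / \<tau>) * (\<integral>\<^sup>+z. f z * f z \<partial>Q)"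
    using GQ fm by (subst nn_integral_add) (auto simp: nn_integral_cmult nn_integral_cmult_indicator)
  also have "(\<integral>\<^sup>+z. f z * f z \<partial>Q) \<le> ennreal ?c"
  proof -
    have "(\<integral>\<^sup>+z. f z * f z \<partial>Q) = (\<integral>\<^sup>+z. \<integral>\<^sup>+y'. f z * kern R y' z \<partial>LF \<partial>Q)"
      by (intro nn_integral_cong) (subst nn_integral_cmult[OF kz], auto simp: f_def)
    also have "\<dots> = (\<integral>\<^sup>+y'. \<integral>\<^sup>+z. f z * kern R y' z \<partial>Q \<partial>LF)"
    proof (rule LQ.Fubini')
      have "(\<lambda>yz. f (snd yz) * kern R (fst yz) (snd yz)) \<in> borel_measurable (LF \<Otimes>\<^sub>M Q)"
        by (intro borel_measurable_times_ennreal k2 measurable_compose[OF measurable_snd fm])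
      then show "(\<lambda>(y, z). f z * kern R y z) \<in> borel_measurable (LF \<Otimes>\<^sub>M Q)"
        by (simp add: split_beta')
    qed
    also have "\<dots> = (\<integral>\<^sup>+y'. \<integral>\<^sup>+y. \<integral>\<^sup>+z. kern R y z * kern R y' z \<partial>Q \<partial>LF \<partial>LF)"
    proof (rule nn_integral_cong)
      fix y' assume y': "y' \<in> space LF"
      have "(\<integral>\<^sup>+z. f z * kern R y' z \<partial>Q) = (\<integral>\<^sup>+z. \<integral>\<^sup>+y. kern R y z * kern R y' z \<partial>LF \<partial>Q)"
        unfolding f_def by (intro nn_integral_cong nn_integral_multc[symmetric] kz)
      also have "\<dots> = (\<integral>\<^sup>+y. \<integral>\<^sup>+z. kern R y z * kern R y' z \<partial>Q \<partial>LF)"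
      proof (rule LQ.Fubini')
        have "(\<lambda>yz. kern R (fst yz) (snd yz) * kern R y' (snd yz)) \<in> borel_measurable (LF \<Otimes>\<^sub>M Q)"
          by (intro borel_measurable_times_ennreal k2 measurable_compose[OF measurable_snd ky[OF y']])
        then show "(\<lambda>(y, z). kern R y z * kern R y' z) \<in> borel_measurable (LF \<Otimes>\<^sub>M Q)"
          by (simp add: split_beta')
      qed
      finally show "(\<integral>\<^sup>+z. f z * kern R y' z \<partial>Q) = (\<integral>\<^sup>+y. \<integral>\<^sup>+z. kern R y z * kern R y' z \<partial>Q \<partial>LF)" .
    qed
    also have "\<dots> \<le> (\<integral>\<^sup>+y'. ennreal ?c \<partial>LF)"
      by (intro nn_integral_mono kern_overlap[OF pos _ R]) (simp add: LF_def)
    also have "\<dots> = ennreal ?c" by (simp add: LF.emeasure_space_1)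
    finally show ?thesis .
  qed
  then have "ennreal \<tau> * emeasure Q G + ennreal (1 / \<tau>) * (\<integral>\<^sup>+z. f z * f z \<partial>Q) \<le> ennreal \<tau> * emeasure Q G + ennreal (1 / \<tau>) * ennreal ?c"
    by (intro add_left_mono mult_left_mono) auto
  also have "ennreal (1 / \<tau>) * ennreal ?c = ennreal (?c / \<tau>)"
    using \<tau> by (simp add: ennreal_mult'[symmetric])
  finally show ?thesis .
qed

lemma reg_markov:
  assumes "0 < R" and I: "I \<subseteq> {..<N}" "real (card I) \<le> m"
  shows "(\<integral>\<^sup>+\<omega>. indicator {\<omega>. R < (\<Sum>i\<in>I. (reg (time i) \<omega>)\<^sup>2)} \<omega> \<partial>M)
     \<le> ennreal (m * ((1 / \<eta>)\<^sup>2 * (\<sigma>\<^sup>2 * (\<Sum>l = 1..p. (\<theta> l)\<^sup>2))) / R)"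
proof -
  let ?v = "(1 / \<eta>)\<^sup>2 * (\<sigma>\<^sup>2 * (\<Sum>l = 1..p. (\<theta> l)\<^sup>2))"
  have v0: "0 \<le> ?v" by (simp add: sum_nonneg)
  have "(\<integral>\<^sup>+\<omega>. indicator {\<omega>. R < (\<Sum>i\<in>I. (reg (time i) \<omega>)\<^sup>2)} \<omega> \<partial>M)
     \<le> (\<integral>\<^sup>+\<omega>. ennreal (1 / R) * (\<Sum>i\<in>I. ennreal ((reg (time i) \<omega>)\<^sup>2)) \<partial>M)"
  proof (intro nn_integral_mono)
    fix \<omega>
    have "1 \<le> 1 / R * (\<Sum>i\<in>I. (reg (time i) \<omega>)\<^sup>2)" if "R < (\<Sum>i\<in>I. (reg (time i) \<omega>)\<^sup>2)"
      using that assms(1) by (simp add: field_simps)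
    then have "1 \<le> ennreal (1 / R * (\<Sum>i\<in>I. (reg (time i) \<omega>)\<^sup>2))" if "R < (\<Sum>i\<in>I. (reg (time i) \<omega>)\<^sup>2)"
      using that ennreal_leI by fastforce
    then show "indicator {\<omega>. R < (\<Sum>i\<in>I. (reg (time i) \<omega>)\<^sup>2)} \<omega> \<le> ennreal (1 / R) * (\<Sum>i\<in>I. ennreal ((reg (time i) \<omega>)\<^sup>2))"
      using assms(1) by (auto simp: indicator_def sum_ennreal ennreal_mult'[symmetric])
  qed
  also have "\<dots> = ennreal (1 / R) * (\<Sum>i\<in>I. \<integral>\<^sup>+\<omega>. ennreal ((reg (time i) \<omega>)\<^sup>2) \<partial>M)"
    by (simp add: nn_integral_cmult nn_integral_sum del: sum_ennreal)
  also have "\<dots> \<le> ennreal (1 / R) * (\<Sum>i\<in>I. ennreal ?v)"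
    by (intro mult_left_mono sum_mono reg_second_moment) auto
  also have "\<dots> = ennreal (1 / R * (real (card I) * ?v))"
    using v0 assms(1) by (subst sum_ennreal) (auto simp: ennreal_mult'[symmetric])
  also have "\<dots> \<le> ennreal (m * ?v / R)"
    using v0 assms by (intro ennreal_leI) (simp add: divide_right_mono mult_right_mono)
  finally show ?thesis .
qed

text \<open>The four summands match four cases: large early energy, large late energy, late
  log-likelihood exceeding its energy term by more than \<open>\<delta>\<close>, and none of these.
  In the last case the late likelihood is at most
  \<open>exp (\<delta> + RL / \<sigma>\<^sup>2)\<close>, and the early one is handled by
  truncation.\<close>

lemma hit_probability_le:
  assumes pos: "0 < l1_norm p \<theta>" and R: "0 < R" and RL: "0 < RL" and G: "G \<in> sets Z" and \<tau>: "0 < \<tau>"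
  shows "emeasure M {\<omega> \<in> space M. X \<omega> \<in> G}
     \<le> ennreal (real p * ((1 / \<eta>)\<^sup>2 * (\<sigma>\<^sup>2 * (\<Sum>l = 1..p. (\<theta> l)\<^sup>2))) / R)
      + ennreal (2 * real n * ((1 / \<eta>)\<^sup>2 * (\<sigma>\<^sup>2 * (\<Sum>l = 1..p. (\<theta> l)\<^sup>2))) / RL)
      + ennreal (exp (- \<delta>))
      + ennreal (exp (\<delta> + RL / \<sigma>\<^sup>2)) * (ennreal \<tau> * emeasure Q G + ennreal (exp ((l1_norm p \<theta>)\<^sup>2 * R / (2 * \<eta>\<^sup>2 * \<sigma>\<^sup>2)) / \<tau>))"
proof -
  interpret LF: prob_space LF by (rule prob_LF)
  interpret Q: prob_space Q by (rule prob_Q)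
  let ?A1 = "\<lambda>\<omega>. indicator {\<omega>. R < (\<Sum>i\<in>{..<q}. (reg (time i) \<omega>)\<^sup>2)} \<omega> :: ennreal"
  let ?A2 = "\<lambda>\<omega>. indicator {\<omega>. RL < (\<Sum>i\<in>{q..<N}. (reg (time i) \<omega>)\<^sup>2)} \<omega> :: ennreal"
  \<comment> \<open>The late log-likelihood minus the late energy divided by
    \<open>\<sigma>\<^sup>2\<close>; by \<open>lr_double\<close> its exponential has expectation
    1.\<close>
  define D where "D y z = (\<Sum>i\<in>{q..<N}. (z i * U y i z - 3 / 2 * (U y i z)\<^sup>2) / \<sigma>\<^sup>2)" for y z
  define A3 where "A3 yz = ennreal (exp (- \<delta>)) * (\<Prod>i\<in>{q..<N}. ennreal (exp ((snd yz i * U (fst yz) i (snd yz) - 3 / 2 * (U (fst yz) i (snd yz))\<^sup>2) / \<sigma>\<^sup>2)))" for yz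
  define A4 where "A4 yz = indicator G (snd yz) * (indicator {y. energy y \<le> R} (fst yz) * indicator {yz. late (fst yz) (snd yz) \<le> exp (\<delta> + RL / \<sigma>\<^sup>2)} yz :: ennreal)" for yz
  have A3m: "A3 \<in> borel_measurable (S \<Otimes>\<^sub>M Z)"
  proof -
    have "(\<lambda>yz. ennreal (exp ((snd yz i * U (fst yz) i (snd yz) - 3 / 2 * (U (fst yz) i (snd yz))\<^sup>2) / \<sigma>\<^sup>2))) \<in> borel_measurable (S \<Otimes>\<^sub>M Z)"
      if "i \<in> {q..<N}" for i
    proof -
      have i: "i < N" using that by simp
      show ?thesis using z_meas[OF i] U_meas[OF i] by measurable
    qed
    then show ?thesis
      unfolding A3_def[abs_def]
      by (intro borel_measurable_times_ennreal borel_measurable_const borel_measurable_prod_ennreal)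
  qed
  have A4m: "A4 \<in> borel_measurable (S \<Otimes>\<^sub>M Z)"
  proof -
    have "{y \<in> space S. energy y \<le> R} \<in> sets S" using energy_meas by measurable
    then have "(\<lambda>y. indicator {y. energy y \<le> R} y :: ennreal) \<in> borel_measurable S"
      by (subst borel_measurable_indicator_iff) (auto simp: Int_def conj_commute)
    moreover have "{yz \<in> space (S \<Otimes>\<^sub>M Z). late (fst yz) (snd yz) \<le> exp (\<delta> + RL / \<sigma>\<^sup>2)} \<in> sets (S \<Otimes>\<^sub>M Z)"
      using late_meas by measurable
    then have "(\<lambda>yz. indicator {yz. late (fst yz) (snd yz) \<le> exp (\<delta> + RL / \<sigma>\<^sup>2)} yz :: ennreal) \<in> borel_measurable (S \<Otimes>\<^sub>M Z)"
      by (subst borel_measurable_indicator_iff) (auto simp: Int_def conj_commute)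
    moreover have "(\<lambda>z. indicator G z :: ennreal) \<in> borel_measurable Z" using G by simp
    ultimately show ?thesis
      unfolding A4_def[abs_def]
      by (intro borel_measurable_times_ennreal measurable_compose[OF measurable_snd, where g = "\<lambda>z. indicator G z"]
          measurable_compose[OF measurable_fst, where g = "\<lambda>y. indicator {y. energy y \<le> R} y"])
  qed
  have split: "AE \<omega> in M. indicator {\<omega> \<in> space M. X \<omega> \<in> G} \<omega> \<le> ?A1 \<omega> + ?A2 \<omega> + A3 (F \<omega>, X \<omega>) + A4 (F \<omega>, X \<omega>)"
    using X_AE
  proof eventually_elim
    case (elim \<omega>)
    have U: "U (F \<omega>) i (X \<omega>) = reg (time i) \<omega>" if "i < N" for i using elim that by auto
    have en: "energy (F \<omega>) = (\<Sum>i\<in>{..<q}. (reg (time i) \<omega>)\<^sup>2)"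
      unfolding energy_def
    proof (intro sum.cong refl)
      fix i assume "i \<in> {..<q}"
      then have i: "i < q" by simp
      have "U (F \<omega>) i (X \<omega>) = reg (time i) \<omega>" using i q_le_N by (intro U) simp
      then show "(V (F \<omega>) i)\<^sup>2 = (reg (time i) \<omega>)\<^sup>2" unfolding U_V[OF i] by (rule arg_cong)
    qed
    have A3: "A3 (F \<omega>, X \<omega>) = ennreal (exp (D (F \<omega>) (X \<omega>) - \<delta>))"
      unfolding A3_def D_def by (simp add: prod_ennreal ennreal_mult'[symmetric] exp_sum[symmetric] exp_add[symmetric])
    have late: "late (F \<omega>) (X \<omega>) = exp (D (F \<omega>) (X \<omega>) + (\<Sum>i\<in>{q..<N}. (reg (time i) \<omega>)\<^sup>2) / \<sigma>\<^sup>2)"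
    proof -
      have "late (F \<omega>) (X \<omega>) = exp (\<Sum>i\<in>{q..<N}. (X \<omega> i * U (F \<omega>) i (X \<omega>) - (U (F \<omega>) i (X \<omega>))\<^sup>2 / 2) / \<sigma>\<^sup>2)"
        unfolding late_def lr_def by (simp add: exp_sum)
      also have "(\<Sum>i\<in>{q..<N}. (X \<omega> i * U (F \<omega>) i (X \<omega>) - (U (F \<omega>) i (X \<omega>))\<^sup>2 / 2) / \<sigma>\<^sup>2)
          = (\<Sum>i\<in>{q..<N}. (X \<omega> i * U (F \<omega>) i (X \<omega>) - 3 / 2 * (U (F \<omega>) i (X \<omega>))\<^sup>2) / \<sigma>\<^sup>2 + (reg (time i) \<omega>)\<^sup>2 / \<sigma>\<^sup>2)"
        unfolding add_divide_distrib[symmetric] using U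
          by (intro sum.cong refl arg_cong2[where f = "(/)"]) auto
      finally show ?thesis by (simp add: D_def sum.distrib sum_divide_distrib)
    qed
    show ?case
    proof (cases "X \<omega> \<in> G")
      case inG: True
      consider "R < (\<Sum>i\<in>{..<q}. (reg (time i) \<omega>)\<^sup>2)" | "RL < (\<Sum>i\<in>{q..<N}. (reg (time i) \<omega>)\<^sup>2)" | "\<delta> < D (F \<omega>) (X \<omega>)"
        | "energy (F \<omega>) \<le> R" "(\<Sum>i\<in>{q..<N}. (reg (time i) \<omega>)\<^sup>2) \<le> RL" "D (F \<omega>) (X \<omega>) \<le> \<delta>"
        unfolding en by linarith
      then show ?thesis
      proof cases
        case 3
        then have "1 \<le> A3 (F \<omega>, X \<omega>)" unfolding A3 by simp
        then have "1 \<le> (?A1 \<omega> + ?A2 \<omega>) + A3 (F \<omega>, X \<omega>)" by (rule add_increasing[OF zero_le])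
        then have "1 \<le> (?A1 \<omega> + ?A2 \<omega>) + A3 (F \<omega>, X \<omega>) + A4 (F \<omega>, X \<omega>)" by (rule add_increasing2[OF zero_le])
        moreover have "indicator {\<omega> \<in> space M. X \<omega> \<in> G} \<omega> \<le> (1 :: ennreal)" by (simp add: indicator_def)
        ultimately show ?thesis by (rule order_trans[rotated])
      next
        case 4
        have "late (F \<omega>) (X \<omega>) \<le> exp (\<delta> + RL / \<sigma>\<^sup>2)"
          unfolding late using 4 by (simp add: add_mono divide_right_mono)
        then have "A4 (F \<omega>, X \<omega>) = 1" using 4 inG by (simp add: A4_def)
        then have "1 \<le> ?A1 \<omega> + ?A2 \<omega> + A3 (F \<omega>, X \<omega>) + A4 (F \<omega>, X \<omega>)" by simp
        moreover have "indicator {\<omega> \<in> space M. X \<omega> \<in> G} \<omega> \<le> (1 :: ennreal)" by (simp add: indicator_def)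
        ultimately show ?thesis by (rule order_trans[rotated])
      next
        case 1
        then have "1 \<le> ?A1 \<omega> + (?A2 \<omega> + A3 (F \<omega>, X \<omega>) + A4 (F \<omega>, X \<omega>))" by simp
        moreover have "indicator {\<omega> \<in> space M. X \<omega> \<in> G} \<omega> \<le> (1 :: ennreal)" by (simp add: indicator_def)
        ultimately show ?thesis unfolding add.assoc[symmetric] by (rule order_trans[rotated])
      next
        case 2
        then have "1 \<le> ?A2 \<omega>" by simp
        then have "1 \<le> ?A1 \<omega> + ?A2 \<omega>" by (rule add_increasing[OF zero_le])
        then have "1 \<le> ?A1 \<omega> + ?A2 \<omega> + A3 (F \<omega>, X \<omega>)" by (rule add_increasing2[OF zero_le])
        then have "1 \<le> ?A1 \<omega> + ?A2 \<omega> + A3 (F \<omega>, X \<omega>) + A4 (F \<omega>, X \<omega>)" by (rule add_increasing2[OF zero_le])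
        moreover have "indicator {\<omega> \<in> space M. X \<omega> \<in> G} \<omega> \<le> (1 :: ennreal)" by (simp add: indicator_def)
        ultimately show ?thesis by (rule order_trans[rotated])
      qed
    qed simp
  qed
  have m: "{\<omega> \<in> space M. X \<omega> \<in> G} \<in> sets M" using measurable_sets[OF X_meas G] by (simp add: vimage_def Int_def conj_commute)
  have FX: "(\<lambda>\<omega>. (F \<omega>, X \<omega>)) \<in> M \<rightarrow>\<^sub>M S \<Otimes>\<^sub>M Z" by measurable
  have A12m: "?A1 \<in> borel_measurable M" "?A2 \<in> borel_measurable M"
    by (auto simp: borel_measurable_indicator_iff)
  have "emeasure M {\<omega> \<in> space M. X \<omega> \<in> G} = (\<integral>\<^sup>+\<omega>. indicator {\<omega> \<in> space M. X \<omega> \<in> G} \<omega> \<partial>M)"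
    using m by simp
  also have "\<dots> \<le> (\<integral>\<^sup>+\<omega>. ?A1 \<omega> + ?A2 \<omega> + A3 (F \<omega>, X \<omega>) + A4 (F \<omega>, X \<omega>) \<partial>M)"
    by (rule nn_integral_mono_AE[OF split])
  also have "\<dots> = (\<integral>\<^sup>+\<omega>. ?A1 \<omega> \<partial>M) + (\<integral>\<^sup>+\<omega>. ?A2 \<omega> \<partial>M) + (\<integral>\<^sup>+\<omega>. A3 (F \<omega>, X \<omega>) \<partial>M) + (\<integral>\<^sup>+\<omega>. A4 (F \<omega>, X \<omega>) \<partial>M)"
    using A12m measurable_compose[OF FX A3m] measurable_compose[OF FX A4m]
    by (subst nn_integral_add, simp, simp, subst nn_integral_add, simp, simp, subst nn_integral_add) simp_all
  also have "\<dots> \<le> ennreal (real p * ((1 / \<eta>)\<^sup>2 * (\<sigma>\<^sup>2 * (\<Sum>l = 1..p. (\<theta> l)\<^sup>2))) / R)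
      + ennreal (2 * real n * ((1 / \<eta>)\<^sup>2 * (\<sigma>\<^sup>2 * (\<Sum>l = 1..p. (\<theta> l)\<^sup>2))) / RL)
      + ennreal (exp (- \<delta>))
      + ennreal (exp (\<delta> + RL / \<sigma>\<^sup>2)) * (ennreal \<tau> * emeasure Q G + ennreal (exp ((l1_norm p \<theta>)\<^sup>2 * R / (2 * \<eta>\<^sup>2 * \<sigma>\<^sup>2)) / \<tau>))"
  proof (intro add_mono)
    show "(\<integral>\<^sup>+\<omega>. ?A1 \<omega> \<partial>M) \<le> ennreal (real p * ((1 / \<eta>)\<^sup>2 * (\<sigma>\<^sup>2 * (\<Sum>l = 1..p. (\<theta> l)\<^sup>2))) / R)"
      using q_le_N n_p by (intro reg_markov R) (auto simp: q_def)
    \<comment> \<open>There are \<open>N - q = 2 * n - 1\<close> late observations.\<close>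
    show "(\<integral>\<^sup>+\<omega>. ?A2 \<omega> \<partial>M) \<le> ennreal (2 * real n * ((1 / \<eta>)\<^sup>2 * (\<sigma>\<^sup>2 * (\<Sum>l = 1..p. (\<theta> l)\<^sup>2))) / RL)"
      using q_le_N n_p by (intro reg_markov RL) (auto simp: q_def N_def)
    show "(\<integral>\<^sup>+\<omega>. A3 (F \<omega>, X \<omega>) \<partial>M) \<le> ennreal (exp (- \<delta>))"
    proof -
      \<comment> \<open>Multiplying by \<open>A3\<close> doubles the drift at the late observations;
        the result is again a likelihood and integrates to 1.\<close>
      let ?a = "\<lambda>i. if i < q then 1 else 2 :: real"
      have eq: "A3 (y, z) * (\<Prod>i<N. ennreal (lr \<sigma> (z i) (U y i z))) = ennreal (exp (- \<delta>)) * (\<Prod>i<N. ennreal (lr \<sigma> (z i) (?a i * U y i z)))" for y z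
      proof -
        have "(\<Prod>i<N. ennreal (lr \<sigma> (z i) (?a i * U y i z)))
            = (\<Prod>i<q. ennreal (lr \<sigma> (z i) (U y i z))) * (\<Prod>i\<in>{q..<N}. ennreal (lr \<sigma> (z i) (2 * U y i z)))"
          unfolding prod_split by (intro arg_cong2[where f = "(*)"] prod.cong refl) auto
        also have "(\<Prod>i\<in>{q..<N}. ennreal (lr \<sigma> (z i) (2 * U y i z)))
            = (\<Prod>i\<in>{q..<N}. ennreal (exp ((z i * U y i z - 3 / 2 * (U y i z)\<^sup>2) / \<sigma>\<^sup>2))) * (\<Prod>i\<in>{q..<N}. ennreal (lr \<sigma> (z i) (U y i z)))"
          unfolding prod.distrib[symmetric] lr_double[symmetric] by (simp add: ennreal_mult')
        finally show ?thesis
          unfolding A3_def prod_split[of "\<lambda>i. ennreal (lr \<sigma> (z i) (U y i z))"] fst_conv snd_conv by (simp only: mult_ac)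
      qed
      have um: "(\<lambda>z. \<Prod>i<N. ennreal (lr \<sigma> (z i) (?a i * U y i z))) \<in> borel_measurable Q" for y
      proof -
        have "(\<lambda>z. ennreal (lr \<sigma> (z i) (?a i * U y i z))) \<in> borel_measurable Z" if "i \<in> {..<N}" for i
        proof -
          have "(\<lambda>z. z i) \<in> borel_measurable Z" using that by (rule measurable_component_singleton)
          moreover have "U y i \<in> borel_measurable Z" using that by (intro adapted_measurable[OF U_adapted]) simp
          ultimately show ?thesis
            by (intro measurable_compose[OF _ measurable_ennreal] lr_meas borel_measurable_times borel_measurable_const)
        qed
        then have "(\<lambda>z. \<Prod>i<N. ennreal (lr \<sigma> (z i) (?a i * U y i z))) \<in> borel_measurable Z"
          by (rule borel_measurable_prod_ennreal)
        then show ?thesis by (subst measurable_cong_sets[OF sets_PiM_gauss refl])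
      qed
      have "(\<integral>\<^sup>+\<omega>. A3 (F \<omega>, X \<omega>) \<partial>M) = (\<integral>\<^sup>+y. ennreal (exp (- \<delta>)) * 1 \<partial>LF)"
        unfolding law_density[OF A3m] eq
        by (simp only: nn_integral_cmult[OF um] lr_prod_integral[OF adapted_scale[OF U_adapted]])
      then show ?thesis by (simp add: LF.emeasure_space_1)
    qed
    show "(\<integral>\<^sup>+\<omega>. A4 (F \<omega>, X \<omega>) \<partial>M)
       \<le> ennreal (exp (\<delta> + RL / \<sigma>\<^sup>2)) * (ennreal \<tau> * emeasure Q G + ennreal (exp ((l1_norm p \<theta>)\<^sup>2 * R / (2 * \<eta>\<^sup>2 * \<sigma>\<^sup>2)) / \<tau>))"
    proof -
      let ?t = "ennreal (exp (\<delta> + RL / \<sigma>\<^sup>2))"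
      have pt: "A4 (y, z) * (early y z * ennreal (late y z)) \<le> ?t * (indicator G z * kern R y z)" for y z
      proof (cases "late y z \<le> exp (\<delta> + RL / \<sigma>\<^sup>2)")
        case True
        then have "early y z * ennreal (late y z) \<le> early y z * ?t"
          by (intro mult_left_mono ennreal_leI) auto
        then show ?thesis using True by (auto simp: A4_def kern_def indicator_def mult.commute)
      qed (simp add: A4_def)
      have k2: "(\<lambda>yz. indicator G (snd yz) * kern R (fst yz) (snd yz)) \<in> borel_measurable (LF \<Otimes>\<^sub>M Q)"
      proof -
        have "(\<lambda>yz. indicator G (snd yz) * kern R (fst yz) (snd yz)) \<in> borel_measurable (S \<Otimes>\<^sub>M Z)"
          using G by (intro borel_measurable_times_ennreal kern_meas measurable_compose[OF measurable_snd]) auto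
        then show ?thesis by (subst measurable_cong_sets[OF sets_pair_measure_cong[OF sets_LF sets_PiM_gauss] refl])
      qed
      have kz: "(\<lambda>z. indicator G z * kern R y z) \<in> borel_measurable Q" if "y \<in> space LF" for y
        using measurable_compose[OF measurable_Pair1'[OF that] k2] by simp
      have km: "(\<lambda>y. \<integral>\<^sup>+z. indicator G z * kern R y z \<partial>Q) \<in> borel_measurable LF"
        using k2 by (intro Q.borel_measurable_nn_integral) (simp add: split_beta')
      have "(\<integral>\<^sup>+\<omega>. A4 (F \<omega>, X \<omega>) \<partial>M) \<le> (\<integral>\<^sup>+y. \<integral>\<^sup>+z. ?t * (indicator G z * kern R y z) \<partial>Q \<partial>LF)"
        unfolding law_density[OF A4m] density_split by (intro nn_integral_mono pt)
      also have "\<dots> = (\<integral>\<^sup>+y. ?t * (\<integral>\<^sup>+z. indicator G z * kern R y z \<partial>Q) \<partial>LF)"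
        by (intro nn_integral_cong nn_integral_cmult kz)
      also have "\<dots> = ?t * (\<integral>\<^sup>+y. \<integral>\<^sup>+z. indicator G z * kern R y z \<partial>Q \<partial>LF)"
        by (rule nn_integral_cmult[OF km])
      also have "\<dots> \<le> ?t * (ennreal \<tau> * emeasure Q G + ennreal (exp ((l1_norm p \<theta>)\<^sup>2 * R / (2 * \<eta>\<^sup>2 * \<sigma>\<^sup>2)) / \<tau>))"
        using R by (intro mult_left_mono early_bound pos G \<tau>) auto
      finally show ?thesis .
    qed
  qed
  finally show ?thesis .
qed

end

subsection \<open>The hypotheses\<close>

text \<open>Consecutive blocks of \<open>B\<close> lags start just above \<open>p - n\<close>, and
  \<open>J b\<close> is the position chosen in block \<open>b\<close>.\<close>

definition lag :: "nat \<Rightarrow> nat \<Rightarrow> nat \<Rightarrow> (nat \<Rightarrow> nat) \<Rightarrow> nat \<Rightarrow> nat" where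
  "lag p n B J b = p - n + 1 + (b * B + J b)"

definition hyp :: "real \<Rightarrow> nat \<Rightarrow> nat \<Rightarrow> nat \<Rightarrow> nat \<Rightarrow> (nat \<Rightarrow> nat) \<Rightarrow> (nat \<Rightarrow> real)" where
  "hyp a p n s B J = (\<lambda>l\<in>{1..p}. if l \<in> lag p n B J ` {..<s} then a else 0)"

lemma lag_eq_iff:
  assumes "J b < B" "J' b' < B"
  shows "lag p n B J b = lag p n B J' b' \<longleftrightarrow> b = b' \<and> J b = J' b'"
proof
  assume "lag p n B J b = lag p n B J' b'"
  then have e: "b * B + J b = b' * B + J' b'" by (simp add: lag_def)
  then have "(b * B + J b) div B = (b' * B + J' b') div B" by simp
  then have "b = b'" using assms by simp
  then show "b = b' \<and> J b = J' b'" using e by simp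
qed (elim conjE, simp add: lag_def)

lemma lag_range:
  assumes "s * B \<le> n" "n < p" "b < s" "J b < B"
  shows "lag p n B J b \<in> {1..p}" "p - n < lag p n B J b"
proof -
  have "Suc b * B \<le> s * B" using assms by (intro mult_right_mono) auto
  then have "b * B + J b < n" using assms by simp
  then show "lag p n B J b \<in> {1..p}" "p - n < lag p n B J b" using assms by (auto simp: lag_def)
qed

context
  fixes a :: real and p n s B :: nat and J :: "nat \<Rightarrow> nat"
  assumes sB: "s * B \<le> n" "n < p" and J: "J \<in> {..<s} \<rightarrow>\<^sub>E {..<B}"
begin

lemma J_less: "b < s \<Longrightarrow> J b < B"
  using J by (auto simp: PiE_iff)

lemma inj_lag: "inj_on (lag p n B J) {..<s}"
  using J_less lag_eq_iff by (auto simp: inj_on_def)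

lemma lag_subset: "lag p n B J ` {..<s} \<subseteq> {1..p}"
  using lag_range[OF sB] J_less by blast

lemma sum_hyp:
  assumes "f 0 = 0"
  shows "(\<Sum>l = 1..p. f (hyp a p n s B J l)) = real s * f a"
proof -
  have "(\<Sum>l = 1..p. f (hyp a p n s B J l)) = (\<Sum>l\<in>lag p n B J ` {..<s}. f a)"
    using lag_subset assms by (intro sum.mono_neutral_cong_right) (auto simp: hyp_def)
  also have "\<dots> = real s * f a" by (simp add: card_image[OF inj_lag])
  finally show ?thesis .
qed

lemma hyp_sparse: "sparse p s (hyp a p n s B J)"
proof -
  have "card {l \<in> {1..p}. hyp a p n s B J l \<noteq> 0} \<le> card (lag p n B J ` {..<s})"
    by (intro card_mono) (auto simp: hyp_def split: if_splits)
  then show ?thesis by (simp add: sparse_def card_image[OF inj_lag])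
qed

lemma hyp_long_lags:
  assumes "1 \<le> l" "l \<le> p - n"
  shows "hyp a p n s B J l = 0"
proof -
  have "l \<notin> lag p n B J ` {..<s}"
    using lag_range(2)[OF sB] J_less assms(2) by fastforce
  moreover have "l \<in> {1..p}" using assms by auto
  ultimately show ?thesis by (simp add: hyp_def)
qed

text \<open>In each block where the choices differ, the lag chosen by \<open>J\<close> contributes
  \<open>a\<^sup>2\<close>; the lag chosen by \<open>J'\<close> contributes as much again and is not
  counted.\<close>

lemma hyp_distance:
  assumes J': "J' \<in> {..<s} \<rightarrow>\<^sub>E {..<B}"
  shows "a\<^sup>2 * real (card {b \<in> {..<s}. J b \<noteq> J' b}) \<le> (\<Sum>l = 1..p. (hyp a p n s B J l - hyp a p n s B J' l)\<^sup>2)"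
proof -
  let ?D = "{b \<in> {..<s}. J b \<noteq> J' b}"
  have J'l: "b < s \<Longrightarrow> J' b < B" for b using J' by (auto simp: PiE_iff)
  have inj: "inj_on (lag p n B J) ?D" using inj_lag by (rule inj_on_subset) auto
  have sub: "lag p n B J ` ?D \<subseteq> {1..p}" using lag_subset by auto
  have val: "(hyp a p n s B J l - hyp a p n s B J' l)\<^sup>2 = a\<^sup>2" if "l \<in> lag p n B J ` ?D" for l
  proof -
    obtain b where b: "b < s" "J b \<noteq> J' b" "l = lag p n B J b" using \<open>l \<in> _\<close> by auto
    have "l \<notin> lag p n B J' ` {..<s}"
    proof
      assume "l \<in> lag p n B J' ` {..<s}"
      then obtain b' where "b' < s" "lag p n B J b = lag p n B J' b'" using b(3) by auto
      then show False using b lag_eq_iff[of J b B J' b'] J_less J'l by auto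
    qed
    moreover have "l \<in> {1..p}" "l \<in> lag p n B J ` {..<s}" using sub \<open>l \<in> _\<close> b by auto
    ultimately show ?thesis by (simp add: hyp_def)
  qed
  have "a\<^sup>2 * real (card ?D) = (\<Sum>l\<in>lag p n B J ` ?D. a\<^sup>2)"
    using card_image[OF inj] by (simp add: mult.commute)
  also have "\<dots> = (\<Sum>l\<in>lag p n B J ` ?D. (hyp a p n s B J l - hyp a p n s B J' l)\<^sup>2)"
    using val by (intro sum.cong) auto
  also have "\<dots> \<le> (\<Sum>l = 1..p. (hyp a p n s B J l - hyp a p n s B J' l)\<^sup>2)"
    using sub by (intro sum_mono2) auto
  finally show ?thesis .
qed

end

text \<open>A member is encoded by the set where it differs from \<open>J0\<close> and its values
  there. There are at most \<open>2 ^ s\<close> such sets, and fewer than \<open>s / 4\<close> free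
  values on each.\<close>

lemma hamming_ball_card:
  assumes J0: "J0 \<in> {..<s} \<rightarrow>\<^sub>E {..<B}" and B: "1 \<le> B"
  shows "real (card {J \<in> {..<s} \<rightarrow>\<^sub>E {..<B}. 4 * card {b \<in> {..<s}. J b \<noteq> J0 b} < s}) \<le> 2 ^ s * real B powr (real s / 4)"
proof -
  let ?A = "{J \<in> {..<s} \<rightarrow>\<^sub>E {..<B}. 4 * card {b \<in> {..<s}. J b \<noteq> J0 b} < s}"
  let ?DD = "{D. D \<subseteq> {..<s} \<and> 4 * card D < s}"
  let ?h = "\<lambda>J. ({b \<in> {..<s}. J b \<noteq> J0 b}, restrict J {b \<in> {..<s}. J b \<noteq> J0 b})"
  have finDD: "finite ?DD" by (rule finite_subset[of _ "Pow {..<s}"]) auto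
  have cDD: "card ?DD \<le> 2 ^ s"
    using card_mono[of "Pow {..<s}" ?DD] by (auto simp: card_Pow)
  have "inj_on ?h ?A"
  proof (rule inj_onI)
    fix J J' assume JJ: "J \<in> ?A" "J' \<in> ?A" and eq: "?h J = ?h J'"
    let ?D = "{b \<in> {..<s}. J b \<noteq> J0 b}"
    have D: "?D = {b \<in> {..<s}. J' b \<noteq> J0 b}" using arg_cong[OF eq, of fst] unfolding fst_conv .
    have r: "restrict J ?D = restrict J' ?D" using arg_cong[OF eq, of snd] unfolding snd_conv D[symmetric] .
    have "J b = J' b" for b
    proof (cases "b < s")
      case True
      show ?thesis
      proof (cases "b \<in> ?D")
        case True then show ?thesis using fun_cong[OF r, of b] by simp
      next
        case False
        then have "J b = J0 b" "J' b = J0 b" using D \<open>b < s\<close> by auto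
        then show ?thesis by simp
      qed
    next
      case False
      then show ?thesis using JJ by (auto simp: PiE_def extensional_def)
    qed
    then show "J = J'" by auto
  qed
  moreover have "?h ` ?A \<subseteq> (SIGMA D:?DD. D \<rightarrow>\<^sub>E {..<B})" by (auto simp: PiE_iff split: if_splits)
  moreover have "finite (SIGMA D:?DD. D \<rightarrow>\<^sub>E {..<B})"
    using finDD by (intro finite_SigmaI finite_PiE) (auto intro: finite_subset)
  ultimately have "card ?A \<le> card (SIGMA D:?DD. D \<rightarrow>\<^sub>E {..<B})" by (rule card_inj_on_le)
  also have "\<dots> = (\<Sum>D\<in>?DD. B ^ card D)"
    using finDD by (subst card_SigmaI) (auto intro!: sum.cong simp: card_PiE finite_PiE dest: finite_subset intro: finite_subset[of _ "{..<s}"])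
  finally have "real (card ?A) \<le> (\<Sum>D\<in>?DD. real B ^ card D)" by (metis (mono_tags, lifting) of_nat_le_iff of_nat_power of_nat_sum sum.cong)
  also have "\<dots> \<le> (\<Sum>D\<in>?DD. real B powr (real s / 4))"
  proof (rule sum_mono)
    fix D assume "D \<in> ?DD"
    then have "real (card D) \<le> real s / 4" by auto
    then have "real B powr real (card D) \<le> real B powr (real s / 4)" using B by (intro powr_mono) auto
    then show "real B ^ card D \<le> real B powr (real s / 4)" using B by (simp add: powr_realpow)
  qed
  also have "\<dots> = real (card ?DD) * real B powr (real s / 4)" by simp
  also have "\<dots> \<le> 2 ^ s * real B powr (real s / 4)"
  proof (rule mult_right_mono)
    have "real (card ?DD) \<le> real (2 ^ s)" using cDD by (rule of_nat_mono)
    then show "real (card ?DD) \<le> 2 ^ s" by simp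
  qed simp
  finally show ?thesis .
qed

subsection \<open>The lower bound\<close>

definition observe :: "nat \<Rightarrow> nat \<Rightarrow> (int \<Rightarrow> real) \<Rightarrow> (nat \<Rightarrow> real)" where
  "observe n p \<omega> = (\<lambda>i\<in>{..<n + p}. \<omega> (int i + 1 - int p))"

definition rebuild :: "nat \<Rightarrow> nat \<Rightarrow> (nat \<Rightarrow> real) \<Rightarrow> (int \<Rightarrow> real)" where
  "rebuild n p z = (\<lambda>k\<in>obs_times n p. z (nat (k + int p - 1)))"

lemma rebuild_observe: "rebuild n p (observe n p \<omega>) = restrict \<omega> (obs_times n p)"
  unfolding rebuild_def observe_def obs_times_def by (intro ext) (auto simp: restrict_def)

lemma rebuild_meas: "rebuild n p \<in> PiM {..<n + p} (\<lambda>_. borel) \<rightarrow>\<^sub>M PiM (obs_times n p) (\<lambda>_. borel)"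
  unfolding rebuild_def
  by (intro measurable_restrict measurable_component_singleton) (auto simp: obs_times_def)

text \<open>A norm of at most \<open>1 / 2\<close> allows the analysis to run with
  \<open>1 / 2\<close> in place of \<open>\<eta>\<close>, so the constants of the lower bound do not
  depend on \<open>\<eta>\<close>. The factor 4 is the square of the total weight 2 of the moving
  average.\<close>

lemma gaussian_hit:
  assumes \<theta>: "\<theta> \<in> {1..p} \<rightarrow>\<^sub>E UNIV" and nm: "l1_norm p \<theta> \<le> 1 - \<eta>" "l1_norm p \<theta> \<le> 1 / 2" "0 < l1_norm p \<theta>"
    and pos: "0 < \<eta>" "0 < \<sigma>" and K: "1 \<le> K" and np: "1 \<le> n" "n < p"
    and long: "\<forall>l \<in> {1..p - n}. \<theta> l = 0"
  shows "\<exists>P. (\<theta>, P) \<in> AR_laws \<eta> \<sigma> K p \<and> observe n p \<in> P \<rightarrow>\<^sub>M PiM {..<n + p} (\<lambda>_. borel) \<and>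
    (\<forall>G \<in> sets (PiM {..<n + p} (\<lambda>_. borel)). \<forall>R > 0. \<forall>RL > 0. \<forall>\<delta>. \<forall>\<tau> > 0.
      emeasure P {\<omega> \<in> space P. observe n p \<omega> \<in> G}
      \<le> ennreal (real p * (4 * (\<sigma>\<^sup>2 * (\<Sum>l = 1..p. (\<theta> l)\<^sup>2))) / R)
      + ennreal (2 * real n * (4 * (\<sigma>\<^sup>2 * (\<Sum>l = 1..p. (\<theta> l)\<^sup>2))) / RL)
      + ennreal (exp (- \<delta>))
      + ennreal (exp (\<delta> + RL / \<sigma>\<^sup>2)) * (ennreal \<tau> * emeasure (PiM {..<n + p} (\<lambda>_. gauss \<sigma>)) G
          + ennreal (exp (2 * (l1_norm p \<theta>)\<^sup>2 * R / \<sigma>\<^sup>2) / \<tau>)))"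
proof -
  obtain P w where law: "(\<theta>, P) \<in> AR_laws \<eta> \<sigma> K p" and ar: "AR_process P p \<theta> \<sigma> K (\<lambda>k \<omega>. \<omega> k) w"
    and g: "\<And>k. distr P borel (w k) = gauss \<sigma>"
    using gaussian_AR_law_exists[OF \<theta> nm(1) pos K] by metis
  interpret ar_gauss P p \<theta> \<sigma> K "1 / 2" "\<lambda>k \<omega>. \<omega> k" w n
    by unfold_locales (use ar nm pos np long g in auto)
  have four: "(1 / (1 / 2))\<^sup>2 = (4 :: real)" by (simp add: power2_eq_square)
  have ex: "(l1_norm p \<theta>)\<^sup>2 * R / (2 * (1 / 2)\<^sup>2 * \<sigma>\<^sup>2) = 2 * (l1_norm p \<theta>)\<^sup>2 * R / \<sigma>\<^sup>2" for R
    by (simp add: power2_eq_square)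
  have X: "X = observe n p" by (simp add: fun_eq_iff X_def observe_def N_def time_def)
  show ?thesis
  proof (intro exI[of _ P] conjI ballI allI impI law)
    show "observe n p \<in> P \<rightarrow>\<^sub>M PiM {..<n + p} (\<lambda>_. borel)"
      using X_meas by (simp add: X N_def)
    fix G :: "(nat \<Rightarrow> real) set" and R RL \<delta> \<tau> :: real
    assume "G \<in> sets (PiM {..<n + p} (\<lambda>_. borel))" "0 < R" "0 < RL" "0 < \<tau>"
    then show "emeasure P {\<omega> \<in> space P. observe n p \<omega> \<in> G}
      \<le> ennreal (real p * (4 * (\<sigma>\<^sup>2 * (\<Sum>l = 1..p. (\<theta> l)\<^sup>2))) / R)
      + ennreal (2 * real n * (4 * (\<sigma>\<^sup>2 * (\<Sum>l = 1..p. (\<theta> l)\<^sup>2))) / RL)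
      + ennreal (exp (- \<delta>))
      + ennreal (exp (\<delta> + RL / \<sigma>\<^sup>2)) * (ennreal \<tau> * emeasure (PiM {..<n + p} (\<lambda>_. gauss \<sigma>)) G
          + ennreal (exp (2 * (l1_norm p \<theta>)\<^sup>2 * R / \<sigma>\<^sup>2) / \<tau>))"
      using hit_probability_le[OF nm(3), of R RL G \<tau> \<delta>] unfolding X N_def four ex by simp
  qed
qed

lemma esqrt_ge:
  assumes "ennreal (b\<^sup>2) \<le> a" "0 \<le> b"
  shows "ennreal b \<le> esqrt a"
proof (cases "a = top")
  case False
  then have "b\<^sup>2 \<le> enn2real a"
    using enn2real_mono[OF assms(1)] by (simp add: top.not_eq_extremum)
  then have "sqrt (b\<^sup>2) \<le> sqrt (enn2real a)" by (rule real_sqrt_le_mono)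
  then show ?thesis using assms False by (simp add: esqrt_def ennreal_leI)
qed (simp add: esqrt_def)

text \<open>If the bounds on the hit probabilities average at most \<open>1 / 2\<close> over all
  choices \<open>J\<close>, then some \<open>J\<close> is missed with probability at least
  \<open>1 / 2\<close>. That law alone gives the risk bound.\<close>

lemma est_risk_ge:
  assumes pos: "0 < \<eta>" "\<eta> < 1" "0 < \<sigma>" and K: "1 \<le> K" and np: "1 \<le> n" "n < p" and s: "1 \<le> s"
    and sB: "s * B \<le> n" and B: "exp 50 \<le> real B" and lnB: "ln (real p) \<le> 2 * ln (real B)"
    and a: "a = rate n p / 64" and sa: "real s * a \<le> 1 / 2" "real s * a \<le> 1 - \<eta>"
    and sparse: "real p * (real s)\<^sup>2 * (rate n p) ^ 4 \<le> ln (real p)"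
    and T: "T \<in> estimators n p"
  shows "ennreal (sqrt (real s) * a / 8) \<le> est_risk \<eta> \<sigma> K n p s T"
proof -
  let ?r = "rate n p"
  let ?Z = "PiM {..<n + p} (\<lambda>_. borel :: real measure)"
  let ?Q = "PiM {..<n + p} (\<lambda>_. gauss \<sigma>)"
  let ?JJ = "{..<s} \<rightarrow>\<^sub>E {..<B}"
  let ?th = "\<lambda>J. hyp a p n s B J"
  \<comment> \<open>The logarithm of the number of hypotheses; all exponents below are compared with
    it.\<close>
  define \<beta> where "\<beta> = real s * ln (real B)"
  interpret Q: prob_space ?Q by (intro prob_space_PiM prob_space_gauss pos(3))
  have lnp: "0 < ln (real p)" using np by simp
  have r0: "0 < ?r" using lnp np by simp
  have a0: "0 < a" unfolding a using r0 by (rule divide_pos_pos) simp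
  have B0: "0 < real B" using B less_le_trans[OF exp_gt_zero] by blast
  then have B1: "1 \<le> B" by simp
  have lnB50: "50 \<le> ln (real B)" using B B0 by (simp add: ln_ge_iff)
  have beta: "50 * real s \<le> \<beta>" "50 \<le> \<beta>"
  proof -
    show "50 * real s \<le> \<beta>" using lnB50 mult_left_mono[OF lnB50, of "real s"] by (simp add: \<beta>_def mult.commute)
    then show "50 \<le> \<beta>" using s by linarith
  qed
  have slnp: "real s * ln (real p) \<le> 2 * \<beta>"
    using mult_left_mono[OF lnB, of "real s"] by (simp add: \<beta>_def)
  have nr: "real n * ?r\<^sup>2 = ln (real p)" using lnp np by simp
  have finJ: "finite ?JJ" by (intro finite_PiE) auto
  have cardJ: "real (card ?JJ) = exp \<beta>"
    using B0 by (simp add: card_PiE \<beta>_def exp_of_nat_mult)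
  have th: "?th J \<in> {1..p} \<rightarrow>\<^sub>E UNIV" for J by (simp add: hyp_def)
  have l1: "l1_norm p (?th J) = real s * a" if "J \<in> ?JJ" for J
    using sum_hyp[OF sB np(2) that, of abs a] a0 by (simp add: l1_norm_def)
  have l2: "(\<Sum>l = 1..p. (?th J l)\<^sup>2) = real s * a\<^sup>2" if "J \<in> ?JJ" for J
    using sum_hyp[OF sB np(2) that, of "\<lambda>t. t\<^sup>2" a] by simp
  define err where "err J z = (\<Sum>l = 1..p. (T (rebuild n p z) l - ?th J l)\<^sup>2)" for J z
  have Tm: "(\<lambda>z. T (rebuild n p z)) \<in> ?Z \<rightarrow>\<^sub>M PiM {1..p} (\<lambda>_. borel)"
    using measurable_compose[OF rebuild_meas] T by (simp add: estimators_def)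
  have errm [measurable]: "err J \<in> borel_measurable ?Z" for J
  proof -
    have "(\<lambda>z. T (rebuild n p z) l) \<in> borel_measurable ?Z" if "l \<in> {1..p}" for l
      by (rule measurable_compose[OF Tm measurable_component_singleton[OF that]])
    then show ?thesis
      unfolding err_def[abs_def]
      by (intro borel_measurable_sum borel_measurable_power borel_measurable_diff borel_measurable_const)
  qed
  \<comment> \<open>With this radius, two hypotheses close to the same estimate are at squared
    distance below \<open>s * a\<^sup>2 / 4\<close>, hence differ in fewer than a quarter of the
    blocks.\<close>
  define G where "G J = {z \<in> space ?Z. err J z < real s * a\<^sup>2 / 16}" for J
  have Gm: "G J \<in> sets ?Z" for J unfolding G_def by measurable
  have ball: "real (card {J \<in> ?JJ. z \<in> G J}) \<le> 2 ^ s * real B powr (real s / 4)" for z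
  proof (cases "{J \<in> ?JJ. z \<in> G J} = {}")
    case True
    show ?thesis unfolding True by simp
  next
    case False
    then obtain J0 where J0: "J0 \<in> ?JJ" "z \<in> G J0" by auto
    have "{J \<in> ?JJ. z \<in> G J} \<subseteq> {J \<in> ?JJ. 4 * card {b \<in> {..<s}. J b \<noteq> J0 b} < s}"
    proof safe
      fix J assume J: "J \<in> ?JJ" "z \<in> G J"
      have "a\<^sup>2 * real (card {b \<in> {..<s}. J b \<noteq> J0 b}) \<le> (\<Sum>l = 1..p. (?th J l - ?th J0 l)\<^sup>2)"
        by (rule hyp_distance[OF sB np(2) J(1) J0(1)])
      also have "\<dots> \<le> (\<Sum>l = 1..p. 2 * (T (rebuild n p z) l - ?th J l)\<^sup>2 + 2 * (T (rebuild n p z) l - ?th J0 l)\<^sup>2)"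
      proof (rule sum_mono)
        fix l
        have "(u - v)\<^sup>2 \<le> 2 * (t - u)\<^sup>2 + 2 * (t - v)\<^sup>2" for t u v :: real
          using zero_le_power2[of "(t - u) + (t - v)"] by (simp add: power2_eq_square algebra_simps)
        then show "(?th J l - ?th J0 l)\<^sup>2 \<le> 2 * (T (rebuild n p z) l - ?th J l)\<^sup>2 + 2 * (T (rebuild n p z) l - ?th J0 l)\<^sup>2" .
      qed
      also have "\<dots> = 2 * err J z + 2 * err J0 z"
        by (simp add: err_def sum.distrib sum_distrib_left)
      also have "\<dots> < real s * a\<^sup>2 / 4" using J J0 by (simp add: G_def)
      finally have "a\<^sup>2 * (4 * real (card {b \<in> {..<s}. J b \<noteq> J0 b})) < a\<^sup>2 * real s" by (simp add: mult_ac)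
      then have "4 * real (card {b \<in> {..<s}. J b \<noteq> J0 b}) < real s"
        using a0 by (simp add: mult_less_cancel_left_pos del: mult_less_cancel_left)
      then show "4 * card {b \<in> {..<s}. J b \<noteq> J0 b} < s" by linarith
    qed
    then have "card {J \<in> ?JJ. z \<in> G J} \<le> card {J \<in> ?JJ. 4 * card {b \<in> {..<s}. J b \<noteq> J0 b} < s}"
      using finJ by (intro card_mono) auto
    then show ?thesis using hamming_ball_card[OF J0(1) B1] by linarith
  qed
  have powrB: "real B powr (real s / 4) = exp (\<beta> / 4)"
    using B0 by (simp add: powr_def \<beta>_def)
  \<comment> \<open>The sum of the white-noise probabilities is the expected number of hypotheses
    near the estimate, and that number is bounded pointwise.\<close>
  have Qsum: "(\<Sum>J\<in>?JJ. Q.prob (G J)) \<le> exp (real s + \<beta> / 4)"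
  proof -
    have GQ: "G J \<in> sets ?Q" for J using Gm by (simp add: sets_PiM_gauss)
    have "ennreal (\<Sum>J\<in>?JJ. Q.prob (G J)) = (\<Sum>J\<in>?JJ. emeasure ?Q (G J))"
      unfolding Q.emeasure_eq_measure by (rule sum_ennreal[symmetric]) simp
    also have "\<dots> = (\<integral>\<^sup>+z. (\<Sum>J\<in>?JJ. indicator (G J) z) \<partial>?Q)"
      using GQ by (subst nn_integral_sum) auto
    also have "\<dots> \<le> (\<integral>\<^sup>+z. ennreal (exp (real s + \<beta> / 4)) \<partial>?Q)"
    proof (rule nn_integral_mono)
      fix z
      have "(\<Sum>J\<in>?JJ. indicator (G J) z :: ennreal) = ennreal (real (card {J \<in> ?JJ. z \<in> G J}))"
        using finJ by (simp add: indicator_def sum.If_cases Int_def ennreal_of_nat_eq_real_of_nat)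
      also have "\<dots> \<le> ennreal (2 ^ s * exp (\<beta> / 4))"
        using ball[of z] unfolding powrB by (rule ennreal_leI)
      also have "\<dots> \<le> ennreal (exp (real s + \<beta> / 4))"
      proof (rule ennreal_leI)
        have "(2 :: real) ^ s \<le> exp 1 ^ s"
          using exp_ge_add_one_self[of 1] by (intro power_mono) auto
        also have "\<dots> = exp (real s)" by (simp add: exp_of_nat_mult[symmetric])
        finally show "2 ^ s * exp (\<beta> / 4) \<le> exp (real s + \<beta> / 4)"
          by (simp add: exp_add mult_right_mono)
      qed
      finally show "(\<Sum>J\<in>?JJ. indicator (G J) z :: ennreal) \<le> ennreal (exp (real s + \<beta> / 4))" .
    qed
    also have "\<dots> = ennreal (exp (real s + \<beta> / 4))" by (simp add: Q.emeasure_space_1)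
    finally show ?thesis by (subst (asm) ennreal_le_iff) auto
  qed
  \<comment> \<open>The bound for the hit probability with both energy terms equal to
    \<open>1 / 8\<close>, \<open>\<delta> = 4\<close> and \<open>\<tau> = exp (\<beta> / 2)\<close>,
    a threshold between 1 and the number of hypotheses.\<close>
  define hit where "hit J = 1 / 4 + exp (- 4) + exp (4 + \<beta> / 32) * (exp (\<beta> / 2) * Q.prob (G J) + exp (\<beta> / 32 - \<beta> / 2))" for J
  have hits: "(\<Sum>J\<in>?JJ. hit J) \<le> real (card ?JJ) / 2"
  proof -
    have e4: "exp (- 4) \<le> 1 / (25 :: real)"
    proof -
      have "(5 :: real) \<le> exp 2" using exp_lower_Taylor_quadratic[of 2] by simp
      then have "5 * 5 \<le> exp 2 * exp (2 :: real)" by (intro mult_mono) auto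
      then have "25 \<le> exp (4 :: real)" by (simp add: exp_add[symmetric])
      then show ?thesis by (simp add: exp_minus field_simps)
    qed
    define c1 where "c1 = 1 / 4 + exp (- 4) + exp (4 + \<beta> / 32) * exp (\<beta> / 32 - \<beta> / 2)"
    define c2 where "c2 = exp (4 + \<beta> / 32) * exp (\<beta> / 2)"
    have "hit J = c1 + c2 * Q.prob (G J)" for J
      by (simp add: hit_def c1_def c2_def distrib_left mult.assoc)
    then have "(\<Sum>J\<in>?JJ. hit J) = real (card ?JJ) * c1 + c2 * (\<Sum>J\<in>?JJ. Q.prob (G J))"
      by (simp only: sum.distrib sum_constant sum_distrib_left)
    also have "\<dots> \<le> exp \<beta> * c1 + c2 * exp (real s + \<beta> / 4)"
      unfolding cardJ by (intro add_left_mono mult_left_mono Qsum) (simp add: c2_def)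
    \<comment> \<open>Besides the constant, the exponents on the left add up to
      \<open>(1 / 32 + 1 / 2 + 1 / 4) * \<beta> + s\<close>, and
      \<open>s \<le> \<beta> / 50\<close>; \<open>\<beta> \<ge> 50\<close> leaves room for both
      constants 4.\<close>
    also have "c2 * exp (real s + \<beta> / 4) \<le> exp \<beta> * exp (- 4)"
      using beta unfolding c2_def exp_add[symmetric] by simp
    also have "exp \<beta> * c1 \<le> exp \<beta> * (1 / 4 + exp (- 4) + exp (- 4))"
      using beta unfolding c1_def exp_add[symmetric] by (intro mult_left_mono add_left_mono) auto
    also have "exp \<beta> * (1 / 4 + exp (- 4) + exp (- 4)) + exp \<beta> * exp (- 4) = exp \<beta> * (1 / 4 + 3 * exp (- 4))"
      by (simp add: algebra_simps)
    also have "\<dots> \<le> exp \<beta> * (1 / 2)" using e4 by (intro mult_left_mono) auto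
    finally show ?thesis by (simp add: cardJ)
  qed
  have "\<exists>J\<in>?JJ. hit J \<le> 1 / 2"
  proof (rule ccontr)
    assume "\<not> (\<exists>J\<in>?JJ. hit J \<le> 1 / 2)"
    then have "(\<Sum>J\<in>?JJ. 1 / 2) < (\<Sum>J\<in>?JJ. hit J)"
      using finJ cardJ by (intro sum_strict_mono) (auto simp: not_le)
    then show False using hits by simp
  qed
  then obtain J where J: "J \<in> ?JJ" and hitJ: "hit J \<le> 1 / 2" by blast
  have l1p: "0 < l1_norm p (?th J)" using l1[OF J] s a0 by simp
  have n1: "l1_norm p (?th J) \<le> 1 - \<eta>" and n2: "l1_norm p (?th J) \<le> 1 / 2"
    unfolding l1[OF J] by (rule sa(2), rule sa(1))
  have long: "\<forall>l \<in> {1..p - n}. ?th J l = 0"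
    using hyp_long_lags[OF sB np(2) J] by simp
  from gaussian_hit[OF th n1 n2 l1p pos(1,3) K np long]
  obtain P where law: "(?th J, P) \<in> AR_laws \<eta> \<sigma> K p" and obs: "observe n p \<in> P \<rightarrow>\<^sub>M ?Z"
    and bound: "\<forall>G \<in> sets ?Z. \<forall>R > 0. \<forall>RL > 0. \<forall>\<delta>. \<forall>\<tau> > 0.
      emeasure P {\<omega> \<in> space P. observe n p \<omega> \<in> G}
      \<le> ennreal (real p * (4 * (\<sigma>\<^sup>2 * (\<Sum>l = 1..p. (?th J l)\<^sup>2))) / R)
      + ennreal (2 * real n * (4 * (\<sigma>\<^sup>2 * (\<Sum>l = 1..p. (?th J l)\<^sup>2))) / RL)
      + ennreal (exp (- \<delta>))
      + ennreal (exp (\<delta> + RL / \<sigma>\<^sup>2)) * (ennreal \<tau> * emeasure ?Q G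
          + ennreal (exp (2 * (l1_norm p (?th J))\<^sup>2 * R / \<sigma>\<^sup>2) / \<tau>))"
    by (elim exE conjE)
  obtain w where "ar_proc P p (?th J) \<sigma> K \<eta> (\<lambda>k \<omega>. \<omega> k) w"
    using ar_proc_of_AR_laws[OF law pos(1,3)] .
  then interpret P: ar_proc P p "?th J" \<sigma> K \<eta> "\<lambda>k \<omega>. \<omega> k" w .
  \<comment> \<open>\<open>R\<close> and \<open>RL\<close> are eight times the bounds on the
    expected early and late energies, so each Markov term is \<open>1 / 8\<close>.\<close>
  define R where "R = 32 * real p * \<sigma>\<^sup>2 * (real s * a\<^sup>2)"
  define RL where "RL = 64 * real n * \<sigma>\<^sup>2 * (real s * a\<^sup>2)"
  have R0: "0 < R" "0 < RL" using np s a0 pos by (auto simp: R_def RL_def)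
  have b1: "real p * (4 * (\<sigma>\<^sup>2 * (real s * a\<^sup>2))) / R = 1 / 8"
    using np s a0 pos by (simp add: R_def)
  have b2: "2 * real n * (4 * (\<sigma>\<^sup>2 * (real s * a\<^sup>2))) / RL = 1 / 8"
    using np s a0 pos by (simp add: RL_def)
  \<comment> \<open>The 64 in \<open>a\<close> enters here: the late energy becomes
    \<open>s * ln p / 64\<close>, a small multiple of \<open>\<beta>\<close>.\<close>
  have b3: "RL / \<sigma>\<^sup>2 \<le> \<beta> / 32"
  proof -
    have "RL / \<sigma>\<^sup>2 = real s * (real n * ?r\<^sup>2) / 64"
      using pos by (simp add: RL_def a power_divide)
    then show ?thesis unfolding nr using slnp by linarith
  qed
  \<comment> \<open>The left side is \<open>64 * p * s ^ 3 * a ^ 4\<close>, which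
    \<open>sparse\<close> turns into a small multiple of \<open>s * ln p\<close>.\<close>
  have b4: "2 * (real s * a)\<^sup>2 * R / \<sigma>\<^sup>2 \<le> \<beta> / 32"
  proof -
    have "2 * (real s * a)\<^sup>2 * R / \<sigma>\<^sup>2 = 64 / 64 ^ 4 * (real s * (real p * (real s)\<^sup>2 * ?r ^ 4))"
    proof -
      have "2 * (real s * (r / 64))\<^sup>2 * (32 * real p * \<sigma>\<^sup>2 * (real s * (r / 64)\<^sup>2)) / \<sigma>\<^sup>2
        = 64 / 64 ^ 4 * (real s * (real p * (real s)\<^sup>2 * r ^ 4))" for r
        using pos by (simp add: power_divide power_mult_distrib power2_eq_square power4_eq_xxxx)
      then show ?thesis unfolding R_def a .
    qed
    also have "\<dots> \<le> 64 / 64 ^ 4 * (real s * ln (real p))"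
      using sparse by (intro mult_left_mono) auto
    also have "\<dots> = real s * ln (real p) / 262144" by simp
    also have "\<dots> \<le> \<beta> / 32" using slnp beta(2) by simp
    finally show ?thesis .
  qed
  have PG: "P.prob {\<omega> \<in> space P. observe n p \<omega> \<in> G J} \<le> 1 / 2"
  proof -
    have "emeasure P {\<omega> \<in> space P. observe n p \<omega> \<in> G J}
      \<le> ennreal (1 / 8) + ennreal (1 / 8) + ennreal (exp (- 4))
        + ennreal (exp (4 + RL / \<sigma>\<^sup>2)) * (ennreal (exp (\<beta> / 2)) * ennreal (Q.prob (G J)) + ennreal (exp (2 * (real s * a)\<^sup>2 * R / \<sigma>\<^sup>2) / exp (\<beta> / 2)))"
      using bound[rule_format, OF Gm[of J] R0 exp_gt_zero, of 4 "\<beta> / 2"]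
      unfolding l2[OF J] b1 b2 l1[OF J] Q.emeasure_eq_measure .
    also have "\<dots> \<le> ennreal (1 / 8) + ennreal (1 / 8) + ennreal (exp (- 4))
        + ennreal (exp (4 + \<beta> / 32)) * (ennreal (exp (\<beta> / 2)) * ennreal (Q.prob (G J)) + ennreal (exp (\<beta> / 32 - \<beta> / 2)))"
    proof -
      have "exp (2 * (real s * a)\<^sup>2 * R / \<sigma>\<^sup>2) / exp (\<beta> / 2) \<le> exp (\<beta> / 32 - \<beta> / 2)"
        unfolding exp_diff using b4 by (intro divide_right_mono) auto
      moreover have "exp (4 + RL / \<sigma>\<^sup>2) \<le> exp (4 + \<beta> / 32)" using b3 by simp
      ultimately show ?thesis by (intro add_mono mult_mono order_refl ennreal_leI) auto
    qed
    also have "\<dots> = ennreal (hit J)"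
      unfolding hit_def by (simp add: ennreal_mult'[symmetric] ennreal_plus[symmetric] del: ennreal_plus)
    also have "\<dots> \<le> ennreal (1 / 2)" using hitJ by (rule ennreal_leI)
    finally show ?thesis unfolding P.emeasure_eq_measure by (subst (asm) ennreal_le_iff) auto
  qed
  have m1: "{\<omega> \<in> space P. observe n p \<omega> \<in> G J} \<in> sets P"
    using measurable_sets[OF obs Gm] by (simp add: vimage_def Int_def conj_commute)
  let ?N = "space P - {\<omega> \<in> space P. observe n p \<omega> \<in> G J}"
  have errP: "(L2_set (\<lambda>l. T (restrict \<omega> (obs_times n p)) l - ?th J l) {1..p})\<^sup>2 = err J (observe n p \<omega>)" for \<omega>
    by (simp add: L2_set_def err_def rebuild_observe sum_nonneg)
  have "ennreal ((sqrt (real s) * a / 8)\<^sup>2) \<le> ennreal (real s * a\<^sup>2 / 16 * P.prob ?N)"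
  proof (rule ennreal_leI)
    have "1 / 2 \<le> P.prob ?N" using PG P.prob_compl[OF m1] by simp
    then have "real s * a\<^sup>2 / 16 * (1 / 2) \<le> real s * a\<^sup>2 / 16 * P.prob ?N" by (intro mult_left_mono) auto
    moreover have "(sqrt (real s) * a / 8)\<^sup>2 \<le> real s * a\<^sup>2 / 16 * (1 / 2)"
      by (simp add: power_divide power_mult_distrib)
    ultimately show "(sqrt (real s) * a / 8)\<^sup>2 \<le> real s * a\<^sup>2 / 16 * P.prob ?N" by linarith
  qed
  also have "\<dots> = (\<integral>\<^sup>+\<omega>. ennreal (real s * a\<^sup>2 / 16) * indicator ?N \<omega> \<partial>P)"
  proof -
    have "ennreal (u * v) = ennreal u * ennreal v" if "0 \<le> v" for u v
      using that by (rule ennreal_mult'')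
    then show ?thesis
      using m1 by (subst nn_integral_cmult_indicator) (auto simp only: P.emeasure_eq_measure measure_nonneg sets.Diff sets.top)
  qed
  also have "\<dots> \<le> (\<integral>\<^sup>+\<omega>. ennreal ((L2_set (\<lambda>l. T (restrict \<omega> (obs_times n p)) l - ?th J l) {1..p})\<^sup>2) \<partial>P)"
  proof (rule nn_integral_mono)
    fix \<omega> assume \<omega>: "\<omega> \<in> space P"
    show "ennreal (real s * a\<^sup>2 / 16) * indicator ?N \<omega> \<le> ennreal ((L2_set (\<lambda>l. T (restrict \<omega> (obs_times n p)) l - ?th J l) {1..p})\<^sup>2)"
    proof (cases "\<omega> \<in> ?N")
      case True
      then have "real s * a\<^sup>2 / 16 \<le> err J (observe n p \<omega>)"
        using measurable_space[OF obs \<omega>] by (auto simp: G_def)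
      then show ?thesis using True unfolding errP by (simp add: ennreal_leI)
    qed simp
  qed
  finally have low: "ennreal (sqrt (real s) * a / 8) \<le> esqrt (\<integral>\<^sup>+\<omega>. ennreal ((L2_set (\<lambda>l. T (restrict \<omega> (obs_times n p)) l - ?th J l) {1..p})\<^sup>2) \<partial>P)"
    by (rule esqrt_ge) (use a0 in simp)
  have "(?th J, P) \<in> sparse_AR_laws \<eta> \<sigma> K p s"
    using law hyp_sparse[OF sB np(2) J] by (simp add: sparse_AR_laws_def)
  then show ?thesis
    unfolding est_risk_def by (rule SUP_upper2) (use low in simp)
qed

text \<open>The size condition makes the blocks longer than a multiple of \<open>sqrt p\<close>, so
  \<open>ln B\<close> is at least half of \<open>ln p\<close> and the hypotheses are numerous
  enough. The denominator is \<open>512 = 64 * 8\<close>.\<close>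

lemma minimax_risk_ge:
  assumes pos: "0 < \<eta>" "\<eta> < 1" "0 < \<sigma>" and K: "1 \<le> K" and np: "1 \<le> n" "n < p" and s: "1 \<le> s"
    and d: "2 * exp 50 + 2 \<le> d" "1 / (1 - \<eta>) \<le> d"
    and size: "real s * (d * sqrt (real p * ln (real p))) \<le> real n"
  shows "ennreal (sqrt (real s) * rate n p / 512) \<le> minimax_risk \<eta> \<sigma> K n p s"
proof -
  let ?r = "rate n p"
  define B where "B = n div s"
  have d0: "4 \<le> d" using d(1) exp_ge_add_one_self[of 50] by linarith
  have lnp: "2 / 3 \<le> ln (real p)"
  proof -
    have "ln 2 \<le> ln (real p)" using np by (subst ln_le_cancel_iff) auto
    then show ?thesis using ln2_ge_two_thirds by linarith
  qed
  have r0: "0 \<le> ?r" using np by simp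
  have sr: "real s * ?r \<le> 1 / d" by (rule sparsity_times_rate_le[OF np(2) s _ size np(1)]) (use d0 in simp)
  have half: "real s * (d * (sqrt (real p) / 2)) \<le> real n"
  proof -
    have "1 / 2 \<le> sqrt (ln (real p))" using lnp by (intro real_le_rsqrt) (simp add: power2_eq_square)
    then have "sqrt (real p) * (1 / 2) \<le> sqrt (real p * ln (real p))"
      unfolding real_sqrt_mult by (intro mult_left_mono) auto
    then have "real s * (d * (sqrt (real p) * (1 / 2))) \<le> real s * (d * sqrt (real p * ln (real p)))"
      using d0 by (intro mult_left_mono) auto
    then show ?thesis using size by simp
  qed
  have sqp: "1 \<le> sqrt (real p)" using np by simp
  \<comment> \<open>Rounding in \<open>n div s\<close> costs 1, which the summand 2 in the lower
    bound for \<open>d\<close> covers: half of \<open>2 * exp 50 + 2\<close>, minus 1, is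
    \<open>exp 50\<close>.\<close>
  have Bge: "d * (sqrt (real p) / 2) - 1 \<le> real B"
  proof -
    have "n < s * (B + 1)"
    proof -
      have "n = s * B + n mod s" by (simp add: B_def)
      moreover have "n mod s < s" using s by simp
      ultimately show ?thesis by (metis add_mult_distrib2 mult.right_neutral nat_add_left_cancel_less)
    qed
    then have "real n < real s * (real B + 1)" by (metis of_nat_1 of_nat_add of_nat_less_iff of_nat_mult)
    then have "real s * (d * (sqrt (real p) / 2)) < real s * (real B + 1)" using half by linarith
    then show ?thesis using s by simp
  qed
  have B50: "exp 50 \<le> real B"
  proof -
    have "d * (1 / 2) \<le> d * (sqrt (real p) / 2)" using sqp d0 by (intro mult_left_mono) auto
    then show ?thesis using Bge d(1) by linarith
  qed
  have Bp: "sqrt (real p) \<le> real B"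
  proof -
    have "4 * (sqrt (real p) / 2) \<le> d * (sqrt (real p) / 2)" using d0 by (intro mult_right_mono) auto
    then show ?thesis using Bge sqp by linarith
  qed
  have lnB: "ln (real p) \<le> 2 * ln (real B)"
  proof -
    have "0 < sqrt (real p)" "0 < real B" using Bp sqp by linarith+
    then have "ln (sqrt (real p)) \<le> ln (real B)" using Bp by (simp only: ln_le_cancel_iff)
    then show ?thesis using np by (simp add: ln_sqrt)
  qed
  have sa: "real s * (?r / 64) \<le> 1 / 2" "real s * (?r / 64) \<le> 1 - \<eta>"
  proof -
    have "1 / d \<le> 1" using d0 by simp
    moreover have "1 / d \<le> 1 - \<eta>" using d(2) d0 pos by (simp add: field_simps)
    moreover have "0 \<le> real s * ?r" using r0 by simp
    ultimately show "real s * (?r / 64) \<le> 1 / 2" "real s * (?r / 64) \<le> 1 - \<eta>" using sr by simp_all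
  qed
  \<comment> \<open>The square of the size condition, rewritten with
    \<open>rate n p ^ 4 = (ln p / n)\<^sup>2\<close>.\<close>
  have sparse: "real p * (real s)\<^sup>2 * ?r ^ 4 \<le> ln (real p)"
  proof -
    have "real s * (1 * sqrt (real p * ln (real p))) \<le> real s * (d * sqrt (real p * ln (real p)))"
      using d0 lnp by (intro mult_left_mono mult_right_mono) auto
    then have "(real s * sqrt (real p * ln (real p)))\<^sup>2 \<le> (real n)\<^sup>2"
      using size lnp by (intro power_mono) auto
    then have *: "(real s)\<^sup>2 * (real p * ln (real p)) \<le> (real n)\<^sup>2"
      using lnp by (simp add: power_mult_distrib)
    have "t ^ 4 = (t\<^sup>2)\<^sup>2" for t :: real by (simp add: power_mult[symmetric])
    moreover have "?r\<^sup>2 = ln (real p) / real n" using lnp np by simp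
    ultimately have r4: "?r ^ 4 = (ln (real p) / real n)\<^sup>2" by (simp only:)
    have "real p * (real s)\<^sup>2 * ?r ^ 4 = ((real s)\<^sup>2 * (real p * ln (real p))) * ln (real p) / (real n)\<^sup>2"
      unfolding r4 by (simp add: power_divide power2_eq_square)
    also have "\<dots> \<le> (real n)\<^sup>2 * ln (real p) / (real n)\<^sup>2"
      using * lnp by (intro divide_right_mono mult_right_mono) auto
    also have "\<dots> = ln (real p)" using np by simp
    finally show ?thesis .
  qed
  show ?thesis
    unfolding minimax_risk_def
  proof (rule INF_greatest)
    fix T assume T: "T \<in> estimators n p"
    have "s * B \<le> n" by (simp add: B_def)
    from est_risk_ge[OF pos K np s this B50 lnB refl sa sparse T]
    show "ennreal (sqrt (real s) * ?r / 512) \<le> est_risk \<eta> \<sigma> K n p s T" by simp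
  qed
qed

section \<open>The two bounds combined\<close>

theorem proposition1:
  fixes \<eta> \<sigma> :: real
  assumes "0 < \<eta>" "\<eta> < 1" "0 < \<sigma>"
  shows "\<exists>L \<ge> 1. \<forall>K \<ge> 1. \<exists>d0 > 0. \<exists>d1 > 0. \<exists>d2 > 0.
           lasso_guarantee \<eta> \<sigma> K d0 d1 d2 \<and>
           (\<forall>n p s T.
              n < p \<longrightarrow> 1 \<le> s \<longrightarrow>
              real s \<le> Min {(1 - \<eta>) / (sqrt (8 * pi) * \<eta>) * sqrt (real n / ln (real p)),
                            real n / (d1 * sqrt (real p * ln (real p))),
                            real n / (d0 * (ln (real p))\<^sup>2)} \<longrightarrow>
              T \<in> lasso_estimators \<eta> (reg_param d2 n p) n p \<longrightarrow>
              est_risk \<eta> \<sigma> K n p s T \<le> ennreal L * minimax_risk \<eta> \<sigma> K n p s)"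
\<comment> \<open>The quotient of the constants of the upper and the lower bound, free of
  \<open>K\<close>.\<close>
proof (rule exI[of _ "512 * (288 / \<eta> + 8)"], intro conjI allI impI)
  let ?L = "512 * (288 / \<eta> + 8)"
  show "1 \<le> ?L" using assms by (simp add: field_simps)
  fix K :: real assume K: "1 \<le> K"
  \<comment> \<open>The three summands ensure, in this order, a rate below the threshold depending
    on \<open>K\<close>, hypotheses inside the class, and sufficiently long blocks.\<close>
  define d where "d = 1 / small_rate \<eta> \<sigma> K + 1 / (1 - \<eta>) + (2 * exp 50 + 2)"
  have sm: "0 < small_rate \<eta> \<sigma> K" using small_rate_pos assms K by simp
  have parts: "0 < 1 / small_rate \<eta> \<sigma> K" "0 < 1 / (1 - \<eta>)" "0 < 2 * exp (50 :: real) + 2"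
    using sm assms by (auto intro: add_pos_pos)
  have d: "1 / small_rate \<eta> \<sigma> K \<le> d" "2 * exp 50 + 2 \<le> d" "1 / (1 - \<eta>) \<le> d" "0 < d"
    using parts unfolding d_def by linarith+
  have d2: "0 < 24 * \<sigma>\<^sup>2 / \<eta>" using assms by simp
  have guar: "lasso_guarantee \<eta> \<sigma> K 1 d (24 * \<sigma>\<^sup>2 / \<eta>)"
    by (rule lasso_guarantee_holds[OF assms K d(1)])
  have risk: "est_risk \<eta> \<sigma> K n p s T \<le> ennreal ?L * minimax_risk \<eta> \<sigma> K n p s"
    if np: "n < p" and s: "1 \<le> s"
      and small: "real s \<le> Min {(1 - \<eta>) / (sqrt (8 * pi) * \<eta>) * sqrt (real n / ln (real p)),
                            real n / (d * sqrt (real p * ln (real p))),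
                            real n / (1 * (ln (real p))\<^sup>2)}"
      and T: "T \<in> lasso_estimators \<eta> (reg_param (24 * \<sigma>\<^sup>2 / \<eta>) n p) n p" for n p s T
  proof -
    have size': "real s \<le> real n / (d * sqrt (real p * ln (real p)))" using small by simp
    \<comment> \<open>For \<open>n = 0\<close> the quotient would be 0, contradicting
      \<open>1 \<le> s\<close>.\<close>
    have n: "1 \<le> n" using size' s by (cases "n = 0") auto
    have "0 < d * sqrt (real p * ln (real p))" using d(4) n np by simp
    then have size: "real s * (d * sqrt (real p * ln (real p))) \<le> real n"
      using size' by (simp add: pos_le_divide_eq)
    have "1 / d \<le> small_rate \<eta> \<sigma> K" using d(1,4) sm by (simp add: field_simps)
    then have rate: "real s * rate n p \<le> small_rate \<eta> \<sigma> K"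
      using sparsity_times_rate_le[OF np s d(4) size n] by linarith
    have "est_risk \<eta> \<sigma> K n p s T \<le> ennreal ((288 / \<eta> + 8) * (sqrt (real s) * rate n p))"
      by (rule lasso_risk_le[OF assms K n np s rate T])
    also have "(288 / \<eta> + 8) * (sqrt (real s) * rate n p) = ?L * (sqrt (real s) * rate n p / 512)"
      by simp
    also have "ennreal \<dots> = ennreal ?L * ennreal (sqrt (real s) * rate n p / 512)"
      using assms by (intro ennreal_mult') simp
    also have "\<dots> \<le> ennreal ?L * minimax_risk \<eta> \<sigma> K n p s"
      by (intro mult_left_mono minimax_risk_ge[OF assms K n np s d(2,3) size]) auto
    finally show ?thesis .
  qed
  show "\<exists>d0 > 0. \<exists>d1 > 0. \<exists>d2 > 0.
           lasso_guarantee \<eta> \<sigma> K d0 d1 d2 \<and>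
           (\<forall>n p s T.
              n < p \<longrightarrow> 1 \<le> s \<longrightarrow>
              real s \<le> Min {(1 - \<eta>) / (sqrt (8 * pi) * \<eta>) * sqrt (real n / ln (real p)),
                            real n / (d1 * sqrt (real p * ln (real p))),
                            real n / (d0 * (ln (real p))\<^sup>2)} \<longrightarrow>
              T \<in> lasso_estimators \<eta> (reg_param d2 n p) n p \<longrightarrow>
              est_risk \<eta> \<sigma> K n p s T \<le> ennreal ?L * minimax_risk \<eta> \<sigma> K n p s)"
    by (rule exI[of _ 1], rule conjI, simp, rule exI[of _ d], rule conjI, rule d(4), rule exI[of _ "24 * \<sigma>\<^sup>2 / \<eta>"],
        rule conjI, rule d2, rule conjI, rule guar, intro allI impI, rule risk)
qed

end
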